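(* Let $n\ge1$, let $M$ be a smooth, connected, simply connected $n$-manifold and $\bar\sigma:M\to\mathbb{H}^n_\tau$ a non-degenerate Lagrangian immersion. Let $\sigma^-_{\hat\mu}=(-f^{\hat\mu},\nu^{\hat\mu}):M\to\mathbb{H}^{n+1,n}$ be a horizontal lift of $\bar\sigma$, so that $f^{\hat\mu}:M\to\mathbb{R}^{n+1}$ and $\nu^{\hat\mu}:M\to(\mathbb{R}^{n+1})^*$ are centroaffine immersions dual to each other. The following are equivalent: (i) $\bar\sigma$ is maximal; (ii) the horizontal lift $\sigma^-_{\hat\mu}:M\to\mathbb{H}^{n+1,n}$ is maximal; (iii) the affine immersion $f^{\hat\mu}$ and its dual $\nu^{\hat\mu}$ are proper affine spheres.
   Context: Everything is smooth. Pseudohyperbolic space. $V=\mathbb{R}^{n+1}\oplus(\mathbb{R}^{n+1})^*$ with $\hat{\mathbf g}((v,\alpha),(w,\beta))=\tfrac12(\alpha(w)+\beta(v))$. $\mathbb{H}^{n+1,n}=\{(v,\alpha)\in V:\alpha(v)=-1\}$ with the restricted metric $g$ of signature $(n+1,n)$. At $z=(v,\alpha)$ the horizontal space is $\mathcal{H}_z=\{(w,\beta):\alpha(w)=0=\beta(v)\}\subset T_z\mathbb{H}^{n+1,n}$ (the orthogonal complement of $\zeta_z=(v,-\alpha)$), and $\phi$ is the endomorphism with $\phi(\zeta)=0$, $\phi(w,\beta)=(w,-\beta)$ on $\mathcal{H}$. A map $\sigma:M\to\mathbb{H}^{n+1,n}$ is horizontal if $\sigma_*X\in\mathcal{H}$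 for all $X$. Para-complex hyperbolic space. $\mathbb{R}$ acts freely and properly by isometries on $\mathbb{H}^{n+1,n}$ via $t\cdot(v,\alpha)=(e^tv,e^{-t}\alpha)$; $\pi_-:\mathbb{H}^{n+1,n}\to\mathbb{H}^n_\tau:=\mathbb{H}^{n+1,n}/\mathbb{R}$ is the quotient map. $\mathbb{H}^n_\tau$ carries $\mathbf g$ (signature $(n,n)$) and $\boldsymbol\omega$ corresponding to $g|_{\mathcal H}$ and $g(\cdot,\phi\cdot)|_{\mathcal H}$ under the isomorphisms $d\pi_-:\mathcal{H}_z\to T_{\pi_-(z)}\mathbb{H}^n_\tau$. An immersion $\bar\sigma$ of an $n$-manifold is Lagrangian if $\bar\sigma^*\boldsymbol\omega=0$ and non-degenerate if its induced metric is non-degenerate. A lift of $\bar\sigma$ is a map $\sigma$ with $\pi_-\circ\sigma=\bar\sigma$; under the hypotheses of the claim a horizontal lift exists and is unique up to the $\mathbb{R}$-action. A non-degenerate immersion into a pseudo-Riemannian manifold is maximal if its mean curvature (trace of the second fundamental form with respect to the induced metric) vanishes identically. Affine notions. An immersion $f:M\to W$ into an $(n+1)$-dimensional vector space is centroaffine if $W=f_*(T_pM)\oplus\mathbb{R}f(p)$ for all $p$. Its dual is $\nu:M\to W^*$ with $\nu_p(f(p))=1$, $\nu_p(f_*X)=0$. For an immersion $f$ with transversal field $\xi$ write $D_Xf_*Y=f_*(\nabla_XY)+h(X,Y)\xi$ and $D_X\xi=-f_*(SX)+\tau(X)\xi$, with $D$ the flat connection; $(f,\xi)$ is equiaffine if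 $\tau=0$. Fix a translation-invariant volume form $\det$ on $W$. An equiaffine $(f,\xi)$ with $h$ non-degenerate is a Blaschke immersion if $\det(f_*\cdot,\dots,f_*\cdot,\xi)$ equals, up to sign, the volume form of $h$; it is a proper affine sphere if moreover $S=-\lambda\,\mathrm{Id}$ with $\lambda$ nowhere zero. A centroaffine immersion $f$ is called a proper affine sphere if $(f,cf)$ is a proper affine sphere for some non-zero constant $c$. *)

theory Defs
  imports "HOL-Analysis.Analysis"
begin

section \<open>Smooth maps and smooth manifolds\<close>

abbreviation Dmap ::
  "('e::real_normed_vector \<Rightarrow> 'w::real_normed_vector) \<Rightarrow> 'e \<Rightarrow> 'e \<Rightarrow> 'w"
  where "Dmap f x \<equiv> frechet_derivative f (at x)"

definition hess ::
  "('e::real_normed_vector \<Rightarrow> 'w::real_normed_vector) \<Rightarrow> 'e \<Rightarrow> 'e \<Rightarrow> 'e \<Rightarrow> 'w"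
  where "hess f x a b = Dmap (\<lambda>y. Dmap f y b) x a"

text \<open>Only used for open subsets \<open>S\<close> of a finite-dimensional space, where continuity of all
  iterated directional derivatives amounts to being of class \<open>C\<^sup>k\<close>.\<close>

primrec Ck_on ::
  "nat \<Rightarrow> 'e::real_normed_vector set \<Rightarrow> ('e \<Rightarrow> 'w::real_normed_vector) \<Rightarrow> bool" where
  "Ck_on 0 S f \<longleftrightarrow> continuous_on S f"
| "Ck_on (Suc k) S f \<longleftrightarrow>
     (\<forall>x\<in>S. f differentiable (at x)) \<and> (\<forall>v. Ck_on k S (\<lambda>x. Dmap f x v))"

definition smooth_on ::
  "'e::real_normed_vector set \<Rightarrow> ('e \<Rightarrow> 'w::real_normed_vector) \<Rightarrow> bool"
  where "smooth_on S f \<longleftrightarrow> (\<forall>k. Ck_on k S f)"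

text \<open>A chart is a pair of its domain and its coordinate map; the values of the coordinate map
  outside the domain are irrelevant.\<close>

type_synonym ('a, 'e) chart = "'a set \<times> ('a \<Rightarrow> 'e)"

definition crange :: "('a, 'e) chart \<Rightarrow> 'e set"
  where "crange c = snd c ` fst c"

definition param :: "('a, 'e) chart \<Rightarrow> 'e \<Rightarrow> 'a"
  where "param c = inv_into (fst c) (snd c)"

definition is_chart :: "'a topology \<Rightarrow> ('a, 'e::euclidean_space) chart \<Rightarrow> bool"
  where "is_chart T c \<longleftrightarrow> openin T (fst c) \<and> open (crange c) \<and>
    homeomorphic_map (subtopology T (fst c)) (top_of_set (crange c)) (snd c)"

definition local_dom :: "('a \<Rightarrow> 'b) \<Rightarrow> ('a, 'e) chart \<Rightarrow> ('b, 'd) chart \<Rightarrow> 'e set"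
  where "local_dom F c d = snd c ` (fst c \<inter> F -` fst d)"

definition local_rep :: "('a \<Rightarrow> 'b) \<Rightarrow> ('a, 'e) chart \<Rightarrow> ('b, 'd) chart \<Rightarrow> 'e \<Rightarrow> 'd"
  where "local_rep F c d = snd d \<circ> F \<circ> param c"

definition smooth_manifold ::
  "'a topology \<Rightarrow> ('a, 'e::euclidean_space) chart set \<Rightarrow> bool"
  where "smooth_manifold T A \<longleftrightarrow>
    Hausdorff_space T \<and> second_countable T \<and>
    (\<forall>c\<in>A. is_chart T c) \<and> (\<Union>c\<in>A. fst c) = topspace T \<and>
    (\<forall>c\<in>A. \<forall>d\<in>A. smooth_on (local_dom id c d) (local_rep id c d))"

text \<open>Since the charts cover the manifolds, openness of all \<open>local_dom F c d\<close> together with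
  smoothness of the local representatives contains the continuity of \<open>F\<close>.\<close>

definition smooth_map ::
  "('a, 'e::euclidean_space) chart set \<Rightarrow> ('b, 'd::euclidean_space) chart set \<Rightarrow>
   ('a \<Rightarrow> 'b) \<Rightarrow> bool"
  where "smooth_map A B F \<longleftrightarrow>
    F ` (\<Union>c\<in>A. fst c) \<subseteq> (\<Union>d\<in>B. fst d) \<and>
    (\<forall>c\<in>A. \<forall>d\<in>B. open (local_dom F c d) \<and> smooth_on (local_dom F c d) (local_rep F c d))"

definition smooth_vec ::
  "('a, 'e::euclidean_space) chart set \<Rightarrow> ('a \<Rightarrow> 'w::real_normed_vector) \<Rightarrow> bool"
  where "smooth_vec A f \<longleftrightarrow> (\<forall>c\<in>A. smooth_on (crange c) (f \<circ> param c))"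


section \<open>Submanifolds of pseudo-Riemannian manifolds\<close>

text \<open>A metric is given by its coordinate expressions: \<open>g d y\<close> is the bilinear form at the
  point with coordinates \<open>y\<close> in the chart \<open>d\<close>. Tangent vectors at a point are represented by
  their coordinate vectors in a chart around that point.\<close>

type_synonym ('b, 'd) metric = "('b, 'd) chart \<Rightarrow> 'd \<Rightarrow> 'd \<Rightarrow> 'd \<Rightarrow> real"

definition nondegenerate_form :: "('e::real_vector \<Rightarrow> 'e \<Rightarrow> real) \<Rightarrow> bool"
  where "nondegenerate_form m \<longleftrightarrow> (\<forall>u. (\<forall>v. m u v = 0) \<longrightarrow> u = 0)"

text \<open>\<open>christoffel m y u v\<close> is the Levi-Civita covariant derivative at \<open>y\<close>, in the direction
  \<open>u\<close>, of the vector field with constant coordinates \<open>v\<close>. It is characterised by torsion-freeness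
  (symmetry) and metric compatibility.\<close>

definition christoffel ::
  "('d::euclidean_space \<Rightarrow> 'd \<Rightarrow> 'd \<Rightarrow> real) \<Rightarrow> 'd \<Rightarrow> 'd \<Rightarrow> 'd \<Rightarrow> 'd"
  where "christoffel m y = (THE G. bilinear G \<and> (\<forall>u v. G u v = G v u) \<and>
    (\<forall>w u v. Dmap (\<lambda>y'. m y' u v) y w = m y (G w u) v + m y u (G w v)))"

definition first_form ::
  "('b, 'd::euclidean_space) metric \<Rightarrow> ('a \<Rightarrow> 'b) \<Rightarrow> ('a, 'e::euclidean_space) chart \<Rightarrow>
   ('b, 'd) chart \<Rightarrow> 'e \<Rightarrow> 'e \<Rightarrow> 'e \<Rightarrow> real"
  where "first_form g F c d x a b =
    g d (local_rep F c d x) (Dmap (local_rep F c d) x a) (Dmap (local_rep F c d) x b)"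

text \<open>The second fundamental form is the component, normal to the image of the differential, of
  the covariant derivative of \<open>F\<^sub>*b\<close> in the direction \<open>a\<close>.\<close>

definition second_form ::
  "('b, 'd::euclidean_space) metric \<Rightarrow> ('a \<Rightarrow> 'b) \<Rightarrow> ('a, 'e::euclidean_space) chart \<Rightarrow>
   ('b, 'd) chart \<Rightarrow> 'e \<Rightarrow> 'e \<Rightarrow> 'e \<Rightarrow> 'd"
  where "second_form g F c d x a b =
    (let G = local_rep F c d; y = G x;
         cov = hess G x a b + christoffel (g d) y (Dmap G x a) (Dmap G x b)
     in THE w. (\<forall>e. g d y w (Dmap G x e) = 0) \<and> cov - w \<in> range (Dmap G x))"

text \<open>The trace of \<open>B\<close> with respect to \<open>m\<close>: the vector dual to a basis element \<open>b\<close> via \<open>m\<close>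
  is the contraction of the inverse of \<open>m\<close> with the coordinate functional of \<open>b\<close>.\<close>

definition form_trace ::
  "('e::euclidean_space \<Rightarrow> 'e \<Rightarrow> real) \<Rightarrow> ('e \<Rightarrow> 'e \<Rightarrow> 'd::real_vector) \<Rightarrow> 'd"
  where "form_trace m B = (\<Sum>b\<in>Basis. B b (THE u. \<forall>v. m u v = b \<bullet> v))"

definition mean_curvature ::
  "('b, 'd::euclidean_space) metric \<Rightarrow> ('a \<Rightarrow> 'b) \<Rightarrow> ('a, 'e::euclidean_space) chart \<Rightarrow>
   ('b, 'd) chart \<Rightarrow> 'e \<Rightarrow> 'd"
  where "mean_curvature g F c d x = form_trace (first_form g F c d x) (second_form g F c d x)"

definition nondegenerate_immersion ::
  "('a, 'e::euclidean_space) chart set \<Rightarrow> ('b, 'd::euclidean_space) chart set \<Rightarrow>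
   ('b, 'd) metric \<Rightarrow> ('a \<Rightarrow> 'b) \<Rightarrow> bool"
  where "nondegenerate_immersion A B g F \<longleftrightarrow> smooth_map A B F \<and>
    (\<forall>c\<in>A. \<forall>d\<in>B. \<forall>x\<in>local_dom F c d.
       inj (Dmap (local_rep F c d) x) \<and> nondegenerate_form (first_form g F c d x))"

definition maximal ::
  "('a, 'e::euclidean_space) chart set \<Rightarrow> ('b, 'd::euclidean_space) chart set \<Rightarrow>
   ('b, 'd) metric \<Rightarrow> ('a \<Rightarrow> 'b) \<Rightarrow> bool"
  where "maximal A B g F \<longleftrightarrow> nondegenerate_immersion A B g F \<and>
    (\<forall>c\<in>A. \<forall>d\<in>B. \<forall>x\<in>local_dom F c d. mean_curvature g F c d x = 0)"


section \<open>Pseudohyperbolic space\<close>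

text \<open>With \<open>n = CARD('n)\<close>, the space \<open>\<real>\<^sup>n\<^sup>+\<^sup>1\<close> is indexed by the type \<open>'n option\<close>.\<close>

type_synonym 'n aff = "(real, 'n option) vec"
type_synonym 'n coaff = "'n aff \<Rightarrow>\<^sub>L real"
type_synonym 'n amb = "'n aff \<times> 'n coaff"

definition ghat :: "'n::finite amb \<Rightarrow> 'n amb \<Rightarrow> real"
  where "ghat z w = (blinfun_apply (snd z) (fst w) + blinfun_apply (snd w) (fst z)) / 2"

definition hyp :: "'n::finite amb set"
  where "hyp = {z. blinfun_apply (snd z) (fst z) = -1}"

definition hor :: "'n::finite amb \<Rightarrow> 'n amb set"
  where "hor z =
    {w. blinfun_apply (snd z) (fst w) = 0 \<and> blinfun_apply (snd w) (fst z) = 0}"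

text \<open>The endomorphism \<open>\<phi>\<close> on horizontal vectors.\<close>

definition phi :: "'n::finite amb \<Rightarrow> 'n amb"
  where "phi w = (fst w, - snd w)"

text \<open>The smooth structure of \<open>hyp\<close> as an embedded submanifold of the ambient vector space.\<close>

definition hyp_atlas :: "('n::finite amb, (real^'n) \<times> (real^'n) \<times> real) chart set"
  where "hyp_atlas = {c. is_chart (top_of_set hyp) c \<and> smooth_on (crange c) (param c) \<and>
    (\<forall>x\<in>crange c. inj (Dmap (param c) x))}"

definition hyp_metric :: "('n::finite amb, (real^'n) \<times> (real^'n) \<times> real) metric"
  where "hyp_metric c x a b = ghat (Dmap (param c) x a) (Dmap (param c) x b)"


section \<open>Para-complex hyperbolic space\<close>

definition act :: "real \<Rightarrow> 'n::finite amb \<Rightarrow> 'n amb"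
  where "act t z = (exp t *\<^sub>R fst z, exp (- t) *\<^sub>R snd z)"

definition proj :: "'n::finite amb \<Rightarrow> 'n amb set"
  where "proj z = range (\<lambda>t. act t z)"

definition para_hyp :: "'n::finite amb set set"
  where "para_hyp = proj ` hyp"

definition para_top :: "'n::finite amb set topology"
  where "para_top =
    topology (\<lambda>U. U \<subseteq> para_hyp \<and> openin (top_of_set hyp) {z \<in> hyp. proj z \<in> U})"

lemma openin_para_top:
  "openin para_top U \<longleftrightarrow>
     U \<subseteq> para_hyp \<and> openin (top_of_set hyp) {z \<in> hyp. proj z \<in> U}"
proof -
  have "istopology
    (\<lambda>U. U \<subseteq> para_hyp \<and> openin (top_of_set hyp) {z \<in> (hyp :: 'a amb set). proj z \<in> U})"
    unfolding istopology_def
  proof (intro conjI allI impI)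
    fix S T :: "'a amb set set"
    assume S: "S \<subseteq> para_hyp \<and> openin (top_of_set hyp) {z \<in> hyp. proj z \<in> S}"
      and T: "T \<subseteq> para_hyp \<and> openin (top_of_set hyp) {z \<in> hyp. proj z \<in> T}"
    have "{z \<in> hyp. proj z \<in> S \<inter> T} = {z \<in> hyp. proj z \<in> S} \<inter> {z \<in> hyp. proj z \<in> T}"
      by auto
    with S T show "openin (top_of_set hyp) {z \<in> hyp. proj z \<in> S \<inter> T}"
      by auto
    from S show "S \<inter> T \<subseteq> para_hyp" by auto
  next
    fix K :: "'a amb set set set"
    assume K: "\<forall>S\<in>K. S \<subseteq> para_hyp \<and> openin (top_of_set hyp) {z \<in> hyp. proj z \<in> S}"
    have "{z \<in> hyp. proj z \<in> \<Union>K} = (\<Union>S\<in>K. {z \<in> hyp. proj z \<in> S})"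
      by auto
    with K show "openin (top_of_set hyp) {z \<in> hyp. proj z \<in> \<Union>K}"
      by auto
    from K show "\<Union>K \<subseteq> para_hyp" by auto
  qed
  then show ?thesis
    by (simp add: para_top_def topology_inverse')
qed

lemma topspace_para_top: "topspace para_top = (para_hyp :: 'n::finite amb set set)"
proof -
  have "{z \<in> hyp. proj z \<in> para_hyp} = (hyp :: 'n amb set)"
    by (auto simp: para_hyp_def)
  then have "openin para_top (para_hyp :: 'n amb set set)"
    by (simp add: openin_para_top)
  then show ?thesis
    by (meson openin_para_top openin_subset openin_topspace subset_antisym)
qed

lemma quotient_map_proj: "quotient_map (top_of_set hyp) para_top proj"
  by (auto simp: quotient_map_def topspace_para_top openin_para_top para_hyp_def)

lemma ghat_act: "ghat (act t z) (act t w) = ghat z w"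
  by (simp add: ghat_def act_def blinfun.scaleR_left blinfun.scaleR_right exp_minus field_simps)

lemma act_in_hyp: "act t z \<in> hyp \<longleftrightarrow> z \<in> hyp"
  by (simp add: hyp_def act_def blinfun.scaleR_left blinfun.scaleR_right exp_minus field_simps)

lemma act_in_hor: "act t w \<in> hor (act t z) \<longleftrightarrow> w \<in> hor z"
  by (simp add: hor_def act_def blinfun.scaleR_left blinfun.scaleR_right)

text \<open>The smooth structure of the quotient: its charts are the charts of the quotient topology
  on whose domains \<open>proj\<close> is a smooth submersion.\<close>

definition para_atlas :: "('n::finite amb set, (real^'n) \<times> (real^'n)) chart set"
  where "para_atlas = {d. is_chart para_top d \<and>
    (\<forall>c\<in>hyp_atlas. smooth_on (local_dom proj c d) (local_rep proj c d) \<and>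
       (\<forall>x\<in>local_dom proj c d. surj (Dmap (local_rep proj c d) x)))}"

text \<open>The horizontal vector at \<open>z\<close> that \<open>d proj\<close> maps to the vector with coordinates \<open>a\<close>.
  The derivative within \<open>hyp\<close> is determined on vectors tangent to \<open>hyp\<close>, in particular on
  horizontal ones.\<close>

definition hlift ::
  "('n::finite amb set, (real^'n) \<times> (real^'n)) chart \<Rightarrow> 'n amb \<Rightarrow> (real^'n) \<times> (real^'n) \<Rightarrow> 'n amb"
  where "hlift d z a =
    (THE w. w \<in> hor z \<and> frechet_derivative (snd d \<circ> proj) (at z within hyp) w = a)"

text \<open>The choice of the point in the fibre is irrelevant, as the action is by isometries that
  preserve the horizontal spaces and commute with \<open>phi\<close>.\<close>

definition fibre_point ::
  "('n::finite amb set, (real^'n) \<times> (real^'n)) chart \<Rightarrow> (real^'n) \<times> (real^'n) \<Rightarrow> 'n amb"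
  where "fibre_point d y = (SOME z. z \<in> hyp \<and> proj z = param d y)"

definition para_metric :: "('n::finite amb set, (real^'n) \<times> (real^'n)) metric"
  where "para_metric d y a b =
    (let z = fibre_point d y in ghat (hlift d z a) (hlift d z b))"

definition para_omega ::
  "('n::finite amb set, (real^'n) \<times> (real^'n)) chart \<Rightarrow> (real^'n) \<times> (real^'n) \<Rightarrow>
   (real^'n) \<times> (real^'n) \<Rightarrow> (real^'n) \<times> (real^'n) \<Rightarrow> real"
  where "para_omega d y a b =
    (let z = fibre_point d y in ghat (hlift d z a) (phi (hlift d z b)))"

definition lagrangian ::
  "('a, real^'n) chart set \<Rightarrow> ('a \<Rightarrow> 'n::finite amb set) \<Rightarrow> bool"
  where "lagrangian A F \<longleftrightarrow> (\<forall>c\<in>A. \<forall>d\<in>para_atlas. \<forall>x\<in>local_dom F c d. \<forall>a b.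
    para_omega d (local_rep F c d x)
      (Dmap (local_rep F c d) x a) (Dmap (local_rep F c d) x b) = 0)"

definition horizontal ::
  "('a, 'e::euclidean_space) chart set \<Rightarrow> ('a \<Rightarrow> 'n::finite amb) \<Rightarrow> bool"
  where "horizontal A s \<longleftrightarrow>
    (\<forall>c\<in>A. \<forall>x\<in>crange c. \<forall>a. Dmap (s \<circ> param c) x a \<in> hor (s (param c x)))"

definition horizontal_lift ::
  "('a, 'e::euclidean_space) chart set \<Rightarrow> ('a \<Rightarrow> 'n::finite amb set) \<Rightarrow> ('a \<Rightarrow> 'n amb) \<Rightarrow> bool"
  where "horizontal_lift A F s \<longleftrightarrow>
    smooth_map A hyp_atlas s \<and> (\<forall>p\<in>(\<Union>c\<in>A. fst c). proj (s p) = F p) \<and> horizontal A s"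


section \<open>Affine immersions\<close>

text \<open>In this section \<open>f\<close> and \<open>\<xi>\<close> are vector-valued; the pointwise notions refer to their
  expressions in a chart of the source manifold.\<close>

definition transversal_at ::
  "('e::real_normed_vector \<Rightarrow> 'w::real_normed_vector) \<Rightarrow> ('e \<Rightarrow> 'w) \<Rightarrow> 'e \<Rightarrow> bool"
  where "transversal_at f \<xi> x \<longleftrightarrow>
    \<xi> x \<notin> range (Dmap f x) \<and> span (insert (\<xi> x) (range (Dmap f x))) = UNIV"

definition affine_immersion ::
  "('a, 'e::euclidean_space) chart set \<Rightarrow> ('a \<Rightarrow> 'w::real_normed_vector) \<Rightarrow> ('a \<Rightarrow> 'w) \<Rightarrow> bool"
  where "affine_immersion A f \<xi> \<longleftrightarrow> smooth_vec A f \<and> smooth_vec A \<xi> \<and>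
    (\<forall>c\<in>A. \<forall>x\<in>crange c.
       inj (Dmap (f \<circ> param c) x) \<and> transversal_at (f \<circ> param c) (\<xi> \<circ> param c) x)"

definition centroaffine ::
  "('a, 'e::euclidean_space) chart set \<Rightarrow> ('a \<Rightarrow> 'w::real_normed_vector) \<Rightarrow> bool"
  where "centroaffine A f \<longleftrightarrow> affine_immersion A f f"

definition is_dual ::
  "('a, 'e::euclidean_space) chart set \<Rightarrow> ('a \<Rightarrow> 'w::real_normed_vector) \<Rightarrow>
   ('a \<Rightarrow> 'w \<Rightarrow>\<^sub>L real) \<Rightarrow> bool"
  where "is_dual A f \<nu> \<longleftrightarrow>
    (\<forall>p\<in>(\<Union>c\<in>A. fst c). blinfun_apply (\<nu> p) (f p) = 1) \<and>
    (\<forall>c\<in>A. \<forall>x\<in>crange c. \<forall>a. blinfun_apply (\<nu> (param c x)) (Dmap (f \<circ> param c) x a) = 0)"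

text \<open>The components of \<open>D\<^sub>X f\<^sub>*Y = f\<^sub>*(\<nabla>\<^sub>X Y) + h(X,Y) \<xi>\<close> and of
  \<open>D\<^sub>X \<xi> = - f\<^sub>*(S X) + \<tau>(X) \<xi>\<close>.\<close>

definition affine_h ::
  "('e::real_normed_vector \<Rightarrow> 'w::real_normed_vector) \<Rightarrow> ('e \<Rightarrow> 'w) \<Rightarrow> 'e \<Rightarrow> 'e \<Rightarrow> 'e \<Rightarrow> real"
  where "affine_h f \<xi> x a b = (THE r. \<exists>u. hess f x a b = Dmap f x u + r *\<^sub>R \<xi> x)"

definition affine_shape ::
  "('e::real_normed_vector \<Rightarrow> 'w::real_normed_vector) \<Rightarrow> ('e \<Rightarrow> 'w) \<Rightarrow> 'e \<Rightarrow> 'e \<Rightarrow> 'e"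
  where "affine_shape f \<xi> x a = (THE u. \<exists>r. Dmap \<xi> x a = - Dmap f x u + r *\<^sub>R \<xi> x)"

definition affine_tau ::
  "('e::real_normed_vector \<Rightarrow> 'w::real_normed_vector) \<Rightarrow> ('e \<Rightarrow> 'w) \<Rightarrow> 'e \<Rightarrow> 'e \<Rightarrow> real"
  where "affine_tau f \<xi> x a = (THE r. \<exists>u. Dmap \<xi> x a = - Dmap f x u + r *\<^sub>R \<xi> x)"

definition equiaffine ::
  "('a, 'e::euclidean_space) chart set \<Rightarrow> ('a \<Rightarrow> 'w::real_normed_vector) \<Rightarrow> ('a \<Rightarrow> 'w) \<Rightarrow> bool"
  where "equiaffine A f \<xi> \<longleftrightarrow> affine_immersion A f \<xi> \<and>
    (\<forall>c\<in>A. \<forall>x\<in>crange c. \<forall>a. affine_tau (f \<circ> param c) (\<xi> \<circ> param c) x a = 0)"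

text \<open>A translation-invariant volume form is a non-zero alternating form of top degree.\<close>

definition volume_form :: "(('k::finite \<Rightarrow> 'w::real_vector) \<Rightarrow> real) \<Rightarrow> bool"
  where "volume_form vol \<longleftrightarrow> dim (UNIV :: 'w set) = CARD('k) \<and>
    (\<forall>i w. linear (\<lambda>u. vol (w(i := u)))) \<and>
    (\<forall>w i j. i \<noteq> j \<and> w i = w j \<longrightarrow> vol w = 0) \<and>
    (\<exists>w. vol w \<noteq> 0)"

text \<open>The volume form of \<open>h\<close> takes the value \<open>\<plusminus>sqrt \<bar>det (h (X\<^sub>i, X\<^sub>j))\<bar>\<close> on \<open>X\<^sub>1, \<dots>, X\<^sub>n\<close>. The
  transversal field is inserted at the index \<open>None\<close>; its position only affects the sign.\<close>

definition blaschke ::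
  "(('n::finite option \<Rightarrow> 'w::real_normed_vector) \<Rightarrow> real) \<Rightarrow> ('a, real^'n) chart set \<Rightarrow>
   ('a \<Rightarrow> 'w) \<Rightarrow> ('a \<Rightarrow> 'w) \<Rightarrow> bool"
  where "blaschke vol A f \<xi> \<longleftrightarrow> equiaffine A f \<xi> \<and>
    (\<forall>c\<in>A. \<forall>x\<in>crange c.
       nondegenerate_form (affine_h (f \<circ> param c) (\<xi> \<circ> param c) x) \<and>
       (\<forall>X :: 'n \<Rightarrow> real^'n.
          \<bar>vol (case_option (\<xi> (param c x)) (\<lambda>i. Dmap (f \<circ> param c) x (X i)))\<bar> =
          sqrt \<bar>det (\<chi> i j. affine_h (f \<circ> param c) (\<xi> \<circ> param c) x (X i) (X j))\<bar>))"

definition proper_affine_sphere ::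
  "(('n::finite option \<Rightarrow> 'w::real_normed_vector) \<Rightarrow> real) \<Rightarrow> ('a, real^'n) chart set \<Rightarrow>
   ('a \<Rightarrow> 'w) \<Rightarrow> ('a \<Rightarrow> 'w) \<Rightarrow> bool"
  where "proper_affine_sphere vol A f \<xi> \<longleftrightarrow> blaschke vol A f \<xi> \<and>
    (\<exists>l :: 'a \<Rightarrow> real. (\<forall>p\<in>(\<Union>c\<in>A. fst c). l p \<noteq> 0) \<and>
       (\<forall>c\<in>A. \<forall>x\<in>crange c. \<forall>a.
          affine_shape (f \<circ> param c) (\<xi> \<circ> param c) x a = - l (param c x) *\<^sub>R a))"

definition centroaffine_sphere ::
  "(('n::finite option \<Rightarrow> 'w::real_normed_vector) \<Rightarrow> real) \<Rightarrow> ('a, real^'n) chart set \<Rightarrow>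
   ('a \<Rightarrow> 'w) \<Rightarrow> bool"
  where "centroaffine_sphere vol A f \<longleftrightarrow> centroaffine A f \<and>
    (\<exists>k. k \<noteq> 0 \<and> proper_affine_sphere vol A f (\<lambda>p. k *\<^sub>R f p))"

end

theory Submission
  imports Defs
begin

text \<open>Write \<open>z = (-f, \<nu>)\<close> in a chart. Horizontality says that \<open>f\<close> and \<open>\<nu>\<close> are dual to each
  other, and the induced metric is \<open>g(a, b) = -d\<nu>(a)(df b) = \<nu>(hess f a b)\<close>, a multiple of the affine
  metric. In both target spaces the mean curvature vector vanishes if and only if the \<open>g\<close>-trace of
  \<open>hess z\<close> is orthogonal to all vectors normal to the immersion. In the pseudohyperbolic space there
  is one more normal direction than in the quotient, namely \<open>\<zeta>\<close>, but \<open>hess z\<close> is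
  orthogonal to it; so (i) and (ii) agree. The remaining normal vectors are \<open>(df c, d\<nu> c)\<close>, and the
  condition becomes the vanishing of the trace of
  \<open>C(a, b, c) = hess \<nu> a b (df c) - d\<nu> c (hess f a b)\<close>, which is totally symmetric. Hence the trace
  can be taken over the last two slots, where it is the logarithmic derivative of \<open>\<theta>\<^sup>2 / det g\<close>, with \<open>\<theta>\<close>
  the volume of the frame \<open>(f, df e\<^sub>i)\<close>. This ratio does not depend on the chart, so the trace
  vanishes if and only if the ratio is constant, and then a constant multiple \<open>k f\<close> is a Blaschke
  normal. The roles of \<open>f\<close> and \<open>\<nu>\<close> are interchangeable.\<close>

section \<open>Differential calculus\<close>

text \<open>For the transversal field \<open>k f\<close> the equiaffine condition and the scalar
  shape operator come for free, since \<open>D (k f) = k df\<close>. The volume condition is what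
  remains, and by homogeneity it reads \<open>ratio * \<bar>k\<bar> ^ (2 n + 4) = 1\<close>: the
  fourth power of the volume contributes \<open>k ^ 4\<close>, the squared determinant of
  \<open>h = g / k\<close> contributes \<open>k ^ (- 2 n)\<close>. Hence every constant positive
  ratio can be normalised by a root. Exchanging f and \<nu> only changes the sign of the trace of
  \<open>C\<close>, so one condition governs both spheres, whatever the two volume forms. The
  technical obstacle is the quotient: its metric is given by horizontal lifts at an arbitrary point
  of the fibre, whereas Christoffel symbols need derivatives of the metric. They come from a local
  section of the projection that is horizontal at one point and has a second derivative at that
  point. Both mean curvatures are tested by pairing with normal vectors, where the covariant
  derivative may be replaced by the ambient Hessian, so that neither a connection nor a normal
  projection has to be written out.\<close>

lemma Dmap_works: "f differentiable (at x) \<Longrightarrow> (f has_derivative Dmap f x) (at x)"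
  using frechet_derivative_works by blast

lemma Dmap_eq: "(f has_derivative f') (at x) \<Longrightarrow> Dmap f x = f'"
  by (rule frechet_derivative_at[symmetric])

lemma has_derivative_cong_open:
  assumes "open S" "x \<in> S" "\<And>y. y \<in> S \<Longrightarrow> f y = g y"
  shows "(f has_derivative D) (at x) \<longleftrightarrow> (g has_derivative D) (at x)"
proof
  assume "(f has_derivative D) (at x)"
  then show "(g has_derivative D) (at x)"
    by (rule has_derivative_transform_within_open[OF _ assms])
next
  assume "(g has_derivative D) (at x)"
  then show "(f has_derivative D) (at x)"
    by (rule has_derivative_transform_within_open[OF _ assms(1,2)]) (simp add: assms(3))
qed

lemma Dmap_cong_open:
  assumes "open S" "x \<in> S" "\<And>y. y \<in> S \<Longrightarrow> f y = g y"
  shows "Dmap f x = Dmap g x"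
  unfolding frechet_derivative_def using has_derivative_cong_open[of S x f g, OF assms] by presburger

lemma differentiable_cong_open:
  assumes "open S" "x \<in> S" "\<And>y. y \<in> S \<Longrightarrow> f y = g y"
  shows "f differentiable (at x) \<longleftrightarrow> g differentiable (at x)"
  unfolding differentiable_def using has_derivative_cong_open[of S x f g, OF assms] by presburger

lemma linear_Dmap: "f differentiable (at x) \<Longrightarrow> linear (Dmap f x)"
  by (rule has_derivative_linear[OF Dmap_works])

lemma Dmap_compose:
  assumes "f differentiable (at x)" "g differentiable (at (f x))"
  shows "(\<lambda>y. g (f y)) differentiable (at x)"
    and "Dmap (\<lambda>y. g (f y)) x a = Dmap g (f x) (Dmap f x a)"
proof -
  have "(g \<circ> f has_derivative Dmap g (f x) \<circ> Dmap f x) (at x)"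
    using assms by (intro diff_chain_at Dmap_works)
  then have h: "((\<lambda>y. g (f y)) has_derivative Dmap g (f x) \<circ> Dmap f x) (at x)"
    by (simp add: comp_def)
  then show "(\<lambda>y. g (f y)) differentiable (at x)" by (auto simp: differentiable_def)
  show "Dmap (\<lambda>y. g (f y)) x a = Dmap g (f x) (Dmap f x a)" using Dmap_eq[OF h] by simp
qed

lemma Dmap_bounded_linear:
  assumes "bounded_linear L" "f differentiable (at x)"
  shows "(\<lambda>y. L (f y)) differentiable (at x)" "Dmap (\<lambda>y. L (f y)) x a = L (Dmap f x a)"
proof -
  have h: "((\<lambda>y. L (f y)) has_derivative (\<lambda>h. L (Dmap f x h))) (at x)"
    by (rule bounded_linear.has_derivative[OF assms(1) Dmap_works[OF assms(2)]])
  then show "(\<lambda>y. L (f y)) differentiable (at x)" by (auto simp: differentiable_def)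
  show "Dmap (\<lambda>y. L (f y)) x a = L (Dmap f x a)" using Dmap_eq[OF h] by simp
qed

lemma Dmap_bilinear:
  assumes "bounded_bilinear B" "f differentiable (at x)" "g differentiable (at x)"
  shows "(\<lambda>y. B (f y) (g y)) differentiable (at x)"
    and "Dmap (\<lambda>y. B (f y) (g y)) x a = B (f x) (Dmap g x a) + B (Dmap f x a) (g x)"
proof -
  have h: "((\<lambda>y. B (f y) (g y)) has_derivative (\<lambda>h. B (f x) (Dmap g x h) + B (Dmap f x h) (g x))) (at x)"
    by (rule bounded_bilinear.FDERIV[OF assms(1) Dmap_works[OF assms(2)] Dmap_works[OF assms(3)]])
  then show "(\<lambda>y. B (f y) (g y)) differentiable (at x)" by (auto simp: differentiable_def)
  show "Dmap (\<lambda>y. B (f y) (g y)) x a = B (f x) (Dmap g x a) + B (Dmap f x a) (g x)"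
    using Dmap_eq[OF h] by simp
qed

lemma Dmap_add:
  assumes "f differentiable (at x)" "g differentiable (at x)"
  shows "Dmap (\<lambda>y. f y + g y) x a = Dmap f x a + Dmap g x a"
  using Dmap_eq[OF has_derivative_add[OF Dmap_works[OF assms(1)] Dmap_works[OF assms(2)]]] by simp

lemma Dmap_zero: "Dmap (\<lambda>y. c) x a = 0"
  using Dmap_eq[OF has_derivative_const[of c "at x"]] by simp

subsection \<open>Calculus of \<open>C\<^sup>k\<close> maps\<close>

lemma Ck_on_subset: "Ck_on k S f \<Longrightarrow> T \<subseteq> S \<Longrightarrow> Ck_on k T f"
proof (induction k arbitrary: f)
  case 0 then show ?case using continuous_on_subset by auto
next
  case (Suc k) then show ?case by (auto simp: subset_iff)
qed

lemma Ck_on_imp_continuous_on: "Ck_on k S f \<Longrightarrow> continuous_on S f"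
proof (cases k)
  case (Suc m)
  assume "Ck_on k S f"
  then have "\<forall>x\<in>S. f differentiable (at x)" unfolding Suc by simp
  then show ?thesis
    using continuous_at_imp_continuous_on differentiable_imp_continuous_within by blast
qed simp

lemma Ck_on_SucD: "Ck_on (Suc k) S f \<Longrightarrow> Ck_on k S f"
proof (induction k arbitrary: f)
  case 0 then show ?case using Ck_on_imp_continuous_on[OF 0] by simp
next
  case (Suc k)
  have "Ck_on k S (\<lambda>x. Dmap f x v)" for v
    using Suc.prems by (intro Suc.IH) simp
  then show ?case using Suc.prems by simp
qed

lemma Ck_on_cong:
  assumes "open S" "\<And>x. x \<in> S \<Longrightarrow> f x = g x" "Ck_on k S f"
  shows "Ck_on k S g"
  using assms(2,3)
proof (induction k arbitrary: f g)
  case 0 then show ?case using continuous_on_cong[of S S f g] by auto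
next
  case (Suc k)
  have "g differentiable (at x)" if "x \<in> S" for x
    using differentiable_cong_open[OF assms(1) that Suc.prems(1)] Suc.prems(2) that by auto
  moreover have "Ck_on k S (\<lambda>x. Dmap g x v)" for v
  proof (rule Suc.IH)
    show "Dmap f x v = Dmap g x v" if "x \<in> S" for x
      using Dmap_cong_open[OF assms(1) that Suc.prems(1)] by simp
  qed (use Suc.prems in simp)
  ultimately show ?case by simp
qed

lemma Ck_on_local:
  assumes "\<And>x. x \<in> S \<Longrightarrow> \<exists>U. open U \<and> x \<in> U \<and> Ck_on k U f"
  shows "Ck_on k S f"
  using assms
proof (induction k arbitrary: f)
  case 0
  have "isCont f x" if "x \<in> S" for x
    using 0[OF that] by (auto simp: continuous_on_eq_continuous_at)
  then show ?case by (simp add: continuous_at_imp_continuous_on)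
next
  case (Suc k)
  have "f differentiable (at x)" if "x \<in> S" for x using Suc.prems[OF that] by auto
  moreover have "Ck_on k S (\<lambda>x. Dmap f x v)" for v
    by (rule Suc.IH) (use Suc.prems in \<open>auto, blast\<close>)
  ultimately show ?case by simp
qed

lemma Ck_on_const: "Ck_on k S (\<lambda>x. c)"
  by (induction k arbitrary: c) (simp_all add: Dmap_zero)

lemma Ck_on_add:
  assumes "open S" "Ck_on k S f" "Ck_on k S g"
  shows "Ck_on k S (\<lambda>x. f x + g x)"
  using assms(2,3)
proof (induction k arbitrary: f g)
  case 0 then show ?case by (simp add: continuous_on_add)
next
  case (Suc k)
  have "Ck_on k S (\<lambda>x. Dmap (\<lambda>y. f y + g y) x v)" for v
    by (rule Ck_on_cong[OF assms(1), of "\<lambda>x. Dmap f x v + Dmap g x v"])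
      (use Suc in \<open>auto simp: Dmap_add\<close>)
  then show ?case using Suc.prems by auto
qed

lemma Ck_on_sum:
  assumes "open S" "\<And>i. i \<in> I \<Longrightarrow> Ck_on k S (f i)"
  shows "Ck_on k S (\<lambda>x. \<Sum>i\<in>I. f i x)"
  using assms(2)
proof (induction I rule: infinite_finite_induct)
  case (insert i I)
  then have "Ck_on k S (\<lambda>x. f i x + (\<Sum>i\<in>I. f i x))"
    by (intro Ck_on_add[OF assms(1)]) auto
  then show ?case using insert by simp
qed (simp_all add: Ck_on_const)

lemma Ck_on_bilinear:
  assumes "open S" "bounded_bilinear B" "Ck_on k S f" "Ck_on k S g"
  shows "Ck_on k S (\<lambda>x. B (f x) (g x))"
  using assms(3,4)
proof (induction k arbitrary: f g)
  case 0 then show ?case using bounded_bilinear.continuous_on[OF assms(2)] by auto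
next
  case (Suc k)
  have "Ck_on k S (\<lambda>x. Dmap (\<lambda>y. B (f y) (g y)) x v)" for v
  proof (rule Ck_on_cong[OF assms(1)])
    show "B (f x) (Dmap g x v) + B (Dmap f x v) (g x) = Dmap (\<lambda>y. B (f y) (g y)) x v"
      if "x \<in> S" for x
      using that Suc.prems by (simp add: Dmap_bilinear(2)[OF assms(2)])
    show "Ck_on k S (\<lambda>x. B (f x) (Dmap g x v) + B (Dmap f x v) (g x))"
      using Suc.prems Ck_on_SucD[OF Suc.prems(1)] Ck_on_SucD[OF Suc.prems(2)]
      by (intro Ck_on_add assms Suc.IH) simp_all
  qed
  moreover have "(\<lambda>y. B (f y) (g y)) differentiable (at x)" if "x \<in> S" for x
    by (rule Dmap_bilinear(1)[OF assms(2)]) (use Suc.prems that in auto)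
  ultimately show ?case by simp
qed

lemma Ck_on_bounded_linear:
  assumes "open S" "bounded_linear L" "Ck_on k S f"
  shows "Ck_on k S (\<lambda>x. L (f x))"
  using assms(3)
proof (induction k arbitrary: f)
  case 0 then show ?case using bounded_linear.continuous_on[OF assms(2)] by auto
next
  case (Suc k)
  have "Ck_on k S (\<lambda>x. Dmap (\<lambda>y. L (f y)) x v)" for v
    by (rule Ck_on_cong[OF assms(1), of "\<lambda>x. L (Dmap f x v)"])
      (use Suc in \<open>auto simp: Dmap_bounded_linear[OF assms(2)]\<close>)
  moreover have "(\<lambda>y. L (f y)) differentiable (at x)" if "x \<in> S" for x
    by (rule Dmap_bounded_linear(1)[OF assms(2)]) (use Suc.prems that in auto)
  ultimately show ?case by simp
qed

text \<open>The chain rule yields \<open>Dmap g (f x) (Dmap f x v)\<close>, whose direction varies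
  with \<open>x\<close>, while \<open>Ck_on\<close> speaks about fixed directions. Expanding along
  \<open>Basis\<close> gives a finite sum of products with fixed directions.\<close>

lemma Ck_on_compose:
  fixes f :: "'a::real_normed_vector \<Rightarrow> 'b::euclidean_space" and g :: "'b \<Rightarrow> 'c::real_normed_vector"
  assumes "open S" "open T" "Ck_on k S f" "Ck_on k T g" "f ` S \<subseteq> T"
  shows "Ck_on k S (\<lambda>x. g (f x))"
  using assms(3,4)
proof (induction k arbitrary: g)
  case 0 then show ?case
    using continuous_on_compose2[OF _ _ assms(5), of g] by simp
next
  case (Suc k)
  have d: "f differentiable (at x)" "g differentiable (at (f x))" if "x \<in> S" for x
    using Suc.prems that assms(5) by auto
  have "Ck_on k S (\<lambda>x. Dmap (\<lambda>y. g (f y)) x v)" for v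
  proof (rule Ck_on_cong[OF assms(1)])
    show "(\<Sum>b\<in>Basis. (Dmap f x v \<bullet> b) *\<^sub>R Dmap g (f x) b) = Dmap (\<lambda>y. g (f y)) x v"
      if "x \<in> S" for x
    proof -
      have "Dmap g (f x) (\<Sum>b\<in>Basis. (Dmap f x v \<bullet> b) *\<^sub>R b) =
          (\<Sum>b\<in>Basis. (Dmap f x v \<bullet> b) *\<^sub>R Dmap g (f x) b)"
        using linear_Dmap[OF d(2)[OF that]] by (simp add: linear_sum linear_cmul)
      then show ?thesis
        using Dmap_compose(2)[OF d[OF that]] by (simp add: euclidean_representation)
    qed
    have "Ck_on k S (\<lambda>x. Dmap f x v \<bullet> b)" for b
      using Suc.prems by (intro Ck_on_bounded_linear[OF assms(1) bounded_linear_inner_left]) simp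
    moreover have "Ck_on k S (\<lambda>x. Dmap g (f x) b)" for b
      using Suc.prems Ck_on_SucD[OF Suc.prems(1)] by (intro Suc.IH) simp_all
    ultimately show "Ck_on k S (\<lambda>x. \<Sum>b\<in>Basis. (Dmap f x v \<bullet> b) *\<^sub>R Dmap g (f x) b)"
      by (intro Ck_on_sum Ck_on_bilinear[OF assms(1) bounded_bilinear_scaleR] assms(1))
  qed
  moreover have "(\<lambda>y. g (f y)) differentiable (at x)" if "x \<in> S" for x
    using Dmap_compose(1)[OF d[OF that]] .
  ultimately show ?case by simp
qed

lemma smooth_onI: "(\<And>k. Ck_on k S f) \<Longrightarrow> smooth_on S f"
  by (simp add: smooth_on_def)

lemma smooth_onD: "smooth_on S f \<Longrightarrow> Ck_on k S f"
  by (simp add: smooth_on_def)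

lemma smooth_on_subset: "smooth_on S f \<Longrightarrow> T \<subseteq> S \<Longrightarrow> smooth_on T f"
  by (rule smooth_onI) (rule Ck_on_subset[OF smooth_onD])

lemma smooth_on_cong:
  assumes "open S" "\<And>x. x \<in> S \<Longrightarrow> f x = g x" "smooth_on S f"
  shows "smooth_on S g"
  by (rule smooth_onI, rule Ck_on_cong[OF assms(1,2) smooth_onD[OF assms(3)]])

lemma smooth_on_bounded_linear:
  assumes "open S" "bounded_linear L" "smooth_on S f"
  shows "smooth_on S (\<lambda>x. L (f x))"
  by (rule smooth_onI, rule Ck_on_bounded_linear[OF assms(1,2) smooth_onD[OF assms(3)]])

lemma smooth_on_compose:
  fixes f :: "'a::real_normed_vector \<Rightarrow> 'b::euclidean_space" and g :: "'b \<Rightarrow> 'c::real_normed_vector"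
  assumes "open S" "open T" "smooth_on S f" "smooth_on T g" "f ` S \<subseteq> T"
  shows "smooth_on S (\<lambda>x. g (f x))"
  by (rule smooth_onI,
      rule Ck_on_compose[OF assms(1,2) smooth_onD[OF assms(3)] smooth_onD[OF assms(4)] assms(5)])

lemma smooth_on_local:
  assumes "\<And>x. x \<in> S \<Longrightarrow> \<exists>U. open U \<and> x \<in> U \<and> smooth_on U f"
  shows "smooth_on S f"
proof (rule smooth_onI, rule Ck_on_local)
  fix k x assume "x \<in> S"
  then show "\<exists>U. open U \<and> x \<in> U \<and> Ck_on k U f"
    using assms[of x] smooth_onD by blast
qed

lemma smooth_on_Dmap:
  assumes "smooth_on S f"
  shows "smooth_on S (\<lambda>x. Dmap f x v)"
  unfolding smooth_on_def
proof
  fix k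
  have "Ck_on (Suc k) S f" using assms unfolding smooth_on_def by blast
  then show "Ck_on k S (\<lambda>x. Dmap f x v)" by simp
qed

lemma smooth_on_differentiable:
  assumes "smooth_on S f" "x \<in> S"
  shows "f differentiable (at x)"
proof -
  have "Ck_on (Suc 0) S f" using assms unfolding smooth_on_def by blast
  then show ?thesis using assms(2) by simp
qed

lemma smooth_on_continuous_on: "smooth_on S f \<Longrightarrow> continuous_on S f"
  unfolding smooth_on_def using Ck_on_imp_continuous_on[of 0 S f] by blast

subsection \<open>Second derivatives\<close>

text \<open>The product rule for a constant pairing. The relations between an immersion and its
  dual, and the tangency to \<open>hyp\<close>, arise by differentiating with it.\<close>

lemma Dmap_bilinear_eq_0:
  fixes c :: "'c::real_normed_vector"
  assumes "open S" "x \<in> S" "bounded_bilinear B" "\<And>y. y \<in> S \<Longrightarrow> B (f y) (g y) = c"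
    "f differentiable (at x)" "g differentiable (at x)"
  shows "B (Dmap f x a) (g x) = - B (f x) (Dmap g x a)"
proof -
  have "Dmap (\<lambda>y. B (f y) (g y)) x = Dmap (\<lambda>y. c) x"
    by (rule Dmap_cong_open[OF assms(1,2)]) (rule assms(4))
  then have "Dmap (\<lambda>y. B (f y) (g y)) x a = 0" by (simp add: Dmap_zero)
  then show ?thesis using Dmap_bilinear(2)[OF assms(3,5,6)] by (simp add: add_eq_0_iff)
qed

lemma hess_add_right:
  assumes "open S" "x \<in> S" "smooth_on S f"
  shows "hess f x a (b + c) = hess f x a b + hess f x a c"
proof -
  have "Dmap f y (b + c) = Dmap f y b + Dmap f y c" if "y \<in> S" for y
    using linear_Dmap[OF smooth_on_differentiable[OF assms(3) that]] linear_add by blast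
  then have "hess f x a (b + c) = Dmap (\<lambda>y. Dmap f y b + Dmap f y c) x a"
    unfolding hess_def using Dmap_cong_open[OF assms(1,2), of "\<lambda>y. Dmap f y (b + c)"] by simp
  then show ?thesis unfolding hess_def
    using smooth_on_differentiable[OF smooth_on_Dmap[OF assms(3)] assms(2)] by (simp add: Dmap_add)
qed

lemma hess_scaleR_right:
  assumes "open S" "x \<in> S" "smooth_on S f"
  shows "hess f x a (r *\<^sub>R b) = r *\<^sub>R hess f x a b"
proof -
  have "Dmap f y (r *\<^sub>R b) = r *\<^sub>R Dmap f y b" if "y \<in> S" for y
    using linear_Dmap[OF smooth_on_differentiable[OF assms(3) that]] linear_cmul by blast
  then have "hess f x a (r *\<^sub>R b) = Dmap (\<lambda>y. r *\<^sub>R Dmap f y b) x a"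
    unfolding hess_def using Dmap_cong_open[OF assms(1,2), of "\<lambda>y. Dmap f y (r *\<^sub>R b)"] by simp
  then show ?thesis unfolding hess_def
    using smooth_on_differentiable[OF smooth_on_Dmap[OF assms(3)] assms(2)]
    by (simp add: Dmap_bounded_linear(2)[OF bounded_linear_scaleR_right])
qed

lemma linear_hess_right:
  assumes "open S" "x \<in> S" "smooth_on S f"
  shows "linear (hess f x a)"
  using hess_add_right[OF assms] hess_scaleR_right[OF assms] by (auto intro: linearI)

lemma linear_hess_left:
  assumes "x \<in> S" "smooth_on S f"
  shows "linear (\<lambda>a. hess f x a b)"
  unfolding hess_def using linear_Dmap[OF smooth_on_differentiable[OF smooth_on_Dmap[OF assms(2)] assms(1)]] .

lemma hess_bounded_linear:
  assumes "open S" "x \<in> S" "smooth_on S f" "bounded_linear L"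
  shows "hess (\<lambda>y. L (f y)) x a b = L (hess f x a b)"
proof -
  have "hess (\<lambda>y. L (f y)) x a b = Dmap (\<lambda>y. L (Dmap f y b)) x a"
    unfolding hess_def
    using Dmap_cong_open[OF assms(1,2), of "\<lambda>y. Dmap (\<lambda>y. L (f y)) y b" "\<lambda>y. L (Dmap f y b)"]
      Dmap_bounded_linear(2)[OF assms(4) smooth_on_differentiable[OF assms(3)]] by simp
  then show ?thesis unfolding hess_def
    using Dmap_bounded_linear(2)[OF assms(4) smooth_on_differentiable[OF smooth_on_Dmap[OF assms(3)] assms(2)]]
    by simp
qed

lemma Ck_on_hess_continuous: "smooth_on S f \<Longrightarrow> continuous_on S (\<lambda>x. hess f x a b)"
  unfolding hess_def by (intro smooth_on_continuous_on smooth_on_Dmap)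

text \<open>The mean value theorem in the direction \<open>a\<close> and then in the direction \<open>b\<close>; the left-hand side is
  symmetric in \<open>a\<close> and \<open>b\<close>, which yields the symmetry of the Hessian.\<close>

lemma second_difference:
  fixes f :: "'a::real_normed_vector \<Rightarrow> real"
  assumes ball: "\<And>p q. 0 \<le> p \<Longrightarrow> p \<le> t \<Longrightarrow> 0 \<le> q \<Longrightarrow> q \<le> t \<Longrightarrow> x + p *\<^sub>R a + q *\<^sub>R b \<in> S"
    and S: "smooth_on S f" and t: "t > 0"
  obtains p q where "0 < p" "p < t" "0 < q" "q < t"
    "f (x + t *\<^sub>R a + t *\<^sub>R b) - f (x + t *\<^sub>R a) - f (x + t *\<^sub>R b) + f x =
       t * t * hess f (x + p *\<^sub>R a + q *\<^sub>R b) b a"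
proof -
  define F where "F = (\<lambda>p. f (x + p *\<^sub>R a + t *\<^sub>R b) - f (x + p *\<^sub>R a))"
  have line: "((\<lambda>p. g (y + p *\<^sub>R v)) has_real_derivative Dmap g (y + p *\<^sub>R v) v) (at p)"
    if "g differentiable (at (y + p *\<^sub>R v))" for g :: "'a \<Rightarrow> real" and y v p
  proof -
    have "((\<lambda>p. y + p *\<^sub>R v) has_derivative (\<lambda>h. h *\<^sub>R v)) (at p)"
      by (auto intro!: derivative_eq_intros)
    from diff_chain_at[OF this Dmap_works[OF that]]
    have "((\<lambda>p. g (y + p *\<^sub>R v)) has_derivative (\<lambda>h. Dmap g (y + p *\<^sub>R v) (h *\<^sub>R v))) (at p)"
      by (simp add: comp_def)
    moreover have "(\<lambda>h. Dmap g (y + p *\<^sub>R v) (h *\<^sub>R v)) = (*) (Dmap g (y + p *\<^sub>R v) v)"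
      using linear_cmul[OF linear_Dmap[OF that]] by (auto simp: mult.commute)
    ultimately show ?thesis
      by (simp add: has_field_derivative_def)
  qed
  have "(F has_real_derivative Dmap f (x + p *\<^sub>R a + t *\<^sub>R b) a - Dmap f (x + p *\<^sub>R a) a) (at p)"
    if "0 \<le> p" "p \<le> t" for p
  proof -
    have "f differentiable (at (x + t *\<^sub>R b + p *\<^sub>R a))" "f differentiable (at (x + p *\<^sub>R a))"
      using smooth_on_differentiable[OF S] ball[of p t] ball[of p 0] that t by (auto simp: ac_simps)
    from DERIV_diff[OF line[OF this(1)] line[OF this(2)]]
    show ?thesis unfolding F_def by (simp add: ac_simps)
  qed
  from MVT2[OF t this] obtain p where p: "0 < p" "p < t"
    "F t - F 0 = (t - 0) * (Dmap f (x + p *\<^sub>R a + t *\<^sub>R b) a - Dmap f (x + p *\<^sub>R a) a)" by auto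
  have "((\<lambda>q. Dmap f (x + p *\<^sub>R a + q *\<^sub>R b) a) has_real_derivative hess f (x + p *\<^sub>R a + q *\<^sub>R b) b a) (at q)"
    if "0 \<le> q" "q \<le> t" for q
    unfolding hess_def
    by (rule line[of "\<lambda>y. Dmap f y a"], rule smooth_on_differentiable[OF smooth_on_Dmap[OF S]],
        rule ball) (use p that in auto)
  from MVT2[OF t this] obtain q where q: "0 < q" "q < t"
    "Dmap f (x + p *\<^sub>R a + t *\<^sub>R b) a - Dmap f (x + p *\<^sub>R a + 0 *\<^sub>R b) a =
      (t - 0) * hess f (x + p *\<^sub>R a + q *\<^sub>R b) b a" by blast
  show ?thesis
    by (rule that[OF p(1,2) q(1,2)]) (use p(3) q(3) in \<open>simp add: F_def\<close>)
qed

lemma hess_symmetric_real: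
  fixes f :: "'a::real_normed_vector \<Rightarrow> real"
  assumes S: "open S" "x \<in> S" "smooth_on S f"
  shows "hess f x a b = hess f x b a"
proof (rule ccontr)
  assume ne: "hess f x a b \<noteq> hess f x b a"
  \<comment> \<open>Half of the gap: the two approximation errors then add up to less than the gap
    itself.\<close>
  define e where "e = \<bar>hess f x a b - hess f x b a\<bar> / 2"
  have e: "e > 0" using ne by (simp add: e_def)
  have near: "\<exists>U. open U \<and> x \<in> U \<and> U \<subseteq> S \<and> (\<forall>y\<in>U. \<bar>hess f y a b - hess f x a b\<bar> < e)" for a b
  proof -
    have "isCont (\<lambda>y. hess f y a b) x"
      using Ck_on_hess_continuous[OF S(3)] S(1,2) by (simp add: continuous_on_eq_continuous_at)
    then obtain d where d: "d > 0" "\<And>y. dist y x < d \<Longrightarrow> \<bar>hess f y a b - hess f x a b\<bar> < e"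
      using e unfolding continuous_at_eps_delta by (auto simp: dist_real_def)
    show ?thesis
      by (rule exI[of _ "ball x d \<inter> S"]) (use d S in \<open>auto simp: dist_commute\<close>)
  qed
  obtain U1 where U1: "open U1" "x \<in> U1" "U1 \<subseteq> S" "\<And>y. y \<in> U1 \<Longrightarrow> \<bar>hess f y a b - hess f x a b\<bar> < e"
    using near by metis
  obtain U2 where U2: "open U2" "x \<in> U2" "\<And>y. y \<in> U2 \<Longrightarrow> \<bar>hess f y b a - hess f x b a\<bar> < e"
    using near by metis
  obtain r where r: "r > 0" "ball x r \<subseteq> U1 \<inter> U2"
    using open_Int[OF U1(1) U2(1)] U1(2) U2(2) openE[of "U1 \<inter> U2" x] by blast
  \<comment> \<open>The summand 1 keeps \<open>N\<close> positive when both vectors vanish; the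
    factor 1/2 in \<open>t\<close> puts the whole parallelogram strictly inside the ball.\<close>
  define N where "N = norm a + norm b + 1"
  define t where "t = r / N / 2"
  have npos: "N > 0"
    using norm_ge_zero[of a] norm_ge_zero[of b] unfolding N_def by linarith
  have t: "t > 0" using r npos by (simp add: t_def)
  have inb: "x + p *\<^sub>R a + q *\<^sub>R b \<in> ball x r" if "0 \<le> p" "p \<le> t" "0 \<le> q" "q \<le> t" for p q
  proof -
    have "norm (p *\<^sub>R a + q *\<^sub>R b) \<le> p * norm a + q * norm b"
      using norm_triangle_ineq[of "p *\<^sub>R a" "q *\<^sub>R b"] that by simp
    also have "\<dots> \<le> t * norm a + t * norm b"
      using that by (intro add_mono mult_right_mono) auto
    also have "\<dots> \<le> t * N" using t by (simp add: N_def algebra_simps)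
    also have "\<dots> = r / 2" using npos by (simp add: t_def)
    also have "\<dots> < r" using r by simp
    finally have "norm (p *\<^sub>R a + q *\<^sub>R b) < r" .
    moreover have "dist x (x + p *\<^sub>R a + q *\<^sub>R b) = norm (p *\<^sub>R a + q *\<^sub>R b)"
      by (metis add.assoc add_diff_cancel_left' dist_commute dist_norm)
    ultimately show ?thesis by simp
  qed
  obtain p q where p: "0 < p" "p < t" "0 < q" "q < t"
    "f (x + t *\<^sub>R a + t *\<^sub>R b) - f (x + t *\<^sub>R a) - f (x + t *\<^sub>R b) + f x =
       t * t * hess f (x + p *\<^sub>R a + q *\<^sub>R b) b a"
  proof (rule second_difference[of t x a b S f])
    show "x + p *\<^sub>R a + q *\<^sub>R b \<in> S" if "0 \<le> p" "p \<le> t" "0 \<le> q" "q \<le> t" for p q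
      using inb[of p q] that r U1(3) by auto
  qed (use S t in auto)
  obtain p' q' where p': "0 < p'" "p' < t" "0 < q'" "q' < t"
    "f (x + t *\<^sub>R b + t *\<^sub>R a) - f (x + t *\<^sub>R b) - f (x + t *\<^sub>R a) + f x =
       t * t * hess f (x + p' *\<^sub>R b + q' *\<^sub>R a) a b"
  proof (rule second_difference[of t x b a S f])
    show "x + p *\<^sub>R b + q *\<^sub>R a \<in> S" if "0 \<le> p" "p \<le> t" "0 \<le> q" "q \<le> t" for p q
      using inb[of q p] that r U1(3) by (auto simp: ac_simps)
  qed (use S t in auto)
  have c: "x + t *\<^sub>R b + t *\<^sub>R a = x + t *\<^sub>R a + t *\<^sub>R b"
    "x + p' *\<^sub>R b + q' *\<^sub>R a = x + q' *\<^sub>R a + p' *\<^sub>R b" by (simp_all add: ac_simps)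
  have "t * t * hess f (x + p *\<^sub>R a + q *\<^sub>R b) b a = t * t * hess f (x + q' *\<^sub>R a + p' *\<^sub>R b) a b"
    using p(5) p'(5) unfolding c by linarith
  then have "hess f (x + p *\<^sub>R a + q *\<^sub>R b) b a = hess f (x + q' *\<^sub>R a + p' *\<^sub>R b) a b"
    using t by simp
  moreover have "\<bar>hess f (x + p *\<^sub>R a + q *\<^sub>R b) b a - hess f x b a\<bar> < e"
    using U2(3) inb[of p q] p r by auto
  moreover have "\<bar>hess f (x + q' *\<^sub>R a + p' *\<^sub>R b) a b - hess f x a b\<bar> < e"
    using U1(4) inb[of q' p'] p' r by auto
  ultimately have "\<bar>hess f x a b - hess f x b a\<bar> < e + e" by linarith
  then show False by (simp add: e_def)
qed

lemma hess_symmetric: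
  fixes f :: "'a::real_normed_vector \<Rightarrow> 'b::euclidean_space"
  assumes S: "open S" "x \<in> S" "smooth_on S f"
  shows "hess f x a b = hess f x b a"
proof (rule euclidean_eqI)
  fix i :: 'b assume "i \<in> Basis"
  have sm: "smooth_on S (\<lambda>y. f y \<bullet> i)"
    by (rule smooth_on_bounded_linear[OF S(1) _ S(3)]) (rule bounded_linear_inner_left)
  have h: "hess (\<lambda>y. f y \<bullet> i) x a b = hess f x a b \<bullet> i" for a b
    by (rule hess_bounded_linear[OF S]) (rule bounded_linear_inner_left)
  have "hess (\<lambda>y. f y \<bullet> i) x a b = hess (\<lambda>y. f y \<bullet> i) x b a"
    by (rule hess_symmetric_real[OF S(1,2) sm])
  then show "hess f x a b \<bullet> i = hess f x b a \<bullet> i" by (simp only: h)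
qed

text \<open>The direction \<open>Dmap f y b\<close> moves with \<open>y\<close>, hence the expansion
  along \<open>Basis\<close>. Second derivatives of \<open>f\<close> are assumed at the point
  \<open>x\<close> alone, because the local section of the projection will offer no more.\<close>

lemma Dmap_compose_on:
  fixes f :: "'a::euclidean_space \<Rightarrow> 'b::euclidean_space" and g :: "'b \<Rightarrow> 'c::real_normed_vector"
  assumes S: "open S" "x \<in> S"
    and "f differentiable (at x)" "\<And>b. (\<lambda>y. Dmap f y b) differentiable (at x)"
    and T: "open T" "f x \<in> T" "smooth_on T g"
  shows "(\<lambda>y. Dmap g (f y) (Dmap f y b)) differentiable (at x)"
    and "Dmap (\<lambda>y. Dmap g (f y) (Dmap f y b)) x a =
      Dmap g (f x) (hess f x a b) + hess g (f x) (Dmap f x a) (Dmap f x b)"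
proof -
  have cont: "isCont f x" using assms(3) differentiable_imp_continuous_within by blast
  then obtain V where V: "open V" "x \<in> V" "\<And>y. y \<in> V \<Longrightarrow> f y \<in> T"
    using continuous_at_open[of x f] T by metis
  have gd: "(\<lambda>z. Dmap g z i) differentiable (at (f x))" for i
    using smooth_on_differentiable[OF smooth_on_Dmap[OF T(3)] T(2)] .
  have term_d: "((\<lambda>y. (Dmap f y b \<bullet> i) *\<^sub>R Dmap g (f y) i) has_derivative
     (\<lambda>a. (Dmap f x b \<bullet> i) *\<^sub>R hess g (f x) (Dmap f x a) i + (hess f x a b \<bullet> i) *\<^sub>R Dmap g (f x) i)) (at x)" for i
  proof -
    have d1: "(\<lambda>y. Dmap f y b \<bullet> i) differentiable (at x)"
      by (rule Dmap_bounded_linear(1)[OF bounded_linear_inner_left assms(4)])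
    have d2: "(\<lambda>y. Dmap g (f y) i) differentiable (at x)"
      by (rule Dmap_compose(1)[OF assms(3) gd])
    have "Dmap (\<lambda>y. (Dmap f y b \<bullet> i) *\<^sub>R Dmap g (f y) i) x =
       (\<lambda>a. (Dmap f x b \<bullet> i) *\<^sub>R hess g (f x) (Dmap f x a) i + (hess f x a b \<bullet> i) *\<^sub>R Dmap g (f x) i)"
      using Dmap_bilinear(2)[OF bounded_bilinear_scaleR d1 d2]
        Dmap_bounded_linear(2)[OF bounded_linear_inner_left assms(4)] Dmap_compose(2)[OF assms(3) gd]
      by (auto simp: hess_def)
    then show ?thesis
      using Dmap_works[OF Dmap_bilinear(1)[OF bounded_bilinear_scaleR d1 d2]] by simp
  qed
  have sum_d: "((\<lambda>y. \<Sum>i\<in>Basis. (Dmap f y b \<bullet> i) *\<^sub>R Dmap g (f y) i) has_derivative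
     (\<lambda>a. \<Sum>i\<in>Basis. (Dmap f x b \<bullet> i) *\<^sub>R hess g (f x) (Dmap f x a) i + (hess f x a b \<bullet> i) *\<^sub>R Dmap g (f x) i)) (at x)"
    by (rule has_derivative_sum) (rule term_d)
  have lin: "(\<Sum>i\<in>Basis. (v \<bullet> i) *\<^sub>R L i) = L v" if "linear L" for L :: "'b \<Rightarrow> 'c" and v
    using that linear_sum[OF that, of "\<lambda>i. (v \<bullet> i) *\<^sub>R i" Basis] by (simp add: linear_cmul euclidean_representation)
  have "(\<Sum>i\<in>Basis. (Dmap f y b \<bullet> i) *\<^sub>R Dmap g (f y) i) = Dmap g (f y) (Dmap f y b)" if "y \<in> V" for y
    by (rule lin, rule linear_Dmap, rule smooth_on_differentiable[OF T(3) V(3)[OF that]])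
  from has_derivative_transform_within_open[OF sum_d V(1,2) this]
  have "((\<lambda>y. Dmap g (f y) (Dmap f y b)) has_derivative
     (\<lambda>a. \<Sum>i\<in>Basis. (Dmap f x b \<bullet> i) *\<^sub>R hess g (f x) (Dmap f x a) i + (hess f x a b \<bullet> i) *\<^sub>R Dmap g (f x) i)) (at x)"
    .
  moreover have "(\<lambda>a. \<Sum>i\<in>Basis. (Dmap f x b \<bullet> i) *\<^sub>R hess g (f x) (Dmap f x a) i + (hess f x a b \<bullet> i) *\<^sub>R Dmap g (f x) i) =
     (\<lambda>a. Dmap g (f x) (hess f x a b) + hess g (f x) (Dmap f x a) (Dmap f x b))"
  proof
    fix a
    show "(\<Sum>i\<in>Basis. (Dmap f x b \<bullet> i) *\<^sub>R hess g (f x) (Dmap f x a) i + (hess f x a b \<bullet> i) *\<^sub>R Dmap g (f x) i) =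
        Dmap g (f x) (hess f x a b) + hess g (f x) (Dmap f x a) (Dmap f x b)"
      unfolding sum.distrib lin[OF linear_hess_right[OF T]]
        lin[OF linear_Dmap[OF smooth_on_differentiable[OF T(3,2)]]] by (rule add.commute)
  qed
  ultimately have h: "((\<lambda>y. Dmap g (f y) (Dmap f y b)) has_derivative
     (\<lambda>a. Dmap g (f x) (hess f x a b) + hess g (f x) (Dmap f x a) (Dmap f x b))) (at x)" by simp
  then show "(\<lambda>y. Dmap g (f y) (Dmap f y b)) differentiable (at x)" by (auto simp: differentiable_def)
  show "Dmap (\<lambda>y. Dmap g (f y) (Dmap f y b)) x a =
      Dmap g (f x) (hess f x a b) + hess g (f x) (Dmap f x a) (Dmap f x b)"
    using Dmap_eq[OF h] by simp
qed

lemma hess_compose: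
  fixes f :: "'a::euclidean_space \<Rightarrow> 'b::euclidean_space" and g :: "'b \<Rightarrow> 'c::real_normed_vector"
  assumes S: "open S" "x \<in> S"
    and f: "\<And>y. y \<in> S \<Longrightarrow> f differentiable (at y)" "\<And>b. (\<lambda>y. Dmap f y b) differentiable (at x)"
    and T: "open T" "smooth_on T g" and fT: "\<And>y. y \<in> S \<Longrightarrow> f y \<in> T"
  shows "(\<lambda>y. Dmap (\<lambda>z. g (f z)) y b) differentiable (at x)"
    and "hess (\<lambda>z. g (f z)) x a b =
      Dmap g (f x) (hess f x a b) + hess g (f x) (Dmap f x a) (Dmap f x b)"
proof -
  have eq: "Dmap (\<lambda>z. g (f z)) y b = Dmap g (f y) (Dmap f y b)" if "y \<in> S" for y
    using Dmap_compose(2)[OF f(1)[OF that] smooth_on_differentiable[OF T(2) fT[OF that]]] .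
  note base = S f(1)[OF S(2)] f(2) T(1) fT[OF S(2)] T(2)
  have "(\<lambda>y. Dmap (\<lambda>z. g (f z)) y b) differentiable (at x) \<longleftrightarrow>
      (\<lambda>y. Dmap g (f y) (Dmap f y b)) differentiable (at x)"
    by (rule differentiable_cong_open[OF S]) (rule eq)
  then show "(\<lambda>y. Dmap (\<lambda>z. g (f z)) y b) differentiable (at x)"
    using Dmap_compose_on(1)[OF base] by blast
  have "Dmap (\<lambda>y. Dmap (\<lambda>z. g (f z)) y b) x = Dmap (\<lambda>y. Dmap g (f y) (Dmap f y b)) x"
    by (rule Dmap_cong_open[OF S]) (rule eq)
  then show "hess (\<lambda>z. g (f z)) x a b =
      Dmap g (f x) (hess f x a b) + hess g (f x) (Dmap f x a) (Dmap f x b)"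
    unfolding hess_def[of "\<lambda>z. g (f z)"]
    using Dmap_compose_on(2)[OF base, of b a] by simp
qed

section \<open>Alternating forms and determinants\<close>

text \<open>Weaker than \<open>volume_form\<close>: freezing the transversal slot of a volume form
  leaves an alternating form in fewer vectors than the dimension, and the determinant formula has to
  apply to it.\<close>

definition alternating_form :: "(('k \<Rightarrow> 'w::real_vector) \<Rightarrow> real) \<Rightarrow> bool"
  where "alternating_form vol \<longleftrightarrow>
    (\<forall>i w. linear (\<lambda>u. vol (w(i := u)))) \<and> (\<forall>w i j. i \<noteq> j \<and> w i = w j \<longrightarrow> vol w = 0)"

lemma volume_form_alternating: "volume_form vol \<Longrightarrow> alternating_form vol"
  by (simp add: volume_form_def alternating_form_def)

context
  fixes vol :: "('k \<Rightarrow> 'w::real_vector) \<Rightarrow> real"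
  assumes alt: "alternating_form vol"
begin

lemma alternating_form_linear: "linear (\<lambda>u. vol (w(i := u)))"
  using alt by (simp add: alternating_form_def)

lemma alternating_form_add: "vol (w(i := u + v)) = vol (w(i := u)) + vol (w(i := v))"
  using linear_add[OF alternating_form_linear, of w i u v] .

lemma alternating_form_scaleR: "vol (w(i := c *\<^sub>R u)) = c * vol (w(i := u))"
  using linear_cmul[OF alternating_form_linear, of w i c u] by simp

lemma alternating_form_zero: "w i = 0 \<Longrightarrow> vol w = 0"
  using alternating_form_scaleR[of w i 0 0] fun_upd_triv[of w i] by simp

lemma alternating_form_eq: "i \<noteq> j \<Longrightarrow> w i = w j \<Longrightarrow> vol w = 0"
  using alt unfolding alternating_form_def by blast

lemma alternating_form_add_multiple:
  assumes "i \<noteq> j"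
  shows "vol (w(i := w i + c *\<^sub>R w j)) = vol w"
proof -
  have "vol (w(i := w j)) = 0" by (rule alternating_form_eq[OF assms]) (use assms in auto)
  then show ?thesis by (simp add: alternating_form_add alternating_form_scaleR)
qed

lemma alternating_form_swap:
  assumes "i \<noteq> j"
  shows "vol (w(i := w j, j := w i)) = - vol w"
proof -
  let ?s = "w i + w j"
  have e: "vol (w(i := a, j := b)) = vol ((w(j := b))(i := a))" for a b
    using assms by (simp add: fun_upd_twist)
  have "0 = vol (w(i := ?s, j := ?s))"
    by (rule alternating_form_eq[OF assms, symmetric]) (use assms in auto)
  also have "\<dots> = vol (w(i := ?s, j := w i)) + vol (w(i := ?s, j := w j))"
    by (rule alternating_form_add)
  also have "vol (w(i := ?s, j := w i)) = vol (w(i := w i, j := w i)) + vol (w(i := w j, j := w i))"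
    unfolding e by (rule alternating_form_add)
  also have "vol (w(i := ?s, j := w j)) = vol (w(i := w i, j := w j)) + vol (w(i := w j, j := w j))"
    unfolding e by (rule alternating_form_add)
  also have "vol (w(i := w i, j := w i)) = 0"
    by (rule alternating_form_eq[OF assms]) (use assms in auto)
  also have "vol (w(i := w j, j := w j)) = 0"
    by (rule alternating_form_eq[OF assms]) (use assms in auto)
  also have "w(i := w i, j := w j) = w" by simp
  finally show ?thesis by linarith
qed

lemma alternating_form_scaleR_all:
  assumes "finite S"
  shows "vol (\<lambda>i. if i \<in> S then c i *\<^sub>R w i else w i) = (\<Prod>i\<in>S. c i) * vol w"
  using assms
proof (induction S)
  case (insert k S)
  let ?w = "\<lambda>i. if i \<in> S then c i *\<^sub>R w i else w i"
  have "(\<lambda>i. if i \<in> insert k S then c i *\<^sub>R w i else w i) = ?w(k := c k *\<^sub>R ?w k)"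
    using insert.hyps by auto
  then have "vol (\<lambda>i. if i \<in> insert k S then c i *\<^sub>R w i else w i) = vol (?w(k := c k *\<^sub>R ?w k))"
    by (rule arg_cong)
  also have "\<dots> = c k * vol (?w(k := ?w k))" by (rule alternating_form_scaleR)
  also have "?w(k := ?w k) = ?w" by (rule fun_upd_triv)
  finally show ?case using insert by simp
qed simp

end

text \<open>Stated for all families \<open>w\<close>, the claim passes to matrix products, since the
  factor \<open>A\<close> is applied to the family that \<open>B\<close> produces; elementary
  matrices then suffice.\<close>

lemma alternating_form_det:
  fixes vol :: "('k::finite \<Rightarrow> 'w::real_vector) \<Rightarrow> real" and A :: "real^'k^'k"
  assumes alt: "alternating_form vol"
  shows "vol (\<lambda>i. \<Sum>j\<in>UNIV. A $ i $ j *\<^sub>R w j) = det A * vol w"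
proof -
  let ?P = "\<lambda>A :: real^'k^'k. \<forall>w. vol (\<lambda>i. \<Sum>j\<in>UNIV. A $ i $ j *\<^sub>R w j) = det A * vol w"
  have "?P A"
  proof (rule induct_matrix_elementary[of ?P])
    fix A B :: "real^'k^'k"
    assume mult: "?P A" "?P B"
    have "(\<Sum>j\<in>UNIV. (A ** B) $ i $ j *\<^sub>R w j) = (\<Sum>l\<in>UNIV. A $ i $ l *\<^sub>R (\<Sum>j\<in>UNIV. B $ l $ j *\<^sub>R w j))"
      for i and w :: "'k \<Rightarrow> 'w"
    proof -
      have "(\<Sum>j\<in>UNIV. (A ** B) $ i $ j *\<^sub>R w j) = (\<Sum>j\<in>UNIV. \<Sum>l\<in>UNIV. (A $ i $ l * B $ l $ j) *\<^sub>R w j)"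
        by (simp add: matrix_matrix_mult_def scaleR_left.sum)
      also have "\<dots> = (\<Sum>l\<in>UNIV. \<Sum>j\<in>UNIV. (A $ i $ l * B $ l $ j) *\<^sub>R w j)" by (rule sum.swap)
      finally show ?thesis by (simp add: scaleR_right.sum)
    qed
    then show "?P (A ** B)" using mult by (simp add: det_mul)
  next
    fix A :: "real^'k^'k" and i
    assume zero_row: "row i A = 0"
    have "(\<Sum>j\<in>UNIV. A $ i $ j *\<^sub>R w j) = 0" for w :: "'k \<Rightarrow> 'w"
      using zero_row by (simp add: row_def vec_eq_iff)
    then show "?P A"
      using alternating_form_zero[OF alt, of _ i] det_zero_row(1)[OF zero_row] by simp
  next
    fix A :: "real^'k^'k"
    assume diagonal: "\<And>i j. i \<noteq> j \<Longrightarrow> A $ i $ j = 0"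
    have "(\<Sum>j\<in>UNIV. A $ i $ j *\<^sub>R w j) = (if i \<in> UNIV then (A $ i $ i) *\<^sub>R w i else w i)" for i and w :: "'k \<Rightarrow> 'w"
    proof -
      have "(\<Sum>j\<in>UNIV. A $ i $ j *\<^sub>R w j) = (\<Sum>j\<in>UNIV. if j = i then A $ i $ i *\<^sub>R w i else 0)"
        by (rule sum.cong) (use diagonal in auto)
      then show ?thesis by simp
    qed
    then show "?P A"
      using alternating_form_scaleR_all[OF alt finite[of UNIV], of "\<lambda>i. A $ i $ i"]
        det_diagonal[OF diagonal] by simp
  next
    fix m n :: 'k
    assume swap1: "m \<noteq> n"
    let ?t = "Transposition.transpose m n"
    have perm: "?t permutes UNIV" by (rule permutes_swap_id) auto
    have "(\<lambda>i. \<Sum>j\<in>UNIV. (\<chi> i j. (mat 1 :: real^'k^'k) $ i $ ?t j) $ i $ j *\<^sub>R w j) = w(m := w n, n := w m)"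
      for w :: "'k \<Rightarrow> 'w"
    proof
      fix i
      have "(\<Sum>j\<in>UNIV. (\<chi> i j. (mat 1 :: real^'k^'k) $ i $ ?t j) $ i $ j *\<^sub>R w j) =
          (\<Sum>j\<in>UNIV. if j = ?t i then w j else 0)"
        by (rule sum.cong) (auto simp: mat_def)
      also have "\<dots> = w (?t i)" by simp
      also have "\<dots> = (w(m := w n, n := w m)) i"
        by (auto simp: Transposition.transpose_def)
      finally show "(\<Sum>j\<in>UNIV. (\<chi> i j. (mat 1 :: real^'k^'k) $ i $ ?t j) $ i $ j *\<^sub>R w j) =
          (w(m := w n, n := w m)) i" .
    qed
    moreover have "det (\<chi> i j. (mat 1 :: real^'k^'k) $ i $ ?t j) = - 1"
      using det_permute_columns[OF perm, of "mat 1 :: real^'k^'k"] swap1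
      by (simp add: sign_swap_id)
    ultimately show "?P (\<chi> i j. mat 1 $ i $ ?t j)" using alternating_form_swap[OF alt swap1] by simp
  next
    fix m n :: 'k and c :: real
    assume idplus: "m \<noteq> n"
    let ?A = "(\<chi> i j. if i = m \<and> j = n then c else of_bool (i = j)) :: real^'k^'k"
    have "(\<lambda>i. \<Sum>j\<in>UNIV. ?A $ i $ j *\<^sub>R w j) = w(m := w m + c *\<^sub>R w n)" for w :: "'k \<Rightarrow> 'w"
    proof
      fix i
      have "(\<Sum>j\<in>UNIV. ?A $ i $ j *\<^sub>R w j) =
         (\<Sum>j\<in>UNIV. (if j = i then w i else 0) + (if j = n then (if i = m then c *\<^sub>R w n else 0) else 0))"
        by (rule sum.cong) (use idplus in auto)
      then show "(\<Sum>j\<in>UNIV. ?A $ i $ j *\<^sub>R w j) = (w(m := w m + c *\<^sub>R w n)) i"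
        unfolding sum.distrib by simp
    qed
    moreover have "det ?A = 1"
    proof -
      have "?A = (\<chi> k. if k = m then row m (mat 1) + c *s row n (mat 1) else row k (mat 1))"
        using idplus by (auto simp: vec_eq_iff row_def mat_def)
      then show ?thesis using det_row_operation[OF idplus, of "mat 1 :: real^'k^'k" c] by simp
    qed
    ultimately show "?P ?A" using alternating_form_add_multiple[OF alt idplus] by simp
  qed
  then show ?thesis by blast
qed

lemma alternating_form_case_option:
  assumes alt: "alternating_form (vol :: ('n option \<Rightarrow> 'w::real_vector) \<Rightarrow> real)"
  shows "alternating_form (\<lambda>Y. vol (case_option \<xi> Y))"
proof -
  have e: "case_option \<xi> (Y(i := u)) = (case_option \<xi> Y)(Some i := u)" for Y :: "'n \<Rightarrow> 'w" and i u
    by (auto split: option.split)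
  show ?thesis
    unfolding alternating_form_def e
    using alternating_form_linear[OF alt] alternating_form_eq[OF alt, of "Some _" "Some _"] by auto
qed

lemma vec_lambda_expansion: "(x::real^'n) = (\<Sum>j\<in>UNIV. x $ j *\<^sub>R axis j 1)"
  using basis_expansion[of x] by (simp add: scalar_mult_eq_scaleR)

lemma alternating_form_linear_image:
  fixes vol :: "('n::finite option \<Rightarrow> 'w::real_vector) \<Rightarrow> real" and X :: "'n \<Rightarrow> real^'n"
  assumes alt: "alternating_form vol" and L: "linear L"
  shows "vol (case_option \<xi> (\<lambda>i. L (X i))) =
    det (\<chi> i j. X i $ j) * vol (case_option \<xi> (\<lambda>i. L (axis i 1)))"
proof -
  have "L (X i) = (\<Sum>j\<in>UNIV. (\<chi> i j. X i $ j) $ i $ j *\<^sub>R L (axis j 1))" for i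
    using arg_cong[OF vec_lambda_expansion[of "X i"], of L] by (simp add: linear_sum[OF L] linear_cmul[OF L])
  then show ?thesis
    using alternating_form_det[OF alternating_form_case_option[OF alt, of \<xi>],
        of "\<chi> i j. X i $ j" "\<lambda>i. L (axis i 1)"] by simp
qed

text \<open>The matrix is \<open>X G X^T\<close> with \<open>G\<close> the matrix of the form in the
  standard basis, which is where the square comes from.\<close>

lemma gram_det:
  fixes X :: "'n::finite \<Rightarrow> real^'n"
  assumes g: "\<And>a. linear (g a)" "\<And>b. linear (\<lambda>a. g a b)"
  shows "det (\<chi> i j. g (X i) (X j)) =
    (det (\<chi> i j. X i $ j))\<^sup>2 * (det (\<chi> i j. g (axis i 1) (axis j 1)) :: real)"
proof -
  let ?X = "(\<chi> i j. X i $ j) :: real^'n^'n"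
  let ?G = "(\<chi> i j. g (axis i 1) (axis j 1)) :: real^'n^'n"
  have e1: "g (X i) v = (\<Sum>k\<in>UNIV. X i $ k * g (axis k 1) v)" for i v
    using arg_cong[OF vec_lambda_expansion[of "X i"], of "\<lambda>a. g a v"]
    by (simp add: linear_sum[OF g(2)] linear_cmul[OF g(2)])
  have e2: "g u (X j) = (\<Sum>l\<in>UNIV. X j $ l * g u (axis l 1))" for j u
    using arg_cong[OF vec_lambda_expansion[of "X j"], of "g u"]
    by (simp add: linear_sum[OF g(1)] linear_cmul[OF g(1)])
  have "g (X i) (X j) = (\<Sum>l\<in>UNIV. (\<Sum>k\<in>UNIV. X i $ k * g (axis k 1) (axis l 1)) * X j $ l)" for i j
  proof -
    have "g (X i) (X j) = (\<Sum>l\<in>UNIV. X j $ l * g (X i) (axis l 1))" by (rule e2)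
    then show ?thesis by (simp add: e1 mult.commute)
  qed
  then have "(\<chi> i j. g (X i) (X j)) = (?X ** ?G) ** transpose ?X"
    by (simp add: vec_eq_iff matrix_matrix_mult_def transpose_def)
  then show ?thesis by (simp add: det_mul power2_eq_square)
qed

text \<open>Jacobi's formula at the identity matrix: a permutation other than the identity moves at
  least two indices, so after differentiating one factor a vanishing off-diagonal entry
  remains.\<close>

lemma has_derivative_det:
  fixes a :: "'n::finite \<Rightarrow> 'n \<Rightarrow> 'x::real_normed_vector \<Rightarrow> real"
  assumes a: "\<And>i j. (a i j has_derivative a' i j) (at x)" and id: "\<And>i j. a i j x = of_bool (i = j)"
  shows "((\<lambda>y. det (\<chi> i j. a i j y)) has_derivative (\<lambda>h. \<Sum>i\<in>UNIV. a' i i h)) (at x)"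
proof -
  let ?D = "\<lambda>h p. of_int (sign p) * (\<Sum>i\<in>UNIV. a' i (p i) h * (\<Prod>j\<in>UNIV - {i}. a j (p j) x))"
  have "((\<lambda>y. det (\<chi> i j. a i j y)) has_derivative (\<lambda>h. \<Sum>p | p permutes UNIV. ?D h p)) (at x)"
    unfolding det_def by (auto intro!: has_derivative_sum has_derivative_mult_right has_derivative_prod a)
  moreover have "(\<Sum>p | p permutes UNIV. ?D h p) = (\<Sum>i\<in>UNIV. a' i i h)" for h
  proof -
    have z: "?D h p = 0" if p: "p permutes UNIV" "p \<noteq> id" for p
    proof -
      have pz: "(\<Prod>j\<in>UNIV - {i}. a j (p j) x) = 0" for i
      proof -
        have "\<exists>j. j \<noteq> i \<and> p j \<noteq> j"
        proof (rule ccontr)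
          assume "\<not> (\<exists>j. j \<noteq> i \<and> p j \<noteq> j)"
          then have fix_all: "p j = j" if "j \<noteq> i" for j using that by blast
          moreover have "p i = i"
            using fix_all permutes_inj[OF p(1)] by (metis injD)
          ultimately show False using p(2) by (metis eq_id_iff)
        qed
        then obtain j where "j \<noteq> i" "p j \<noteq> j" by blast
        then show ?thesis by (intro prod_zero bexI[of _ j]) (auto simp: id)
      qed
      show ?thesis unfolding pz by simp
    qed
    have "(\<Sum>p | p permutes UNIV. ?D h p) = (\<Sum>p\<in>{id}. ?D h p)"
    proof (rule sum.mono_neutral_right)
      show "\<forall>p\<in>{p. p permutes UNIV} - {id}. ?D h p = 0" using z by blast
    qed (simp_all add: finite_permutations permutes_id)
    also have "\<dots> = (\<Sum>i\<in>UNIV. a' i i h)" by (simp add: id sign_id)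
    finally show ?thesis .
  qed
  ultimately show ?thesis by simp
qed

text \<open>Expanding the moving frame in its value at \<open>x\<close> through the dual functionals
  \<open>l\<close> turns the volume into a constant times the determinant of a matrix that is the
  identity at \<open>x\<close>.\<close>

lemma has_derivative_alternating_form:
  fixes vol :: "('k::finite \<Rightarrow> 'w::real_normed_vector) \<Rightarrow> real"
  assumes alt: "alternating_form vol"
    and l: "\<And>k. bounded_linear (l k)" "\<And>u. u = (\<Sum>k\<in>UNIV. l k u *\<^sub>R W k x)"
      "\<And>j k. l k (W j x) = of_bool (j = k)"
    and W: "\<And>k. (W k has_derivative W' k) (at x)"
  shows "((\<lambda>y. vol (\<lambda>k. W k y)) has_derivative (\<lambda>h. (\<Sum>k\<in>UNIV. l k (W' k h)) * vol (\<lambda>k. W k x))) (at x)"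
proof -
  have eq: "(\<lambda>y. vol (\<lambda>k. W k y)) = (\<lambda>y. det (\<chi> k j. l j (W k y)) * vol (\<lambda>k. W k x))"
  proof
    fix y
    have "vol (\<lambda>k. W k y) = vol (\<lambda>k. \<Sum>j\<in>UNIV. (\<chi> k j. l j (W k y)) $ k $ j *\<^sub>R W j x)"
      unfolding vec_lambda_beta by (rule arg_cong[of _ _ vol], rule ext, rule l(2))
    also have "\<dots> = det (\<chi> k j. l j (W k y)) * vol (\<lambda>k. W k x)" by (rule alternating_form_det[OF alt])
    finally show "vol (\<lambda>k. W k y) = det (\<chi> k j. l j (W k y)) * vol (\<lambda>k. W k x)" .
  qed
  have "((\<lambda>y. det (\<chi> k j. l j (W k y))) has_derivative (\<lambda>h. \<Sum>k\<in>UNIV. l k (W' k h))) (at x)"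
    by (rule has_derivative_det) (auto intro: bounded_linear.has_derivative[OF l(1)] W simp: l(3))
  then show ?thesis unfolding eq by (rule has_derivative_mult_left)
qed

text \<open>If \<open>vol w\<close> vanished, expanding every family in \<open>w\<close> would make
  \<open>vol\<close> vanish identically.\<close>

lemma volume_form_frame_nonzero:
  assumes vol: "volume_form vol" and l: "\<And>u. u = (\<Sum>k\<in>UNIV. l k u *\<^sub>R w k)"
  shows "vol w \<noteq> 0"
proof -
  obtain v where v: "vol v \<noteq> 0" using vol by (auto simp: volume_form_def)
  have "vol v = vol (\<lambda>i. \<Sum>j\<in>UNIV. (\<chi> i j. l j (v i)) $ i $ j *\<^sub>R w j)"
    unfolding vec_lambda_beta by (rule arg_cong[of _ _ vol], rule ext, rule l)
  also have "\<dots> = det (\<chi> i j. l j (v i)) * vol w"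
    by (rule alternating_form_det[OF volume_form_alternating[OF vol]])
  finally show ?thesis using v by auto
qed

section \<open>Non-degenerate forms, Christoffel symbols and mean curvature\<close>

text \<open>Raising an index with \<open>m\<close>. The description is the one inside
  \<open>form_trace\<close>, so that both agree by unfolding.\<close>

definition sharp :: "('e::real_vector \<Rightarrow> 'e \<Rightarrow> real) \<Rightarrow> ('e \<Rightarrow> real) \<Rightarrow> 'e"
  where "sharp m l = (THE u. \<forall>v. m u v = l v)"

lemma bilinear_linear_left: "bilinear m \<Longrightarrow> linear (\<lambda>x. m x y)"
  by (simp add: bilinear_def)

lemma bilinear_linear_right: "bilinear m \<Longrightarrow> linear (m x)"
  by (simp add: bilinear_def)

context
  fixes m :: "'e::euclidean_space \<Rightarrow> 'e \<Rightarrow> real"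
  assumes bil: "bilinear m" and nd: "nondegenerate_form m"
begin

lemma nondegenerate_eqI:
  assumes "\<And>v. m u v = m u' v"
  shows "u = u'"
proof -
  have "\<forall>v. m (u - u') v = 0"
    using assms by (simp add: bilinear_lsub[OF bil])
  then have "u - u' = 0" using nd unfolding nondegenerate_form_def by blast
  then show ?thesis by simp
qed

lemma sharp_exists:
  assumes l: "linear l"
  shows "\<exists>u. \<forall>v. m u v = l v"
proof -
  define T where "T = (\<lambda>u. \<Sum>b\<in>Basis. m u b *\<^sub>R b)"
  have T: "linear T"
    unfolding T_def by (rule linearI)
      (simp_all add: bilinear_ladd[OF bil] bilinear_lmul[OF bil] algebra_simps sum.distrib scaleR_right.sum)
  have Tb: "T u \<bullet> b = m u b" if "b \<in> Basis" for u b
    using that by (simp add: T_def)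
  have ext: "m u v = l' v" if "linear l'" "\<And>b. b \<in> Basis \<Longrightarrow> m u b = l' b" for u v l'
    using linear_eq_stdbasis[OF bilinear_linear_right[OF bil, of u] that(1)] that(2) by metis
  have "inj T"
  proof (rule injI)
    fix u u' assume "T u = T u'"
    then have "m u b = m u' b" if "b \<in> Basis" for b using Tb[OF that] by metis
    then show "u = u'" using ext[OF bilinear_linear_right[OF bil, of u']] nondegenerate_eqI by metis
  qed
  then have "surj T" using linear_injective_imp_surjective[OF T] by blast
  then obtain u where u: "T u = (\<Sum>b\<in>Basis. l b *\<^sub>R b)" by (metis surjD)
  have "m u b = l b" if "b \<in> Basis" for b
    unfolding Tb[OF that, symmetric] u using that by simp
  then show ?thesis using ext[OF l] by blast
qed

lemma sharp_eq:
  assumes "linear l"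
  shows "m (sharp m l) v = l v"
proof -
  have "\<exists>!u. \<forall>v. m u v = l v"
    using sharp_exists[OF assms] nondegenerate_eqI by metis
  then have "\<forall>v. m (sharp m l) v = l v" unfolding sharp_def by (rule theI')
  then show ?thesis by blast
qed

lemma sharp_unique:
  assumes "linear l" "\<And>v. m u v = l v"
  shows "u = sharp m l"
  by (rule nondegenerate_eqI) (simp add: assms sharp_eq)

end

lemma form_trace_sharp: "form_trace m B = (\<Sum>b\<in>Basis. B b (sharp m (\<lambda>v. b \<bullet> v)))"
  by (simp add: form_trace_def sharp_def)

text \<open>The braid argument for the uniqueness of the Levi-Civita connection: the difference tensor
  is symmetric in its first two and antisymmetric in its last two arguments.\<close>

lemma christoffel_eq:
  fixes m :: "'d::euclidean_space \<Rightarrow> 'd \<Rightarrow> 'd \<Rightarrow> real"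
  assumes bil: "bilinear (m y)" and sym: "\<And>u v. m y u v = m y v u" and nd: "nondegenerate_form (m y)"
    and G: "bilinear G" "\<And>u v. G u v = G v u"
      "\<And>w u v. Dmap (\<lambda>y'. m y' u v) y w = m y (G w u) v + m y u (G w v)"
  shows "christoffel m y = G"
  unfolding christoffel_def
proof (rule the_equality)
  fix H
  assume H: "bilinear H \<and> (\<forall>u v. H u v = H v u) \<and>
    (\<forall>w u v. Dmap (\<lambda>y'. m y' u v) y w = m y (H w u) v + m y u (H w v))"
  define E where "E w u v = m y (H w u - G w u) v" for w u v
  have E12: "E w u v = E u w v" for w u v
    unfolding E_def using H G(2) by metis
  have E23: "E w u v = - E w v u" for w u v
  proof -
    have "m y (H w u) v + m y u (H w v) = m y (G w u) v + m y u (G w v)"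
      using H G(3) by metis
    then show ?thesis
      unfolding E_def bilinear_lsub[OF bil] using sym[of u "H w v"] sym[of u "G w v"] by linarith
  qed
  have "E w u v = 0" for w u v
    using E23[of w u v] E12[of w v u] E23[of v w u] E12[of v u w] E23[of u v w] E12[of u w v] by linarith
  then have "m y (H w u) v = m y (G w u) v" for w u v
    unfolding E_def bilinear_lsub[OF bil] by simp
  then show "H = G" using nondegenerate_eqI[OF bil nd] by blast
qed (use G in blast)

text \<open>The Gauss formula in weak form: if \<open>m\<close> at \<open>y\<close> is the pullback
  of a constant form \<open>q\<close> along \<open>S\<close>, and varies to first order as if
  \<open>S\<close> had derivative \<open>H\<close>, then its Christoffel symbol is \<open>H\<close>
  tested against the image of \<open>S\<close>. It serves the embedded space, with \<open>S\<close>
  the differential of a parametrization, and the quotient, with \<open>S\<close> a horizontal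
  lift.\<close>

lemma christoffel_pullback:
  fixes m :: "'d::euclidean_space \<Rightarrow> 'd \<Rightarrow> 'd \<Rightarrow> real" and q :: "'v::real_vector \<Rightarrow> 'v \<Rightarrow> real"
  assumes q: "bilinear q" "\<And>X Y. q X Y = q Y X"
    and S: "linear S" "\<And>u v. m y u v = q (S u) (S v)" and nd: "nondegenerate_form (m y)"
    and H: "bilinear H" "\<And>u v w. q (H u v) (S w) = q (H v u) (S w)"
    and D: "\<And>u v. ((\<lambda>y'. m y' u v) has_derivative (\<lambda>w. q (H w u) (S v) + q (S u) (H w v))) (at y)"
  shows "m y (christoffel m y u v) w = q (H u v) (S w)"
proof -
  have my: "m y = (\<lambda>u v. q (S u) (S v))" using S(2) by (intro ext)
  have bil: "bilinear (m y)"
    unfolding my bilinear_def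
    by (intro conjI allI linearI)
      (simp_all add: linear_add[OF S(1)] linear_cmul[OF S(1)] bilinear_ladd[OF q(1)] bilinear_lmul[OF q(1)]
        bilinear_radd[OF q(1)] bilinear_rmul[OF q(1)])
  have l: "linear (\<lambda>w. q X (S w))" for X
    by (intro linearI)
      (simp_all add: linear_add[OF S(1)] linear_cmul[OF S(1)] bilinear_radd[OF q(1)] bilinear_rmul[OF q(1)])
  define G where "G u v = sharp (m y) (\<lambda>w. q (H u v) (S w))" for u v
  have G: "m y (G u v) w = q (H u v) (S w)" for u v w
    unfolding G_def by (rule sharp_eq[OF bil nd l])
  note eqI = nondegenerate_eqI[OF bil nd]
  have bG: "bilinear G"
    unfolding bilinear_def
    by (intro conjI allI linearI; rule eqI)
      (simp_all add: G bilinear_ladd[OF bil] bilinear_lmul[OF bil] bilinear_ladd[OF H(1)]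
        bilinear_lmul[OF H(1)] bilinear_radd[OF H(1)] bilinear_rmul[OF H(1)]
        bilinear_ladd[OF q(1)] bilinear_lmul[OF q(1)])
  have "christoffel m y = G"
  proof (rule christoffel_eq[where m = m and y = y, OF bil _ nd bG])
    show "m y u v = m y v u" for u v using q(2) S(2) by metis
    show "G u v = G v u" for u v by (rule eqI) (simp add: G H(2)[of u v])
    have "m y u (G w v) = q (S u) (H w v)" for u v w
      using G[of w v u] q(2) S(2) by metis
    then show "Dmap (\<lambda>y'. m y' u v) y w = m y (G w u) v + m y u (G w v)" for u v w
      unfolding Dmap_eq[OF D] G by simp
  qed
  then show ?thesis using G by simp
qed

text \<open>The contracted covariant derivative \<open>C\<close> differs from the mean curvature
  vector \<open>W\<close> by a tangent vector, and \<open>W\<close> is normal. A non-degenerate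
  first form splits the space, so \<open>W\<close> vanishes as soon as \<open>C\<close> is
  orthogonal to all normal vectors. The hypothesis on \<open>Q\<close> admits a Christoffel symbol
  that is known only through its pairings.\<close>

lemma mean_curvature_eq_0_iff:
  fixes g :: "('b, 'd::euclidean_space) metric" and c :: "('a, 'e::euclidean_space) chart"
    and F :: "'a \<Rightarrow> 'b" and d :: "('b, 'd) chart"
  defines "G \<equiv> local_rep F c d"
  assumes bil: "bilinear (g d (G x))" and sym: "\<And>u v. g d (G x) u v = g d (G x) v u"
    and nd: "nondegenerate_form (g d (G x))"
    and L: "linear (Dmap G x)" and ndI: "nondegenerate_form (first_form g F c d x)"
    and Q: "\<And>a b w. g d (G x) (hess G x a b + christoffel (g d) (G x) (Dmap G x a) (Dmap G x b)) w = Q a b w"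
  shows "mean_curvature g F c d x = 0 \<longleftrightarrow>
    (\<forall>w. (\<forall>e. g d (G x) w (Dmap G x e) = 0) \<longrightarrow>
       (\<Sum>b\<in>Basis. Q b (sharp (first_form g F c d x) (\<lambda>v. b \<bullet> v)) w) = 0)"
proof -
  let ?m = "g d (G x)"
  let ?L = "Dmap G x"
  define I where "I = first_form g F c d x"
  have I: "I a b = ?m (?L a) (?L b)" for a b by (simp add: I_def first_form_def G_def)
  note blin = bilinear_ladd[OF bil] bilinear_lmul[OF bil] bilinear_radd[OF bil] bilinear_rmul[OF bil]
    bilinear_lsub[OF bil] bilinear_rsub[OF bil] bilinear_lzero[OF bil] bilinear_rzero[OF bil]
    linear_add[OF L] linear_cmul[OF L]
  have bilI: "bilinear I"
    unfolding bilinear_def I by (intro conjI allI linearI) (simp_all add: blin)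
  have ndI': "nondegenerate_form I" using ndI by (simp add: I_def)
  \<comment> \<open>The tangential part is the tangent vector with the same pairings as
    \<open>v\<close> against tangent vectors, found by raising an index with the induced
    form.\<close>
  have normal: "\<exists>!w. (\<forall>e. ?m w (?L e) = 0) \<and> v - w \<in> range ?L" for v
  proof -
    have l: "linear (\<lambda>e. ?m v (?L e))" by (intro linearI) (simp_all add: blin)
    have s: "?m (?L (sharp I (\<lambda>e. ?m v (?L e)))) (?L e) = ?m v (?L e)" for e
      using sharp_eq[OF bilI ndI' l] I by metis
    show ?thesis
    proof (rule ex1I[of _ "v - ?L (sharp I (\<lambda>e. ?m v (?L e)))"])
      show "(\<forall>e. ?m (v - ?L (sharp I (\<lambda>e. ?m v (?L e)))) (?L e) = 0) \<and>
        v - (v - ?L (sharp I (\<lambda>e. ?m v (?L e)))) \<in> range ?L"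
        by (simp add: blin s)
      fix w assume w: "(\<forall>e. ?m w (?L e) = 0) \<and> v - w \<in> range ?L"
      then obtain z where z: "v - w = ?L z" by auto
      then have wz: "w = v - ?L z" by (simp add: algebra_simps)
      have "I z e = ?m v (?L e)" for e
        using w unfolding wz I by (simp add: blin)
      then have "z = sharp I (\<lambda>e. ?m v (?L e))" by (rule sharp_unique[OF bilI ndI' l])
      then show "w = v - ?L (sharp I (\<lambda>e. ?m v (?L e)))" using wz by simp
    qed
  qed
  define cov where "cov a b = hess G x a b + christoffel (g d) (G x) (?L a) (?L b)" for a b
  define N where "N v = (THE w. (\<forall>e. ?m w (?L e) = 0) \<and> v - w \<in> range ?L)" for v
  have N: "(\<forall>e. ?m (N v) (?L e) = 0) \<and> v - N v \<in> range ?L" for v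
    unfolding N_def by (rule theI'[OF normal])
  define s where "s b = sharp I (\<lambda>v. b \<bullet> v)" for b
  define C where "C = (\<Sum>b\<in>Basis. cov b (s b))"
  define W where "W = (\<Sum>b\<in>Basis. N (cov b (s b)))"
  have mc: "mean_curvature g F c d x = W"
    unfolding mean_curvature_def form_trace_sharp W_def second_form_def Let_def N_def cov_def s_def I_def G_def ..
  have suml: "?m (\<Sum>b\<in>B. f b) w = (\<Sum>b\<in>B. ?m (f b) w)" for f w and B :: "'e set"
    using linear_sum[OF bilinear_linear_left[OF bil]] .
  have QC: "(\<Sum>b\<in>Basis. Q b (s b) w) = ?m C w" for w
    unfolding C_def suml cov_def Q ..
  have W1: "?m W (?L e) = 0" for e
    unfolding W_def suml using N by simp
  have "subspace (range ?L)" using linear_subspace_image[OF L subspace_UNIV] .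
  then have "(\<Sum>b\<in>Basis. cov b (s b) - N (cov b (s b))) \<in> range ?L"
    by (rule subspace_sum) (use N in auto)
  then obtain z where z: "C - W = ?L z"
    unfolding C_def W_def sum_subtractf by auto
  show ?thesis
    unfolding mc I_def[symmetric] s_def[symmetric] QC
  proof (intro iffI allI impI)
    fix w assume "W = 0" and w: "\<forall>e. ?m w (?L e) = 0"
    then have "C = ?L z" using z by simp
    then show "?m C w = 0" using w sym by metis
  next
    assume h: "\<forall>w. (\<forall>e. ?m w (?L e) = 0) \<longrightarrow> ?m C w = 0"
    have "?m W w = ?m 0 w" for w
    proof -
      obtain z' where "w - N w = ?L z'" using N[of w] by auto
      then have w: "w = N w + ?L z'" by (simp add: algebra_simps)
      have W: "W = C - ?L z" using z by (simp add: algebra_simps)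
      have "?m W w = ?m W (N w)" by (subst w) (simp add: blin W1)
      also have "\<dots> = ?m C (N w) - ?m (N w) (?L z)" unfolding W by (simp add: blin sym)
      also have "\<dots> = 0" using h N by simp
      finally show ?thesis by (simp add: blin)
    qed
    then show "W = 0" by (rule nondegenerate_eqI[OF bil nd])
  qed
qed

section \<open>Dual pairs of centroaffine immersions\<close>

lemma sum_Basis_axis:
  fixes f :: "real^'n \<Rightarrow> 'b::comm_monoid_add"
  shows "(\<Sum>b\<in>Basis. f b) = (\<Sum>i\<in>UNIV. f (axis i (1::real)))"
proof -
  have 1: "(Basis :: (real^'n) set) = range (\<lambda>i. axis i 1)" by (auto simp: Basis_vec_def)
  have 2: "inj (\<lambda>i::'n. axis i (1::real))" by (auto simp: inj_def axis_eq_axis)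
  show ?thesis unfolding 1 sum.reindex[OF 2] comp_def ..
qed

text \<open>Biorthogonality makes \<open>w\<close> independent, so the dimension forces it to span,
  and the formula is then checked on \<open>range w\<close>. The vector space is arbitrary so that
  the dual space is covered as well.\<close>

lemma biorthogonal_expansion:
  fixes w :: "'k::finite \<Rightarrow> 'w::real_vector"
  assumes l: "\<And>k. linear (l k)" "\<And>j k. l k (w j) = (of_bool (j = k) :: real)"
    and dim: "dim (UNIV :: 'w set) = CARD('k)"
  shows "u = (\<Sum>k\<in>UNIV. l k u *\<^sub>R w k)"
proof -
  let ?E = "{u. (\<Sum>k\<in>UNIV. l k u *\<^sub>R w k) = u}"
  have lsum: "l k (\<Sum>j\<in>UNIV. c j *\<^sub>R w j) = c k" for c k
    by (simp add: linear_sum[OF l(1)] linear_cmul[OF l(1)] l(2))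
  have inj: "inj w"
  proof (rule injI)
    fix i j assume "w i = w j"
    then have "l j (w i) = l j (w j)" by simp
    then show "i = j" unfolding l(2) by (cases "i = j") simp_all
  qed
  have ind: "independent (range w)"
  proof (rule independent_if_scalars_zero)
    fix f x assume "(\<Sum>x\<in>range w. f x *\<^sub>R x) = 0" "x \<in> range w"
    then have s: "(\<Sum>k\<in>UNIV. f (w k) *\<^sub>R w k) = 0" by (simp add: sum.reindex[OF inj])
    obtain k where "x = w k" using \<open>x \<in> range w\<close> by auto
    then show "f x = 0" using lsum[of k "\<lambda>k. f (w k)"] unfolding s linear_0[OF l(1)] by simp
  qed simp
  have "span (range w) = UNIV"
  proof (rule ccontr)
    assume "span (range w) \<noteq> UNIV"
    then obtain r where r: "r \<notin> span (range w)" by blast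
    obtain E where E: "independent E" "(UNIV :: 'w set) \<subseteq> span E" "card E = CARD('k)"
      using basis_exists[of "UNIV :: 'w set"] dim by metis
    \<comment> \<open>\<open>card\<close> is 0 for infinite sets, so a positive value gives
      finiteness.\<close>
    have "finite E" by (rule card_ge_0_finite) (simp add: E(3))
    moreover have "independent (insert r (range w))" using independent_insertI[OF r ind] .
    ultimately have "card (insert r (range w)) \<le> CARD('k)"
      using independent_span_bound[of E "insert r (range w)"] E by auto
    moreover have "r \<notin> range w" using r span_base[of r "range w"] by blast
    ultimately show False using card_image[OF inj] by simp
  qed
  moreover have "subspace ?E"
  proof (rule subspaceI)
    show "0 \<in> ?E" using linear_0[OF l(1)] by simp
  next
    fix x y assume x: "x \<in> ?E" and y: "y \<in> ?E"
    have "(\<Sum>k\<in>UNIV. l k (x + y) *\<^sub>R w k) = (\<Sum>k\<in>UNIV. l k x *\<^sub>R w k) + (\<Sum>k\<in>UNIV. l k y *\<^sub>R w k)"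
      by (simp add: linear_add[OF l(1)] scaleR_add_left sum.distrib)
    then show "x + y \<in> ?E" using x y by simp
  next
    fix c x assume x: "x \<in> ?E"
    have "(\<Sum>k\<in>UNIV. l k (c *\<^sub>R x) *\<^sub>R w k) = c *\<^sub>R (\<Sum>k\<in>UNIV. l k x *\<^sub>R w k)"
      by (simp add: linear_cmul[OF l(1)] scaleR_right.sum)
    then show "c *\<^sub>R x \<in> ?E" using x by simp
  qed
  moreover have "range w \<subseteq> ?E"
  proof clarify
    fix j
    have "(\<Sum>k\<in>UNIV. l k (w j) *\<^sub>R w k) = (\<Sum>k\<in>UNIV. if k = j then w j else 0)"
      by (rule sum.cong) (auto simp: l(2))
    then show "(\<Sum>k\<in>UNIV. l k (w j) *\<^sub>R w k) = w j" by simp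
  qed
  ultimately have "UNIV \<subseteq> ?E"
    using span_minimal[of "range w" "?E"] by simp
  then have "u \<in> ?E" by blast
  then show ?thesis by (rule CollectE) (rule sym)
qed

text \<open>For \<open>B\<close> the evaluation pairing of a dual pair, this is the metric that
  \<open>ghat\<close> induces on the map \<open>(- \<phi>, \<psi>)\<close>. A general
  \<open>B\<close> lets \<open>\<phi>\<close> and \<open>\<psi>\<close> change places.\<close>

definition pair_metric ::
  "('v::real_normed_vector \<Rightarrow> 'w::real_normed_vector \<Rightarrow> real) \<Rightarrow> ('e::real_normed_vector \<Rightarrow> 'w) \<Rightarrow>
   ('e \<Rightarrow> 'v) \<Rightarrow> 'e \<Rightarrow> 'e \<Rightarrow> 'e \<Rightarrow> real"
  where "pair_metric B \<phi> \<psi> x a b = - B (Dmap \<psi> x a) (Dmap \<phi> x b)"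

text \<open>Twice the \<open>ghat\<close> product of the Hessian of
  \<open>(- \<phi>, \<psi>)\<close> with the normal vector
  \<open>(Dmap \<phi> x c, Dmap \<psi> x c)\<close>; for a dual pair it is the cubic form, that is,
  the difference of the connections induced by \<open>\<phi>\<close> and \<open>\<psi>\<close> with
  an index lowered.\<close>

definition pair_cubic ::
  "('v::real_normed_vector \<Rightarrow> 'w::real_normed_vector \<Rightarrow> real) \<Rightarrow> ('e::real_normed_vector \<Rightarrow> 'w) \<Rightarrow>
   ('e \<Rightarrow> 'v) \<Rightarrow> 'e \<Rightarrow> 'e \<Rightarrow> 'e \<Rightarrow> 'e \<Rightarrow> real"
  where "pair_cubic B \<phi> \<psi> x a b c = B (hess \<psi> x a b) (Dmap \<phi> x c) - B (Dmap \<psi> x c) (hess \<phi> x a b)"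

definition pair_trace ::
  "('v::real_normed_vector \<Rightarrow> 'w::real_normed_vector \<Rightarrow> real) \<Rightarrow> ('e::euclidean_space \<Rightarrow> 'w) \<Rightarrow>
   ('e \<Rightarrow> 'v) \<Rightarrow> 'e \<Rightarrow> 'e \<Rightarrow> real"
  where "pair_trace B \<phi> \<psi> x c =
    (\<Sum>b\<in>Basis. pair_cubic B \<phi> \<psi> x b (sharp (pair_metric B \<phi> \<psi> x) (\<lambda>v. b \<bullet> v)) c)"

definition frame :: "(real^'n \<Rightarrow> 'w::real_normed_vector) \<Rightarrow> real^'n \<Rightarrow> 'n option \<Rightarrow> 'w"
  where "frame \<phi> x = case_option (\<phi> x) (\<lambda>i. Dmap \<phi> x (axis i 1))"

definition gram :: "(real^'n \<Rightarrow> real^'n \<Rightarrow> real) \<Rightarrow> real"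
  where "gram m = det (\<chi> i j. m (axis i 1) (axis j 1))"

text \<open>Even powers remove the dependence on orientations and on the sign of the Gram determinant.\<close>

definition vol_ratio ::
  "(('n option \<Rightarrow> 'w::real_normed_vector) \<Rightarrow> real) \<Rightarrow> ('v::real_normed_vector \<Rightarrow> 'w \<Rightarrow> real) \<Rightarrow>
   (real^'n \<Rightarrow> 'w) \<Rightarrow> (real^'n \<Rightarrow> 'v) \<Rightarrow> real^'n \<Rightarrow> real"
  where "vol_ratio vol B \<phi> \<psi> x = (vol (frame \<phi> x)) ^ 4 / (gram (pair_metric B \<phi> \<psi> x))\<^sup>2"

text \<open>Kept apart from non-degeneracy: for the lift this is available only after its induced
  metric has been identified with \<open>pair_metric\<close>, and the identification already uses
  the symmetry proved here.\<close>

locale dual_map =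
  fixes U :: "(real^'n) set" and B :: "'v::real_normed_vector \<Rightarrow> 'w::real_normed_vector \<Rightarrow> real"
    and \<phi> :: "real^'n \<Rightarrow> 'w" and \<psi> :: "real^'n \<Rightarrow> 'v"
  assumes open_U: "open U" and B: "bounded_bilinear B"
    and smooth_phi: "smooth_on U \<phi>" and smooth_psi: "smooth_on U \<psi>"
    and pair_one: "x \<in> U \<Longrightarrow> B (\<psi> x) (\<phi> x) = 1"
    and pair_tangent: "x \<in> U \<Longrightarrow> B (\<psi> x) (Dmap \<phi> x a) = 0"
begin

abbreviation "gm \<equiv> pair_metric B \<phi> \<psi>"
abbreviation "C \<equiv> pair_cubic B \<phi> \<psi>"

lemma differentiable:
  assumes "x \<in> U"
  shows "\<phi> differentiable (at x)" "\<psi> differentiable (at x)"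
    "(\<lambda>y. Dmap \<phi> y a) differentiable (at x)" "(\<lambda>y. Dmap \<psi> y a) differentiable (at x)"
  by (rule smooth_on_differentiable[OF _ assms], intro smooth_on_Dmap smooth_phi smooth_psi)+

lemmas B_simps = bounded_bilinear.add_left[OF B] bounded_bilinear.add_right[OF B]
  bounded_bilinear.scaleR_left[OF B] bounded_bilinear.scaleR_right[OF B]
  bounded_bilinear.minus_left[OF B] bounded_bilinear.minus_right[OF B]
  bounded_bilinear.diff_left[OF B] bounded_bilinear.diff_right[OF B]
  bounded_bilinear.zero_left[OF B] bounded_bilinear.zero_right[OF B]

lemma pair_cotangent:
  assumes "x \<in> U"
  shows "B (Dmap \<psi> x a) (\<phi> x) = 0"
  using Dmap_bilinear_eq_0[OF open_U assms B pair_one differentiable(2,1)[OF assms], of a]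
    pair_tangent[OF assms] by simp

lemma pair_hess_phi:
  assumes "x \<in> U"
  shows "B (\<psi> x) (hess \<phi> x a b) = gm x a b"
proof -
  have "B (Dmap \<psi> x a) (Dmap \<phi> x b) = - B (\<psi> x) (Dmap (\<lambda>y. Dmap \<phi> y b) x a)"
    by (rule Dmap_bilinear_eq_0[OF open_U assms B pair_tangent differentiable(2,3)[OF assms]])
  then show ?thesis by (simp add: pair_metric_def hess_def)
qed

text \<open>\<open>hess_symmetric\<close> asks for a euclidean codomain; pairing with
  \<open>v\<close> reduces a general normed space to the real case.\<close>

lemma pair_hess_symmetric_phi:
  assumes "x \<in> U"
  shows "B v (hess \<phi> x a b) = B v (hess \<phi> x b a)"
proof -
  note bl = bounded_bilinear.bounded_linear_right[OF B, of v]
  show ?thesis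
    unfolding hess_bounded_linear[OF open_U assms smooth_phi bl, symmetric]
    by (rule hess_symmetric_real[OF open_U assms smooth_on_bounded_linear[OF open_U bl smooth_phi]])
qed

lemma pair_hess_symmetric_psi:
  assumes "x \<in> U"
  shows "B (hess \<psi> x a b) w = B (hess \<psi> x b a) w"
proof -
  note bl = bounded_bilinear.bounded_linear_left[OF B, of w]
  show ?thesis
    unfolding hess_bounded_linear[OF open_U assms smooth_psi bl, symmetric]
    by (rule hess_symmetric_real[OF open_U assms smooth_on_bounded_linear[OF open_U bl smooth_psi]])
qed

text \<open>Pairing \<open>\<psi>\<close> with the Hessian of \<open>\<phi>\<close> exhibits a
  symmetry that the definition by first derivatives hides.\<close>

lemma metric_symmetric: "x \<in> U \<Longrightarrow> gm x a b = gm x b a"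
  using pair_hess_phi pair_hess_symmetric_phi by metis

lemma pair_hess_psi:
  assumes "x \<in> U"
  shows "B (hess \<psi> x a b) (\<phi> x) = gm x a b"
proof -
  have "B (Dmap (\<lambda>y. Dmap \<psi> y b) x a) (\<phi> x) = - B (Dmap \<psi> x b) (Dmap \<phi> x a)"
    by (rule Dmap_bilinear_eq_0[OF open_U assms B pair_cotangent differentiable(4,1)[OF assms]])
  then show ?thesis
    using metric_symmetric[OF assms, of a b] by (simp add: pair_metric_def hess_def)
qed

lemma linear_D:
  assumes "x \<in> U"
  shows "linear (Dmap \<phi> x)" "linear (Dmap \<psi> x)"
  using linear_Dmap differentiable[OF assms] by blast+

lemma bilinear_metric: "x \<in> U \<Longrightarrow> bilinear (gm x)"
  unfolding bilinear_def pair_metric_def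
  by (intro conjI allI linearI) (simp_all add: linear_D linear_add linear_cmul B_simps)

end

section \<open>Cubic form and adapted frames of a dual pair\<close>

locale dual_pair = dual_map U B \<phi> \<psi>
  for U :: "(real^'n) set" and B :: "'v::real_normed_vector \<Rightarrow> 'w::real_normed_vector \<Rightarrow> real"
    and \<phi> :: "real^'n \<Rightarrow> 'w" and \<psi> :: "real^'n \<Rightarrow> 'v" +
  assumes nondegenerate: "x \<in> U \<Longrightarrow> nondegenerate_form (pair_metric B \<phi> \<psi> x)"
begin

lemma flip: "dual_pair U (\<lambda>w v. B v w) \<psi> \<phi>"
proof (intro dual_pair.intro dual_map.intro dual_pair_axioms.intro)
  show "bounded_bilinear (\<lambda>w v. B v w)" by (rule bounded_bilinear.flip[OF B])
  fix x assume x: "x \<in> U"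
  have "pair_metric (\<lambda>w v. B v w) \<psi> \<phi> x = gm x"
  proof (intro ext)
    show "pair_metric (\<lambda>w v. B v w) \<psi> \<phi> x a b = gm x a b" for a b
      using metric_symmetric[OF x, of a b] by (simp add: pair_metric_def)
  qed
  then show "nondegenerate_form (pair_metric (\<lambda>w v. B v w) \<psi> \<phi> x)"
    using nondegenerate[OF x] by simp
qed (use open_U smooth_phi smooth_psi pair_one pair_cotangent in auto)

lemma metric_flip: "x \<in> U \<Longrightarrow> pair_metric (\<lambda>w v. B v w) \<psi> \<phi> x = gm x"
  using metric_symmetric by (intro ext) (simp add: pair_metric_def)

text \<open>The metric is the same for both orders, while the two terms of \<open>pair_cubic\<close>
  trade places. So the vanishing of the trace is one condition for both immersions.\<close>

lemma trace_flip: "x \<in> U \<Longrightarrow> pair_trace (\<lambda>w v. B v w) \<psi> \<phi> x c = - pair_trace B \<phi> \<psi> x c"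
  by (simp add: pair_trace_def metric_flip pair_cubic_def sum_subtractf)

lemma has_derivative_metric:
  assumes "x \<in> U"
  shows "((\<lambda>y. gm y a b) has_derivative
    (\<lambda>c. - (B (Dmap \<psi> x a) (hess \<phi> x c b) + B (hess \<psi> x c a) (Dmap \<phi> x b)))) (at x)"
  unfolding pair_metric_def hess_def
  by (intro has_derivative_minus bounded_bilinear.FDERIV[OF B] Dmap_works differentiable[OF assms])

lemma cubic_symmetric_12: "x \<in> U \<Longrightarrow> C x a b c = C x b a c"
  unfolding pair_cubic_def
  using pair_hess_symmetric_phi[of x "Dmap \<psi> x c" a b] pair_hess_symmetric_psi[of x a b "Dmap \<phi> x c"] by simp

text \<open>Differentiating the symmetry of the metric in the direction \<open>c\<close> and sorting
  the four terms gives the Codazzi equation.\<close>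

lemma cubic_symmetric_23:
  assumes "x \<in> U"
  shows "C x c a b = C x c b a"
proof -
  have "Dmap (\<lambda>y. gm y a b) x = Dmap (\<lambda>y. gm y b a) x"
    by (rule Dmap_cong_open[OF open_U assms]) (rule metric_symmetric)
  then have "Dmap (\<lambda>y. gm y a b) x c = Dmap (\<lambda>y. gm y b a) x c" by simp
  then show ?thesis
    unfolding Dmap_eq[OF has_derivative_metric[OF assms]] pair_cubic_def by simp
qed

text \<open>The metric gradient of the \<open>i\<close>-th coordinate; the entries form the inverse
  of the Gram matrix.\<close>

definition dual_vec :: "real^'n \<Rightarrow> 'n \<Rightarrow> real^'n"
  where "dual_vec x i = sharp (gm x) (\<lambda>v. axis i 1 \<bullet> v)"

lemma dual_vec:
  assumes "x \<in> U"
  shows "gm x (dual_vec x i) v = v $ i"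
proof -
  have "linear (\<lambda>v. axis i (1::real) \<bullet> v)"
    by (rule bounded_linear.linear[OF bounded_linear_inner_right])
  from sharp_eq[OF bilinear_metric[OF assms] nondegenerate[OF assms] this]
  show ?thesis by (simp add: dual_vec_def inner_axis inner_commute)
qed

lemma dual_vec_symmetric: "x \<in> U \<Longrightarrow> dual_vec x i $ j = dual_vec x j $ i"
  using dual_vec metric_symmetric by metis

text \<open>The inverse metric is symmetric, so contracting with it does not distinguish the slots
  of \<open>\<beta>\<close>, even if \<open>\<beta>\<close> itself is not symmetric.\<close>

lemma dual_vec_swap:
  assumes x: "x \<in> U" and \<beta>: "bilinear \<beta>"
  shows "(\<Sum>i\<in>UNIV. \<beta> (axis i 1) (dual_vec x i)) = (\<Sum>i\<in>UNIV. \<beta> (dual_vec x i) (axis i 1) :: real)"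
proof -
  have r: "\<beta> u (dual_vec x i) = (\<Sum>j\<in>UNIV. dual_vec x i $ j * \<beta> u (axis j 1))" for u i
    using arg_cong[OF vec_lambda_expansion[of "dual_vec x i"], of "\<beta> u"]
    by (simp add: linear_sum[OF bilinear_linear_right[OF \<beta>]] linear_cmul[OF bilinear_linear_right[OF \<beta>]])
  have l: "\<beta> (dual_vec x i) u = (\<Sum>j\<in>UNIV. dual_vec x i $ j * \<beta> (axis j 1) u)" for u i
    using arg_cong[OF vec_lambda_expansion[of "dual_vec x i"], of "\<lambda>v. \<beta> v u"]
    by (simp add: linear_sum[OF bilinear_linear_left[OF \<beta>]] linear_cmul[OF bilinear_linear_left[OF \<beta>]])
  have "(\<Sum>i\<in>UNIV. \<beta> (axis i 1) (dual_vec x i)) =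
      (\<Sum>j\<in>UNIV. \<Sum>i\<in>UNIV. dual_vec x i $ j * \<beta> (axis i 1) (axis j 1))"
    unfolding r by (rule sum.swap)
  also have "\<dots> = (\<Sum>j\<in>UNIV. \<Sum>i\<in>UNIV. dual_vec x j $ i * \<beta> (axis i 1) (axis j 1))"
    by (intro sum.cong refl) (simp add: dual_vec_symmetric[OF x])
  also have "\<dots> = (\<Sum>j\<in>UNIV. \<beta> (dual_vec x j) (axis j 1))" unfolding l ..
  finally show ?thesis .
qed

text \<open>The basis dual to \<open>frame \<phi> x\<close>: \<open>\<psi> x\<close> kills tangent
  vectors and the differentials of \<open>\<psi>\<close> kill \<open>\<phi> x\<close>. The minus
  sign cancels the one in \<open>pair_metric\<close>.\<close>

definition coframe :: "real^'n \<Rightarrow> 'n option \<Rightarrow> 'w \<Rightarrow> real"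
  where "coframe x k u = (case k of None \<Rightarrow> B (\<psi> x) u | Some i \<Rightarrow> - B (Dmap \<psi> x (dual_vec x i)) u)"

lemma bounded_linear_coframe: "bounded_linear (coframe x k)"
proof (cases k)
  case None
  then have "coframe x k = B (\<psi> x)" by (auto simp: coframe_def)
  then show ?thesis using bounded_bilinear.bounded_linear_right[OF B] by simp
next
  case (Some i)
  then have "coframe x k = (\<lambda>u. - B (Dmap \<psi> x (dual_vec x i)) u)" by (auto simp: coframe_def)
  then show ?thesis
    using bounded_linear_minus[OF bounded_bilinear.bounded_linear_right[OF B]] by simp
qed

lemma coframe_frame:
  assumes "x \<in> U"
  shows "coframe x k (frame \<phi> x j) = of_bool (j = k)"
proof -
  have "B (Dmap \<psi> x (dual_vec x i)) (Dmap \<phi> x v) = - (v $ i)" for i v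
    using dual_vec[OF assms, of i v] unfolding pair_metric_def by linarith
  moreover have ax: "axis i (1::real) $ j = of_bool (i = j)" for i j :: 'n by (simp add: axis_def)
  ultimately show ?thesis
    using pair_one[OF assms] pair_tangent[OF assms] pair_cotangent[OF assms]
    by (auto simp: coframe_def frame_def ax split: option.split)
qed

text \<open>A vector killed by \<open>Dmap \<phi> x\<close> would be orthogonal to everything in the
  metric.\<close>

lemma inj_D_phi:
  assumes "x \<in> U"
  shows "inj (Dmap \<phi> x)"
proof (rule injI)
  fix a b assume "Dmap \<phi> x a = Dmap \<phi> x b"
  then have "gm x c a = gm x c b" for c by (simp add: pair_metric_def)
  then have "gm x a c = gm x b c" for c using metric_symmetric[OF assms] by metis
  then show "a = b" by (rule nondegenerate_eqI[OF bilinear_metric[OF assms] nondegenerate[OF assms]])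
qed

section \<open>Affine invariants for the transversal field \<open>k *\<^sub>R \<phi>\<close>\<close>

context
  assumes dimW: "dim (UNIV :: 'w set) = CARD('n option)"
begin

lemma frame_expansion: "x \<in> U \<Longrightarrow> u = (\<Sum>k\<in>UNIV. coframe x k u *\<^sub>R frame \<phi> x k)"
  by (rule biorthogonal_expansion[OF bounded_linear.linear[OF bounded_linear_coframe] coframe_frame dimW])

lemma decompose:
  assumes "x \<in> U"
  obtains v where "u = Dmap \<phi> x v + B (\<psi> x) u *\<^sub>R \<phi> x"
proof -
  have "u = (\<Sum>k\<in>UNIV. coframe x k u *\<^sub>R frame \<phi> x k)" by (rule frame_expansion[OF assms])
  also have "\<dots> = (\<Sum>i\<in>UNIV. coframe x (Some i) u *\<^sub>R Dmap \<phi> x (axis i 1)) + B (\<psi> x) u *\<^sub>R \<phi> x"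
    unfolding UNIV_option_conv by (simp add: sum.reindex frame_def coframe_def)
  also have "(\<Sum>i\<in>UNIV. coframe x (Some i) u *\<^sub>R Dmap \<phi> x (axis i 1)) =
     Dmap \<phi> x (\<Sum>i\<in>UNIV. coframe x (Some i) u *\<^sub>R axis i 1)"
    by (simp add: linear_sum[OF linear_D(1)[OF assms]] linear_cmul[OF linear_D(1)[OF assms]])
  finally show ?thesis by (rule that)
qed

lemma transversal:
  assumes x: "x \<in> U" and k: "k \<noteq> 0"
  shows "transversal_at \<phi> (\<lambda>y. k *\<^sub>R \<phi> y) x"
  unfolding transversal_at_def
proof
  show "k *\<^sub>R \<phi> x \<notin> range (Dmap \<phi> x)"
  proof
    assume "k *\<^sub>R \<phi> x \<in> range (Dmap \<phi> x)"
    then obtain a where "k *\<^sub>R \<phi> x = Dmap \<phi> x a" by auto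
    then have "B (\<psi> x) (k *\<^sub>R \<phi> x) = 0" using pair_tangent[OF x] by simp
    then show False using pair_one[OF x] k by (simp add: B_simps)
  qed
  show "span (insert (k *\<^sub>R \<phi> x) (range (Dmap \<phi> x))) = UNIV"
  proof (rule UNIV_eq_I[symmetric])
    fix u
    obtain v where "u = Dmap \<phi> x v + B (\<psi> x) u *\<^sub>R \<phi> x" using decompose[OF x] .
    then have u: "u = Dmap \<phi> x v + (B (\<psi> x) u / k) *\<^sub>R (k *\<^sub>R \<phi> x)" using k by simp
    show "u \<in> span (insert (k *\<^sub>R \<phi> x) (range (Dmap \<phi> x)))"
      by (subst u) (intro span_add span_scale span_base; simp)
  qed
qed

text \<open>\<open>\<psi> x\<close> kills the tangential part and takes the value \<open>k\<close>
  on the transversal vector.\<close>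

lemma affine_h_eq:
  assumes x: "x \<in> U" and k: "k \<noteq> 0"
  shows "affine_h \<phi> (\<lambda>y. k *\<^sub>R \<phi> y) x a b = gm x a b / k"
  unfolding affine_h_def
proof (rule the_equality)
  obtain v where "hess \<phi> x a b = Dmap \<phi> x v + B (\<psi> x) (hess \<phi> x a b) *\<^sub>R \<phi> x" using decompose[OF x] .
  then have "hess \<phi> x a b = Dmap \<phi> x v + gm x a b *\<^sub>R \<phi> x" unfolding pair_hess_phi[OF x] .
  then show "\<exists>u. hess \<phi> x a b = Dmap \<phi> x u + (gm x a b / k) *\<^sub>R k *\<^sub>R \<phi> x"
    using k by auto
next
  fix r assume "\<exists>u. hess \<phi> x a b = Dmap \<phi> x u + r *\<^sub>R k *\<^sub>R \<phi> x"
  then obtain u where "hess \<phi> x a b = Dmap \<phi> x u + r *\<^sub>R k *\<^sub>R \<phi> x" by blast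
  then have "gm x a b = B (\<psi> x) (Dmap \<phi> x u + r *\<^sub>R k *\<^sub>R \<phi> x)" using pair_hess_phi[OF x, of a b] by simp
  also have "\<dots> = r * k" by (simp add: B_simps pair_tangent[OF x] pair_one[OF x])
  finally show "r = gm x a b / k" using k by simp
qed

end

lemma D_scaled: "x \<in> U \<Longrightarrow> Dmap (\<lambda>y. k *\<^sub>R \<phi> y) x a = k *\<^sub>R Dmap \<phi> x a"
  by (rule Dmap_bounded_linear(2)[OF bounded_linear_scaleR_right differentiable(1)])

text \<open>The derivative of \<open>k *\<^sub>R \<phi>\<close> is already tangent, so its
  decomposition has no transversal part. Uniqueness comes from \<open>\<psi>\<close> for the
  coefficient and from injectivity for the tangent vector.\<close>

lemma D_scaled_decompose:
  assumes x: "x \<in> U" and k: "k \<noteq> 0"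
  shows "Dmap (\<lambda>y. k *\<^sub>R \<phi> y) x a = - Dmap \<phi> x u + r *\<^sub>R k *\<^sub>R \<phi> x \<longleftrightarrow> u = - k *\<^sub>R a \<and> r = 0"
proof
  assume eq: "Dmap (\<lambda>y. k *\<^sub>R \<phi> y) x a = - Dmap \<phi> x u + r *\<^sub>R k *\<^sub>R \<phi> x"
  have "B (\<psi> x) (k *\<^sub>R Dmap \<phi> x a) = B (\<psi> x) (- Dmap \<phi> x u + r *\<^sub>R k *\<^sub>R \<phi> x)"
    using eq D_scaled[OF x] by simp
  then have r: "r = 0" using k by (simp add: B_simps pair_tangent[OF x] pair_one[OF x])
  then have "Dmap \<phi> x (- k *\<^sub>R a) = Dmap \<phi> x u"
    using eq D_scaled[OF x] by (simp add: linear_cmul[OF linear_D(1)[OF x]] linear_neg[OF linear_D(1)[OF x]])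
  then show "u = - k *\<^sub>R a \<and> r = 0" using r injD[OF inj_D_phi[OF x]] by metis
next
  assume "u = - k *\<^sub>R a \<and> r = 0"
  then show "Dmap (\<lambda>y. k *\<^sub>R \<phi> y) x a = - Dmap \<phi> x u + r *\<^sub>R k *\<^sub>R \<phi> x"
    using D_scaled[OF x] by (simp add: linear_cmul[OF linear_D(1)[OF x]] linear_neg[OF linear_D(1)[OF x]])
qed

lemma affine_shape_eq: "x \<in> U \<Longrightarrow> k \<noteq> 0 \<Longrightarrow> affine_shape \<phi> (\<lambda>y. k *\<^sub>R \<phi> y) x a = - k *\<^sub>R a"
  unfolding affine_shape_def D_scaled_decompose by blast

lemma affine_tau_eq: "x \<in> U \<Longrightarrow> k \<noteq> 0 \<Longrightarrow> affine_tau \<phi> (\<lambda>y. k *\<^sub>R \<phi> y) x a = 0"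
  unfolding affine_tau_def D_scaled_decompose by blast

end

section \<open>The volume ratio and its logarithmic derivative\<close>

lemma gram_det_left:
  fixes X :: "'n::finite \<Rightarrow> real^'n" and g :: "real^'n \<Rightarrow> real^'n \<Rightarrow> real"
  assumes g: "\<And>b. linear (\<lambda>a. g a b)"
  shows "det (\<chi> i j. g (X i) (axis j 1)) = det (\<chi> i j. X i $ j) * gram g"
proof -
  have "g (X i) v = (\<Sum>k\<in>UNIV. X i $ k * g (axis k 1) v)" for i v
    using arg_cong[OF vec_lambda_expansion[of "X i"], of "\<lambda>a. g a v"]
    by (simp add: linear_sum[OF g] linear_cmul[OF g])
  then have "(\<chi> i j. g (X i) (axis j 1)) = (\<chi> i j. X i $ j) ** (\<chi> i j. g (axis i 1) (axis j 1))"
    by (simp add: vec_eq_iff matrix_matrix_mult_def)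
  then show ?thesis by (simp add: det_mul gram_def)
qed

lemma det_scaled: "det (\<chi> i j. c * (A i j :: real)) = c ^ CARD('n) * det (\<chi> i j. A i j :: real^'n^'n)"
proof -
  have "(\<chi> i j. c * A i j) = (\<chi> i. c *s (\<chi> j. A i j :: real^'n))" by (simp add: vec_eq_iff)
  then show ?thesis using det_rows_mul[of "\<lambda>i. c" "\<lambda>i. (\<chi> j. A i j :: real^'n)"] by simp
qed

text \<open>Even powers of nonnegative numbers may be compared; the exponents are those of
  \<open>vol_ratio\<close>.\<close>

lemma sqrt_eq_iff_power4:
  fixes a b :: real
  assumes "0 \<le> a" "0 \<le> b"
  shows "a = sqrt b \<longleftrightarrow> a ^ 4 = b\<^sup>2"
proof -
  have "a = sqrt b \<longleftrightarrow> a\<^sup>2 = b"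
    using assms by (metis real_sqrt_pow2 real_sqrt_unique)
  also have "\<dots> \<longleftrightarrow> (a\<^sup>2)\<^sup>2 = b\<^sup>2"
    by (subst power2_eq_iff_nonneg) (use assms in auto)
  also have "(a\<^sup>2)\<^sup>2 = a ^ 4" by (simp flip: power_mult)
  finally show ?thesis .
qed

context dual_pair
begin

lemma gram_dual:
  assumes x: "x \<in> U"
  shows "det (\<chi> i j. dual_vec x i $ j) * gram (gm x) = 1"
proof -
  have "det (\<chi> i j. gm x (dual_vec x i) (axis j 1)) = det (\<chi> i j. dual_vec x i $ j) * gram (gm x)"
    by (rule gram_det_left) (rule bilinear_linear_left[OF bilinear_metric[OF x]])
  moreover have "(\<chi> i j. gm x (dual_vec x i) (axis j 1)) = mat 1"
    by (simp add: dual_vec[OF x] vec_eq_iff mat_def axis_def)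
  ultimately show ?thesis by simp
qed

lemma gram_nonzero: "x \<in> U \<Longrightarrow> gram (gm x) \<noteq> 0"
  using gram_dual by fastforce

text \<open>Putting the dual vectors of the fixed point \<open>x\<close> into the left slot changes
  the Gram determinant by a constant factor and makes its matrix the identity at \<open>x\<close>,
  as \<open>has_derivative_det\<close> requires.\<close>

lemma has_derivative_gram:
  assumes x: "x \<in> U"
  shows "((\<lambda>y. gram (gm y)) has_derivative
    (\<lambda>c. (\<Sum>i\<in>UNIV. - (B (Dmap \<psi> x (dual_vec x i)) (hess \<phi> x c (axis i 1)) +
       B (hess \<psi> x c (dual_vec x i)) (Dmap \<phi> x (axis i 1)))) * gram (gm x))) (at x)"
proof -
  have "((\<lambda>y. det (\<chi> i j. gm y (dual_vec x i) (axis j 1))) has_derivative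
    (\<lambda>c. \<Sum>i\<in>UNIV. - (B (Dmap \<psi> x (dual_vec x i)) (hess \<phi> x c (axis i 1)) +
       B (hess \<psi> x c (dual_vec x i)) (Dmap \<phi> x (axis i 1))))) (at x)" (is "(_ has_derivative ?D) _")
    by (rule has_derivative_det[OF has_derivative_metric[OF x]])
      (simp add: dual_vec[OF x] axis_def)
  from has_derivative_mult_left[OF this, of "gram (gm x)"]
  have h: "((\<lambda>y. det (\<chi> i j. gm y (dual_vec x i) (axis j 1)) * gram (gm x)) has_derivative
      (\<lambda>c. ?D c * gram (gm x))) (at x)" .
  have eq: "det (\<chi> i j. gm y (dual_vec x i) (axis j 1)) * gram (gm x) = gram (gm y)" if y: "y \<in> U" for y
  proof -
    have "det (\<chi> i j. gm y (dual_vec x i) (axis j 1)) = det (\<chi> i j. dual_vec x i $ j) * gram (gm y)"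
      by (rule gram_det_left) (rule bilinear_linear_left[OF bilinear_metric[OF y]])
    then show ?thesis using gram_dual[OF x] by simp
  qed
  show ?thesis by (rule has_derivative_transform_within_open[OF h open_U x eq])
qed

lemma has_derivative_frame:
  assumes x: "x \<in> U"
  shows "((\<lambda>y. frame \<phi> y k) has_derivative
    (\<lambda>c. case k of None \<Rightarrow> Dmap \<phi> x c | Some i \<Rightarrow> hess \<phi> x c (axis i 1))) (at x)"
  using Dmap_works[OF differentiable(1)[OF x]] Dmap_works[OF differentiable(3)[OF x]]
  by (cases k) (auto simp: frame_def hess_def)

context
  fixes vol :: "('n option \<Rightarrow> 'w) \<Rightarrow> real"
  assumes vol: "volume_form vol"
begin

lemma dim_W: "dim (UNIV :: 'w set) = CARD('n option)"
  using vol by (simp add: volume_form_def)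

lemma vol_frame_nonzero: "x \<in> U \<Longrightarrow> vol (frame \<phi> x) \<noteq> 0"
  using volume_form_frame_nonzero[OF vol frame_expansion[OF dim_W]] .

lemma has_derivative_vol_frame:
  assumes x: "x \<in> U"
  shows "((\<lambda>y. vol (frame \<phi> y)) has_derivative
    (\<lambda>c. (\<Sum>i\<in>UNIV. - B (Dmap \<psi> x (dual_vec x i)) (hess \<phi> x c (axis i 1))) * vol (frame \<phi> x))) (at x)"
proof -
  have "((\<lambda>y. vol (\<lambda>k. frame \<phi> y k)) has_derivative
    (\<lambda>c. (\<Sum>k\<in>UNIV. coframe x k (case k of None \<Rightarrow> Dmap \<phi> x c | Some i \<Rightarrow> hess \<phi> x c (axis i 1))) *
      vol (\<lambda>k. frame \<phi> x k))) (at x)"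
    by (rule has_derivative_alternating_form[OF volume_form_alternating[OF vol] bounded_linear_coframe
          frame_expansion[OF dim_W x] coframe_frame[OF x] has_derivative_frame[OF x]])
  \<comment> \<open>The \<open>None\<close> slot contributes nothing: the derivative of
    \<open>\<phi>\<close> is tangent, and \<open>\<psi> x\<close> annihilates it.\<close>
  moreover have "(\<Sum>k\<in>UNIV. coframe x k (case k of None \<Rightarrow> Dmap \<phi> x c | Some i \<Rightarrow> hess \<phi> x c (axis i 1))) =
     (\<Sum>i\<in>UNIV. - B (Dmap \<psi> x (dual_vec x i)) (hess \<phi> x c (axis i 1)))" for c
    unfolding UNIV_option_conv by (simp add: sum.reindex coframe_def pair_tangent[OF x])
  ultimately show ?thesis by simp
qed

lemma vol_ratio_pos: "x \<in> U \<Longrightarrow> vol_ratio vol B \<phi> \<psi> x > 0"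
  using vol_frame_nonzero gram_nonzero by (simp add: vol_ratio_def zero_less_power_eq)

lemma pair_trace_alt:
  assumes x: "x \<in> U"
  shows "pair_trace B \<phi> \<psi> x c =
    (\<Sum>i\<in>UNIV. B (hess \<psi> x c (dual_vec x i)) (Dmap \<phi> x (axis i 1))) -
    (\<Sum>i\<in>UNIV. B (Dmap \<psi> x (dual_vec x i)) (hess \<phi> x c (axis i 1)))"
proof -
  have "C x b v c = C x c v b" for b v
    using cubic_symmetric_12[OF x] cubic_symmetric_23[OF x] by metis
  then have "pair_trace B \<phi> \<psi> x c = (\<Sum>i\<in>UNIV. C x c (dual_vec x i) (axis i 1))"
    by (simp add: pair_trace_def sum_Basis_axis dual_vec_def)
  \<comment> \<open>\<open>pair_cubic\<close> has the dual vector inside the Hessian of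
    \<open>\<phi>\<close>, whereas the derivatives of the volume and of the Gram determinant have it
    in the differential of \<open>\<psi>\<close>.\<close>
  moreover have "(\<Sum>i\<in>UNIV. B (Dmap \<psi> x (axis i 1)) (hess \<phi> x c (dual_vec x i))) =
      (\<Sum>i\<in>UNIV. B (Dmap \<psi> x (dual_vec x i)) (hess \<phi> x c (axis i 1)))"
  proof (rule dual_vec_swap[OF x])
    show "bilinear (\<lambda>a b. B (Dmap \<psi> x a) (hess \<phi> x c b))"
      unfolding bilinear_def
      by (intro conjI allI linearI)
        (simp_all add: linear_add[OF linear_D(2)[OF x]] linear_cmul[OF linear_D(2)[OF x]] B_simps
          linear_add[OF linear_hess_right[OF open_U x smooth_phi]]
          linear_cmul[OF linear_hess_right[OF open_U x smooth_phi]])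
  qed
  ultimately show ?thesis by (simp add: pair_cubic_def sum_subtractf)
qed

text \<open>Logarithmically, the fourth power of the volume contributes \<open>- 4 * s\<close> and
  the inverse square of the Gram determinant \<open>2 * (s + t)\<close>; the sum is
  \<open>2 * (t - s)\<close>, twice the trace.\<close>

lemma has_derivative_vol_ratio:
  assumes x: "x \<in> U"
  shows "(vol_ratio vol B \<phi> \<psi> has_derivative
    (\<lambda>c. 2 * vol_ratio vol B \<phi> \<psi> x * pair_trace B \<phi> \<psi> x c)) (at x)"
proof -
  define \<theta> where "\<theta> = vol (frame \<phi> x)"
  define g where "g = gram (gm x)"
  define s where "s c = (\<Sum>i\<in>UNIV. B (Dmap \<psi> x (dual_vec x i)) (hess \<phi> x c (axis i 1)))" for c
  define t where "t c = (\<Sum>i\<in>UNIV. B (hess \<psi> x c (dual_vec x i)) (Dmap \<phi> x (axis i 1)))" for c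
  have g0: "g \<noteq> 0" using gram_nonzero[OF x] by (simp add: g_def)
  have d1: "((\<lambda>y. vol (frame \<phi> y)) has_derivative (\<lambda>c. - s c * \<theta>)) (at x)"
    using has_derivative_vol_frame[OF x] by (simp add: s_def \<theta>_def sum_negf)
  have d2: "((\<lambda>y. gram (gm y)) has_derivative (\<lambda>c. - (s c + t c) * g)) (at x)"
    using has_derivative_gram[OF x] by (simp add: s_def t_def g_def sum.distrib sum_subtractf sum_negf)
  have n4: "((\<lambda>y. (vol (frame \<phi> y)) ^ 4) has_derivative (\<lambda>c. 4 * (- s c * \<theta>) * \<theta> ^ 3)) (at x)"
    using has_derivative_power[OF d1, of 4] by (simp add: \<theta>_def)
  have n2: "((\<lambda>y. (gram (gm y))\<^sup>2) has_derivative (\<lambda>c. 2 * (- (s c + t c) * g) * g)) (at x)"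
    using has_derivative_power[OF d2, of 2] by (simp add: g_def)
  have "((\<lambda>y. (vol (frame \<phi> y)) ^ 4 / (gram (gm y))\<^sup>2) has_derivative
     (\<lambda>c. (4 * (- s c * \<theta>) * \<theta> ^ 3 * g\<^sup>2 - \<theta> ^ 4 * (2 * (- (s c + t c) * g) * g)) / (g\<^sup>2 * g\<^sup>2))) (at x)"
    using has_derivative_divide'[OF n4 n2] g0 by (simp add: g_def \<theta>_def)
  moreover have "(4 * (- s c * \<theta>) * \<theta> ^ 3 * g\<^sup>2 - \<theta> ^ 4 * (2 * (- (s c + t c) * g) * g)) / (g\<^sup>2 * g\<^sup>2) =
     2 * (\<theta> ^ 4 / g\<^sup>2) * (t c - s c)" for c
    using g0 by (simp add: divide_simps power2_eq_square power3_eq_cube power4_eq_xxxx algebra_simps)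
  ultimately have "((\<lambda>y. (vol (frame \<phi> y)) ^ 4 / (gram (gm y))\<^sup>2) has_derivative
     (\<lambda>c. 2 * (\<theta> ^ 4 / g\<^sup>2) * (t c - s c))) (at x)" by simp
  moreover have "vol_ratio vol B \<phi> \<psi> = (\<lambda>y. (vol (frame \<phi> y)) ^ 4 / (gram (gm y))\<^sup>2)"
    by (auto simp: vol_ratio_def)
  moreover have "pair_trace B \<phi> \<psi> x c = t c - s c" for c
    by (simp add: pair_trace_alt[OF x] s_def t_def)
  ultimately show ?thesis by (simp add: \<theta>_def g_def)
qed

text \<open>Both sides carry the factor \<open>\<bar>det X\<bar>\<close>, so the standard frame
  decides. There the fourth powers are \<open>\<bar>k\<bar> ^ 4 * \<theta> ^ 4\<close> and
  \<open>g\<^sup>2 / \<bar>k\<bar> ^ (2 * CARD('n))\<close>, the latter because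
  \<open>affine_h\<close> is the metric divided by \<open>k\<close>.\<close>

lemma blaschke_condition:
  assumes x: "x \<in> U" and k: "k \<noteq> 0"
  shows "(\<forall>X :: 'n \<Rightarrow> real^'n. \<bar>vol (case_option (k *\<^sub>R \<phi> x) (\<lambda>i. Dmap \<phi> x (X i)))\<bar> =
      sqrt \<bar>det (\<chi> i j. affine_h \<phi> (\<lambda>y. k *\<^sub>R \<phi> y) x (X i) (X j))\<bar>) \<longleftrightarrow>
    vol_ratio vol B \<phi> \<psi> x * \<bar>k\<bar> ^ (2 * CARD('n) + 4) = 1"
proof -
  define \<theta> where "\<theta> = vol (frame \<phi> x)"
  define g where "g = gram (gm x)"
  have g0: "g \<noteq> 0" using gram_nonzero[OF x] by (simp add: g_def)
  have lhs: "vol (case_option (k *\<^sub>R \<phi> x) (\<lambda>i. Dmap \<phi> x (X i))) = det (\<chi> i j. X i $ j) * (k * \<theta>)"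
    for X :: "'n \<Rightarrow> real^'n"
  proof -
    have "case_option (k *\<^sub>R \<phi> x) (\<lambda>i. Dmap \<phi> x (axis i 1)) = (frame \<phi> x)(None := k *\<^sub>R frame \<phi> x None)"
    proof
      show "case_option (k *\<^sub>R \<phi> x) (\<lambda>i. Dmap \<phi> x (axis i 1)) j = ((frame \<phi> x)(None := k *\<^sub>R frame \<phi> x None)) j" for j
        by (cases j) (simp_all add: frame_def)
    qed
    then have "vol (case_option (k *\<^sub>R \<phi> x) (\<lambda>i. Dmap \<phi> x (axis i 1))) =
        vol ((frame \<phi> x)(None := k *\<^sub>R frame \<phi> x None))" by (rule arg_cong[of _ _ vol])
    also have "\<dots> = k * vol ((frame \<phi> x)(None := frame \<phi> x None))"
      by (rule alternating_form_scaleR[OF volume_form_alternating[OF vol]])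
    also have "\<dots> = k * \<theta>" unfolding \<theta>_def fun_upd_triv ..
    finally have "vol (case_option (k *\<^sub>R \<phi> x) (\<lambda>i. Dmap \<phi> x (axis i 1))) = k * \<theta>" .
    then show ?thesis
      using alternating_form_linear_image[OF volume_form_alternating[OF vol] linear_D(1)[OF x],
          of "k *\<^sub>R \<phi> x" X] by simp
  qed
  have rhs: "det (\<chi> i j. affine_h \<phi> (\<lambda>y. k *\<^sub>R \<phi> y) x (X i) (X j)) =
     (1 / k) ^ CARD('n) * ((det (\<chi> i j. X i $ j))\<^sup>2 * g)" for X :: "'n \<Rightarrow> real^'n"
  proof -
    have "affine_h \<phi> (\<lambda>y. k *\<^sub>R \<phi> y) x a b = (1 / k) * gm x a b" for a b
      using affine_h_eq[OF dim_W x k] by simp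
    then have "det (\<chi> i j. affine_h \<phi> (\<lambda>y. k *\<^sub>R \<phi> y) x (X i) (X j)) =
       (1 / k) ^ CARD('n) * det (\<chi> i j. gm x (X i) (X j))" using det_scaled[of "1 / k"] by simp
    then show ?thesis
      using gram_det[of "gm x" X] bilinear_metric[OF x] by (simp add: bilinear_def g_def gram_def)
  qed
  have main: "\<bar>k * \<theta>\<bar> = sqrt \<bar>(1 / k) ^ CARD('n) * g\<bar> \<longleftrightarrow>
      vol_ratio vol B \<phi> \<psi> x * \<bar>k\<bar> ^ (2 * CARD('n) + 4) = 1"
  proof -
    have "\<bar>k * \<theta>\<bar> = sqrt \<bar>(1 / k) ^ CARD('n) * g\<bar> \<longleftrightarrow> (\<bar>k * \<theta>\<bar>) ^ 4 = \<bar>(1 / k) ^ CARD('n) * g\<bar>\<^sup>2"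
      by (rule sqrt_eq_iff_power4) auto
    also have "\<bar>k * \<theta>\<bar> ^ 4 = \<bar>k\<bar> ^ 4 * \<theta> ^ 4" by (simp add: abs_mult power_mult_distrib)
    also have "\<bar>(1 / k) ^ CARD('n) * g\<bar>\<^sup>2 = g\<^sup>2 / \<bar>k\<bar> ^ (2 * CARD('n))"
    proof -
      have "\<bar>k\<bar> ^ (2 * CARD('n)) = (k ^ CARD('n))\<^sup>2"
        by (simp only: power_even_eq power_abs[symmetric] abs_power2)
      then show ?thesis by (simp add: power_mult_distrib power_divide)
    qed
    also have "\<bar>k\<bar> ^ 4 * \<theta> ^ 4 = g\<^sup>2 / \<bar>k\<bar> ^ (2 * CARD('n)) \<longleftrightarrow>
       \<theta> ^ 4 / g\<^sup>2 * (\<bar>k\<bar> ^ (2 * CARD('n)) * \<bar>k\<bar> ^ 4) = 1"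
      using g0 k by (auto simp: divide_simps algebra_simps)
    finally show ?thesis by (simp add: vol_ratio_def \<theta>_def g_def power_add)
  qed
  show ?thesis
    unfolding lhs rhs
  proof
    assume h: "\<forall>X :: 'n \<Rightarrow> real^'n. \<bar>det (\<chi> i j. X i $ j) * (k * \<theta>)\<bar> =
      sqrt \<bar>(1 / k) ^ CARD('n) * ((det (\<chi> i j. X i $ j))\<^sup>2 * g)\<bar>"
    have "(\<chi> i j. axis i (1::real) $ j) = (mat 1 :: real^'n^'n)"
      by (simp add: vec_eq_iff mat_def axis_def)
    then have "\<bar>k * \<theta>\<bar> = sqrt \<bar>(1 / k) ^ CARD('n) * g\<bar>"
      using h[rule_format, of "\<lambda>i. axis i 1"] by simp
    then show "vol_ratio vol B \<phi> \<psi> x * \<bar>k\<bar> ^ (2 * CARD('n) + 4) = 1" using main by simp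
  next
    assume "vol_ratio vol B \<phi> \<psi> x * \<bar>k\<bar> ^ (2 * CARD('n) + 4) = 1"
    then have m: "\<bar>k * \<theta>\<bar> = sqrt \<bar>(1 / k) ^ CARD('n) * g\<bar>" using main by simp
    show "\<forall>X :: 'n \<Rightarrow> real^'n. \<bar>det (\<chi> i j. X i $ j) * (k * \<theta>)\<bar> =
      sqrt \<bar>(1 / k) ^ CARD('n) * ((det (\<chi> i j. X i $ j))\<^sup>2 * g)\<bar>"
    proof
      fix X :: "'n \<Rightarrow> real^'n"
      let ?d = "det (\<chi> i j. X i $ j)"
      have "\<bar>(1 / k) ^ CARD('n) * (?d\<^sup>2 * g)\<bar> = ?d\<^sup>2 * \<bar>(1 / k) ^ CARD('n) * g\<bar>"
        by (simp add: abs_mult)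
      then have "sqrt \<bar>(1 / k) ^ CARD('n) * (?d\<^sup>2 * g)\<bar> = \<bar>?d\<bar> * sqrt \<bar>(1 / k) ^ CARD('n) * g\<bar>"
        by (simp add: real_sqrt_mult)
      then show "\<bar>?d * (k * \<theta>)\<bar> = sqrt \<bar>(1 / k) ^ CARD('n) * (?d\<^sup>2 * g)\<bar>"
        using m by (simp add: abs_mult)
    qed
  qed
qed

text \<open>The frame volume scales with \<open>d\<close> and the Gram determinant with its square,
  so numerator and denominator both gain the fourth power of \<open>d\<close>. The condition
  \<open>nz\<close> excludes \<open>d = 0\<close>.\<close>

lemma vol_ratio_reparametrize:
  assumes x: "x \<in> U" and T: "linear T"
    and \<phi>': "\<phi>' x' = \<phi> x" "\<And>a. Dmap \<phi>' x' a = Dmap \<phi> x (T a)"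
    and \<psi>': "\<And>a. Dmap \<psi>' x' a = Dmap \<psi> x (T a)"
    and nz: "gram (pair_metric B \<phi>' \<psi>' x') \<noteq> 0"
  shows "vol_ratio vol B \<phi>' \<psi>' x' = vol_ratio vol B \<phi> \<psi> x"
proof -
  define d where "d = det (\<chi> i j. T (axis i 1) $ j)"
  have m: "pair_metric B \<phi>' \<psi>' x' a b = gm x (T a) (T b)" for a b
    by (simp add: pair_metric_def \<phi>' \<psi>')
  have "gram (pair_metric B \<phi>' \<psi>' x') = d\<^sup>2 * gram (gm x)"
    unfolding gram_def m d_def
    by (rule gram_det[of "gm x" "\<lambda>i. T (axis i 1)"]) (use bilinear_metric[OF x] in \<open>auto simp: bilinear_def\<close>)
  moreover have "vol (frame \<phi>' x') = d * vol (frame \<phi> x)"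
    unfolding frame_def \<phi>' d_def
    by (rule alternating_form_linear_image[OF volume_form_alternating[OF vol] linear_D(1)[OF x], of "\<phi> x" "\<lambda>i. T (axis i 1)"])
  moreover from calculation have "d \<noteq> 0" using nz by auto
  ultimately show ?thesis
    by (simp add: vol_ratio_def power_mult_distrib)
qed

end

end

section \<open>Charts\<close>

context
  fixes T :: "'a topology" and c :: "('a, 'e::euclidean_space) chart"
  assumes c: "is_chart T c"
begin

lemma chart_homeo: "homeomorphic_map (subtopology T (fst c)) (top_of_set (crange c)) (snd c)"
  using c by (simp add: is_chart_def)

lemma chart_dom_subset: "fst c \<subseteq> topspace T"
  by (rule openin_subset) (use c in \<open>simp add: is_chart_def\<close>)

lemma chart_topspace: "topspace (subtopology T (fst c)) = fst c"
  unfolding topspace_subtopology using chart_dom_subset by blast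

lemma chart_inj: "inj_on (snd c) (fst c)"
  using homeomorphic_imp_injective_map[OF chart_homeo] unfolding chart_topspace .

lemma chart_open_crange: "open (crange c)"
  using c by (simp add: is_chart_def)

lemma param_in_dom: "x \<in> crange c \<Longrightarrow> param c x \<in> fst c"
  by (simp add: param_def crange_def inv_into_into)

lemma coord_param: "x \<in> crange c \<Longrightarrow> snd c (param c x) = x"
  by (simp add: param_def crange_def f_inv_into_f)

lemma param_coord: "p \<in> fst c \<Longrightarrow> param c (snd c p) = p"
  by (simp add: param_def chart_inj inv_into_f_f)

lemma coord_in_crange: "p \<in> fst c \<Longrightarrow> snd c p \<in> crange c"
  by (simp add: crange_def)

lemma local_dom_eq: "local_dom F c d = {x \<in> crange c. F (param c x) \<in> fst d}"
proof (intro set_eqI iffI)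
  fix x assume "x \<in> local_dom F c d"
  then obtain p where "p \<in> fst c" "F p \<in> fst d" "x = snd c p" by (auto simp: local_dom_def)
  then show "x \<in> {x \<in> crange c. F (param c x) \<in> fst d}" by (simp add: coord_in_crange param_coord)
next
  fix x assume "x \<in> {x \<in> crange c. F (param c x) \<in> fst d}"
  then show "x \<in> local_dom F c d"
    unfolding local_dom_def using param_in_dom[of x] coord_param[of x, symmetric] by blast
qed

lemma chart_continuous: "continuous_map (subtopology T (fst c)) euclidean (snd c)"
  using homeomorphic_imp_continuous_map[OF chart_homeo] by (simp add: continuous_map_in_subtopology)

end

section \<open>The ambient space\<close>

lemma bounded_bilinear_ghat: "bounded_bilinear (ghat :: 'n::finite amb \<Rightarrow> 'n amb \<Rightarrow> real)"
proof (rule bounded_bilinear.intro)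
  show "\<exists>K. \<forall>a b :: 'n amb. norm (ghat a b) \<le> norm a * norm b * K"
  proof (intro exI allI)
    fix a b :: "'n amb"
    have "\<bar>blinfun_apply (snd a) (fst b)\<bar> \<le> norm (snd a) * norm (fst b)"
      "\<bar>blinfun_apply (snd b) (fst a)\<bar> \<le> norm (snd b) * norm (fst a)"
      using norm_blinfun[of "snd a" "fst b"] norm_blinfun[of "snd b" "fst a"] by simp_all
    moreover have "norm (snd a) * norm (fst b) \<le> norm a * norm b"
      using norm_snd_le[of "snd a" "fst a"] norm_fst_le[of "fst b" "snd b"] by (intro mult_mono) auto
    moreover have "norm (snd b) * norm (fst a) \<le> norm b * norm a"
      using norm_snd_le[of "snd b" "fst b"] norm_fst_le[of "fst a" "snd a"] by (intro mult_mono) auto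
    ultimately show "norm (ghat a b) \<le> norm a * norm b * 1"
      unfolding ghat_def real_norm_def by (simp add: mult.commute[of "norm b"])
  qed
qed (simp_all add: ghat_def blinfun.add_left blinfun.add_right blinfun.scaleR_left blinfun.scaleR_right
    field_simps)

lemma bilinear_ghat: "bilinear (ghat :: 'n::finite amb \<Rightarrow> 'n amb \<Rightarrow> real)"
  unfolding bilinear_def
  by (intro conjI allI bounded_linear.linear bounded_bilinear.bounded_linear_left[OF bounded_bilinear_ghat]
      bounded_bilinear.bounded_linear_right[OF bounded_bilinear_ghat])

lemma ghat_commute: "ghat z w = ghat w z"
  by (simp add: ghat_def)

lemmas ghat_simps = bilinear_ladd[OF bilinear_ghat] bilinear_lmul[OF bilinear_ghat]
  bilinear_radd[OF bilinear_ghat] bilinear_rmul[OF bilinear_ghat] bilinear_lsub[OF bilinear_ghat]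
  bilinear_rsub[OF bilinear_ghat] bilinear_lzero[OF bilinear_ghat] bilinear_rzero[OF bilinear_ghat]
  bilinear_lneg[OF bilinear_ghat] bilinear_rneg[OF bilinear_ghat]

definition zeta :: "'n::finite amb \<Rightarrow> 'n amb"
  where "zeta z = (fst z, - snd z)"

lemma ghat_self: "z \<in> hyp \<Longrightarrow> ghat z z = -1"
  by (simp add: hyp_def ghat_def)

lemma ghat_zeta: "z \<in> hyp \<Longrightarrow> ghat (zeta z) (zeta z) = 1"
  by (simp add: hyp_def ghat_def zeta_def blinfun.minus_left)

lemma ghat_zeta_self: "ghat z (zeta z) = 0"
  by (simp add: ghat_def zeta_def blinfun.minus_left)

text \<open>Up to a factor, the two equations of \<open>hor\<close> are the sum and the difference
  of these orthogonality relations.\<close>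

lemma hor_iff: "w \<in> hor z \<longleftrightarrow> ghat z w = 0 \<and> ghat (zeta z) w = 0"
  by (auto simp: hor_def ghat_def zeta_def blinfun.minus_left)

text \<open>Replacing a functional by its values on \<open>Basis\<close> embeds the ambient space
  into a euclidean space, where dimensions can be counted.\<close>

definition coords :: "'n::finite amb \<Rightarrow> (real^'n option) \<times> (real^'n option)"
  where "coords z = (fst z, \<Sum>b\<in>Basis. blinfun_apply (snd z) b *\<^sub>R b)"

lemma bounded_linear_coords: "bounded_linear (coords :: 'n::finite amb \<Rightarrow> _)"
proof -
  have "bounded_linear (\<lambda>z :: 'n amb. blinfun_apply (snd z) b)" for b
    by (rule bounded_linear_compose[OF bounded_bilinear.bounded_linear_left[OF bounded_bilinear_blinfun_apply]
          bounded_linear_snd])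
  then have "bounded_linear (\<lambda>z :: 'n amb. blinfun_apply (snd z) b *\<^sub>R b)" for b
    by (rule bounded_linear_compose[OF bounded_linear_scaleR_left])
  then show ?thesis
    unfolding coords_def by (intro bounded_linear_Pair bounded_linear_fst bounded_linear_sum)
qed

lemma inj_coords: "inj (coords :: 'n::finite amb \<Rightarrow> _)"
proof (rule injI)
  fix z w :: "'n amb" assume eq: "coords z = coords w"
  have "blinfun_apply (snd z) b = blinfun_apply (snd w) b" if "b \<in> Basis" for b
  proof -
    have "(\<Sum>b\<in>Basis. blinfun_apply (snd z) b *\<^sub>R b) \<bullet> b = (\<Sum>b\<in>Basis. blinfun_apply (snd w) b *\<^sub>R b) \<bullet> b"
      using eq by (simp add: coords_def)
    then show ?thesis using that by simp
  qed
  then have "snd z = snd w" by (rule blinfun_euclidean_eqI)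
  then show "z = w" using eq by (simp add: coords_def prod_eq_iff)
qed

lemma card_option: "CARD('n::finite option) = Suc CARD('n)"
  by (simp add: UNIV_option_conv card_image)

lemma amb_linear_inj_imp_surj:
  fixes L :: "'e::euclidean_space \<Rightarrow> 'n::finite amb"
  assumes L: "linear L" "inj L" and dim: "DIM('e) = 2 * CARD('n option)"
  shows "surj L"
proof -
  let ?L = "coords \<circ> L"
  have lin: "linear ?L"
    by (rule linear_compose[OF L(1) bounded_linear.linear[OF bounded_linear_coords]])
  have inj: "inj ?L" by (rule inj_compose[OF inj_coords L(2)])
  have "dim (range ?L) = DIM('e)" using dim_image_eq[OF lin, of UNIV] inj by simp
  then have "span (range ?L) = UNIV" using dim by (simp flip: dim_eq_full)
  then have "range ?L = UNIV"
    using linear_subspace_image[OF lin subspace_UNIV] span_eq_iff by blast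
  show ?thesis
  proof (rule surjI)
    fix w
    have "coords w \<in> range ?L" using \<open>range ?L = UNIV\<close> by simp
    then have "\<exists>x. L x = w" using injD[OF inj_coords] by fastforce
    then show "L (SOME x. L x = w) = w" by (rule someI_ex)
  qed
qed

lemma ghat_nondegenerate:
  fixes w :: "'n::finite amb"
  assumes "\<And>u. ghat w u = 0"
  shows "w = 0"
proof -
  have "snd w = 0"
    by (rule blinfun_eqI) (use assms[of "(_, 0)"] in \<open>simp add: ghat_def\<close>)
  moreover have "blinfun_apply (blinfun_inner_left (fst w)) (fst w) = 0"
    using assms[of "(0, blinfun_inner_left (fst w))"] by (simp add: ghat_def)
  ultimately show ?thesis by (simp add: prod_eq_iff)
qed

lemma bilinear_hess:
  assumes "open S" "x \<in> S" "smooth_on S f"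
  shows "bilinear (hess f x)"
  using linear_hess_right[OF assms] linear_hess_left[OF assms(2,3)] by (auto simp: bilinear_def)

lemma ghat_hess_symmetric:
  assumes S: "open S" "x \<in> S" "smooth_on S f"
  shows "ghat (hess f x a b) w = ghat (hess f x b a) w"
proof -
  note bl = bounded_bilinear.bounded_linear_left[OF bounded_bilinear_ghat, of w]
  show ?thesis
    unfolding hess_bounded_linear[OF S bl, symmetric]
    by (rule hess_symmetric_real[OF S(1,2) smooth_on_bounded_linear[OF S(1) bl S(3)]])
qed

section \<open>Charts of pseudohyperbolic space\<close>

context
  fixes c :: "('n::finite amb, (real^'n) \<times> (real^'n) \<times> real) chart"
  assumes c: "c \<in> hyp_atlas"
begin

lemma hyp_chart: "is_chart (top_of_set hyp) c"
  using c by (simp add: hyp_atlas_def)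

lemma hyp_param_smooth: "smooth_on (crange c) (param c)"
  using c by (simp add: hyp_atlas_def)

lemma hyp_chart_subset: "fst c \<subseteq> hyp"
  using chart_dom_subset[OF hyp_chart] by simp

lemma hyp_param_in: "x \<in> crange c \<Longrightarrow> param c x \<in> hyp"
  using param_in_dom[OF hyp_chart] hyp_chart_subset by blast

lemma hyp_param_differentiable: "x \<in> crange c \<Longrightarrow> param c differentiable (at x)"
  by (rule smooth_on_differentiable[OF hyp_param_smooth])

lemma hyp_param_inj: "x \<in> crange c \<Longrightarrow> inj (Dmap (param c) x)"
  using c by (simp add: hyp_atlas_def)

lemma hyp_param_linear: "x \<in> crange c \<Longrightarrow> linear (Dmap (param c) x)"
  by (rule linear_Dmap[OF hyp_param_differentiable])

lemma hyp_tangent: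
  assumes x: "x \<in> crange c"
  shows "ghat (param c x) (Dmap (param c) x X) = 0"
proof -
  have "ghat (Dmap (param c) x X) (param c x) = - ghat (param c x) (Dmap (param c) x X)"
    by (rule Dmap_bilinear_eq_0[OF chart_open_crange[OF hyp_chart] x bounded_bilinear_ghat _
          hyp_param_differentiable[OF x] hyp_param_differentiable[OF x]])
      (rule ghat_self[OF hyp_param_in])
  then show ?thesis by (simp add: ghat_commute)
qed

text \<open>Tangent vectors are orthogonal to the position vector, which has square -1, so the two
  are independent; the dimensions \<open>(2 n + 1) + 1 = 2 (n + 1)\<close> then leave no room for
  anything else.\<close>

lemma hyp_decompose:
  assumes x: "x \<in> crange c"
  obtains X s where "w = Dmap (param c) x X + s *\<^sub>R param c x"
proof -
  define L where "L = (\<lambda>p. Dmap (param c) x (fst p) + snd p *\<^sub>R param c x)"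
  note lin = hyp_param_linear[OF x]
  have L: "linear L"
    unfolding L_def by (rule linearI) (simp_all add: linear_add[OF lin] linear_cmul[OF lin] algebra_simps)
  have "p = 0" if "L p = 0" for p
  proof -
    have "ghat (param c x) (L p) = 0" using that by (simp add: ghat_simps)
    then have "snd p = 0"
      by (simp add: L_def ghat_simps hyp_tangent[OF x] ghat_self[OF hyp_param_in[OF x]])
    moreover from this have "Dmap (param c) x (fst p) = Dmap (param c) x 0"
      using that by (simp add: L_def linear_0[OF lin])
    then have "fst p = 0" by (rule injD[OF hyp_param_inj[OF x]])
    ultimately show ?thesis by (simp add: prod_eq_iff)
  qed
  then have "inj L" using linear_injective_0[OF L] by blast
  then have "surj L" by (rule amb_linear_inj_imp_surj[OF L]) (simp add: card_option)
  then obtain p where "w = L p" by (metis surjD)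
  then show ?thesis by (intro that[of "fst p" "snd p"]) (simp add: L_def)
qed

lemma hyp_tangent_space:
  assumes x: "x \<in> crange c" and w: "ghat (param c x) w = 0"
  obtains X where "w = Dmap (param c) x X"
proof -
  obtain X s where X: "w = Dmap (param c) x X + s *\<^sub>R param c x" using hyp_decompose[OF x] .
  have "s = 0"
    using w unfolding X by (simp add: ghat_simps hyp_tangent[OF x] ghat_self[OF hyp_param_in[OF x]])
  then show ?thesis using X by (intro that[of X]) simp
qed

lemma hyp_metric_nondegenerate:
  assumes x: "x \<in> crange c"
  shows "nondegenerate_form (hyp_metric c x)"
  unfolding nondegenerate_form_def
proof (intro allI impI)
  fix X assume h: "\<forall>Y. hyp_metric c x X Y = 0"
  have "ghat (Dmap (param c) x X) w = 0" for w
  proof -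
    obtain Y s where Y: "w = Dmap (param c) x Y + s *\<^sub>R param c x" using hyp_decompose[OF x] .
    show ?thesis
      using spec[OF h, of Y] hyp_tangent[OF x, of X] unfolding Y hyp_metric_def
      by (simp add: ghat_simps ghat_commute[of _ "param c x"])
  qed
  then have "Dmap (param c) x X = Dmap (param c) x 0"
    using ghat_nondegenerate linear_0[OF hyp_param_linear[OF x]] by metis
  then show "X = 0" by (rule injD[OF hyp_param_inj[OF x]])
qed

lemma hyp_metric_bilinear:
  assumes x: "x \<in> crange c"
  shows "bilinear (hyp_metric c x)"
  unfolding bilinear_def hyp_metric_def
  by (intro conjI allI linearI)
    (simp_all add: ghat_simps linear_add[OF hyp_param_linear[OF x]] linear_cmul[OF hyp_param_linear[OF x]])

lemma hyp_christoffel: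
  assumes x: "x \<in> crange c"
  shows "hyp_metric c x (christoffel (hyp_metric c) x u v) w =
    ghat (hess (param c) x u v) (Dmap (param c) x w)"
proof (rule christoffel_pullback[OF bilinear_ghat ghat_commute hyp_param_linear[OF x]])
  note S = chart_open_crange[OF hyp_chart] x hyp_param_smooth
  show "bilinear (hess (param c) x)" by (rule bilinear_hess[OF S])
  show "ghat (hess (param c) x u v) (Dmap (param c) x w) = ghat (hess (param c) x v u) (Dmap (param c) x w)"
    for u v w by (rule ghat_hess_symmetric[OF S])
  show "((\<lambda>y'. hyp_metric c y' u v) has_derivative
      (\<lambda>w. ghat (hess (param c) x w u) (Dmap (param c) x v) + ghat (Dmap (param c) x u) (hess (param c) x w v)))
      (at x)" for u v
  proof -
    have d: "((\<lambda>y. Dmap (param c) y u) has_derivative (\<lambda>w. hess (param c) x w u)) (at x)" for u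
      unfolding hess_def by (rule Dmap_works[OF smooth_on_differentiable[OF smooth_on_Dmap[OF S(3)] x]])
    show ?thesis
      unfolding hyp_metric_def
      using bounded_bilinear.FDERIV[OF bounded_bilinear_ghat d[of u] d[of v]] by (simp add: add.commute)
  qed
  show "nondegenerate_form (hyp_metric c x)" by (rule hyp_metric_nondegenerate[OF x])
qed (simp add: hyp_metric_def)

end

section \<open>Maps into pseudohyperbolic space\<close>

lemma local_rep_smooth:
  assumes "smooth_map A E F" "c \<in> A" "d \<in> E"
  shows "open (local_dom F c d)" "smooth_on (local_dom F c d) (local_rep F c d)"
  using assms by (auto simp: smooth_map_def)

lemma smooth_map_covers:
  assumes "smooth_map A E F" "c \<in> A" "is_chart T c" "x \<in> crange c"
  obtains d where "d \<in> E" "x \<in> local_dom F c d"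
proof -
  have p: "param c x \<in> fst c" by (rule param_in_dom[OF assms(3,4)])
  have "F ` (\<Union>c\<in>A. fst c) \<subseteq> (\<Union>d\<in>E. fst d)" using assms(1) unfolding smooth_map_def by blast
  then have "F (param c x) \<in> (\<Union>d\<in>E. fst d)" using p assms(2) by blast
  then obtain d where "d \<in> E" "F (param c x) \<in> fst d" by blast
  then show ?thesis using assms(4) by (intro that[of d]) (auto simp: local_dom_eq[OF assms(3)])
qed

context
  fixes A :: "('a, 'e::euclidean_space) chart set" and s :: "'a \<Rightarrow> 'n::finite amb"
    and T :: "'a topology" and c :: "('a, 'e) chart"
  assumes s: "smooth_map A hyp_atlas s" and c: "c \<in> A" and T: "is_chart T c"
begin

lemma lift_in_hyp:
  assumes "x \<in> crange c"
  shows "s (param c x) \<in> hyp"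
proof -
  obtain d where "d \<in> hyp_atlas" "x \<in> local_dom s c d" using smooth_map_covers[OF s c T assms] .
  then show ?thesis using hyp_chart_subset[of d] by (auto simp: local_dom_eq[OF T])
qed

lemma lift_factor:
  assumes d: "d \<in> hyp_atlas" and x: "x \<in> local_dom s c d"
  shows "(s \<circ> param c) x = param d (local_rep s c d x)" "local_rep s c d x \<in> crange d"
  using x param_coord[OF hyp_chart[OF d]] coord_in_crange[OF hyp_chart[OF d]]
  by (auto simp: local_dom_eq[OF T] local_rep_def)

lemma lift_smooth: "smooth_on (crange c) (s \<circ> param c)"
proof (rule smooth_on_local)
  fix x assume "x \<in> crange c"
  then obtain d where d: "d \<in> hyp_atlas" "x \<in> local_dom s c d" using smooth_map_covers[OF s c T] by blast
  have "smooth_on (local_dom s c d) (\<lambda>y. param d (local_rep s c d y))"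
    by (rule smooth_on_compose[OF local_rep_smooth(1)[OF s c d(1)] chart_open_crange[OF hyp_chart[OF d(1)]]
        local_rep_smooth(2)[OF s c d(1)] hyp_param_smooth[OF d(1)]])
      (use lift_factor(2)[OF d(1)] in auto)
  then have "smooth_on (local_dom s c d) (s \<circ> param c)"
    by (rule smooth_on_cong[OF local_rep_smooth(1)[OF s c d(1)], rotated]) (rule lift_factor(1)[OF d(1), symmetric])
  then show "\<exists>U. open U \<and> x \<in> U \<and> smooth_on U (s \<circ> param c)"
    using local_rep_smooth(1)[OF s c d(1)] d(2) by blast
qed

lemma lift_derivatives:
  assumes d: "d \<in> hyp_atlas" and x: "x \<in> local_dom s c d"
  shows "Dmap (s \<circ> param c) x a = Dmap (param d) (local_rep s c d x) (Dmap (local_rep s c d) x a)"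
    and "hess (s \<circ> param c) x a b =
      Dmap (param d) (local_rep s c d x) (hess (local_rep s c d) x a b) +
      hess (param d) (local_rep s c d x) (Dmap (local_rep s c d) x a) (Dmap (local_rep s c d) x b)"
proof -
  let ?H = "local_rep s c d" and ?D = "local_dom s c d"
  note o = local_rep_smooth(1)[OF s c d] and sm = local_rep_smooth(2)[OF s c d]
  have D: "Dmap (s \<circ> param c) y = Dmap (\<lambda>y. param d (?H y)) y" if "y \<in> ?D" for y
    by (rule Dmap_cong_open[OF o that]) (rule lift_factor(1)[OF d])
  have H: "?H differentiable (at y)" if "y \<in> ?D" for y using smooth_on_differentiable[OF sm that] .
  show "Dmap (s \<circ> param c) x a = Dmap (param d) (?H x) (Dmap ?H x a)"
    unfolding D[OF x]
    by (rule Dmap_compose(2)[OF H[OF x] hyp_param_differentiable[OF d lift_factor(2)[OF d x]]])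
  have "Dmap (\<lambda>y. Dmap (s \<circ> param c) y b) x = Dmap (\<lambda>y. Dmap (\<lambda>y. param d (?H y)) y b) x"
    by (rule Dmap_cong_open[OF o x]) (simp add: D)
  then have "hess (s \<circ> param c) x a b = hess (\<lambda>y. param d (?H y)) x a b"
    by (simp add: hess_def)
  also have "\<dots> = Dmap (param d) (?H x) (hess ?H x a b) + hess (param d) (?H x) (Dmap ?H x a) (Dmap ?H x b)"
    by (rule hess_compose(2)[OF o x H smooth_on_differentiable[OF smooth_on_Dmap[OF sm] x]
          chart_open_crange[OF hyp_chart[OF d]] hyp_param_smooth[OF d] lift_factor(2)[OF d]])
  finally show "hess (s \<circ> param c) x a b =
      Dmap (param d) (?H x) (hess ?H x a b) + hess (param d) (?H x) (Dmap ?H x a) (Dmap ?H x b)" .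
qed

lemma hyp_first_form:
  assumes d: "d \<in> hyp_atlas" and x: "x \<in> local_dom s c d"
  shows "first_form hyp_metric s c d x = (\<lambda>a b. ghat (Dmap (s \<circ> param c) x a) (Dmap (s \<circ> param c) x b))"
  by (intro ext) (simp add: first_form_def hyp_metric_def lift_derivatives(1)[OF d x])

text \<open>The chart of the target disappears: the Hessian of the local representative plus the
  Christoffel term pairs like the ambient Hessian of the lift, and the tangent vectors of
  \<open>hyp\<close> are exactly the vectors orthogonal to the position.\<close>

lemma hyp_mean_curvature:
  assumes d: "d \<in> hyp_atlas" and x: "x \<in> local_dom s c d"
  defines "I \<equiv> (\<lambda>a b. ghat (Dmap (s \<circ> param c) x a) (Dmap (s \<circ> param c) x b))"
  assumes nd: "nondegenerate_form I"
  shows "mean_curvature hyp_metric s c d x = 0 \<longleftrightarrow>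
    (\<forall>w. ghat (s (param c x)) w = 0 \<longrightarrow> (\<forall>e. ghat w (Dmap (s \<circ> param c) x e) = 0) \<longrightarrow>
      (\<Sum>b\<in>Basis. ghat (hess (s \<circ> param c) x b (sharp I (\<lambda>v. b \<bullet> v))) w) = 0)"
proof -
  let ?H = "local_rep s c d"
  let ?J = "Dmap (param d) (?H x)"
  note y = lift_factor(2)[OF d x]
  note fac = lift_factor(1)[OF d x]
  have I: "first_form hyp_metric s c d x = I" unfolding I_def by (rule hyp_first_form[OF d x])
  have "mean_curvature hyp_metric s c d x = 0 \<longleftrightarrow>
    (\<forall>W. (\<forall>e. hyp_metric d (?H x) W (Dmap ?H x e) = 0) \<longrightarrow>
       (\<Sum>b\<in>Basis. ghat (hess (s \<circ> param c) x b (sharp (first_form hyp_metric s c d x) (\<lambda>v. b \<bullet> v))) (?J W)) = 0)"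
  proof (rule mean_curvature_eq_0_iff)
    show "bilinear (hyp_metric d (?H x))" by (rule hyp_metric_bilinear[OF d y])
    show "hyp_metric d (?H x) u v = hyp_metric d (?H x) v u" for u v
      by (simp add: hyp_metric_def ghat_commute)
    show "nondegenerate_form (hyp_metric d (?H x))" by (rule hyp_metric_nondegenerate[OF d y])
    show "linear (Dmap ?H x)"
      by (rule linear_Dmap[OF smooth_on_differentiable[OF local_rep_smooth(2)[OF s c d] x]])
    show "nondegenerate_form (first_form hyp_metric s c d x)" unfolding I by (rule nd)
    show "hyp_metric d (?H x) (hess ?H x a b + christoffel (hyp_metric d) (?H x) (Dmap ?H x a) (Dmap ?H x b)) W =
        ghat (hess (s \<circ> param c) x a b) (?J W)" for a b W
      unfolding lift_derivatives(2)[OF d x] bilinear_ladd[OF hyp_metric_bilinear[OF d y]]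
        hyp_christoffel[OF d y] by (simp add: hyp_metric_def ghat_simps)
  qed
  also have "\<dots> \<longleftrightarrow> (\<forall>W. (\<forall>e. ghat (?J W) (Dmap (s \<circ> param c) x e) = 0) \<longrightarrow>
       (\<Sum>b\<in>Basis. ghat (hess (s \<circ> param c) x b (sharp I (\<lambda>v. b \<bullet> v))) (?J W)) = 0)"
    unfolding I by (simp add: hyp_metric_def lift_derivatives(1)[OF d x])
  also have "\<dots> \<longleftrightarrow> (\<forall>w. ghat (s (param c x)) w = 0 \<longrightarrow> (\<forall>e. ghat w (Dmap (s \<circ> param c) x e) = 0) \<longrightarrow>
      (\<Sum>b\<in>Basis. ghat (hess (s \<circ> param c) x b (sharp I (\<lambda>v. b \<bullet> v))) w) = 0)"
    (is "?L \<longleftrightarrow> ?R")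
  proof
    assume L: ?L
    show ?R
    proof (intro allI impI)
      fix w assume "ghat (s (param c x)) w = 0" and w: "\<forall>e. ghat w (Dmap (s \<circ> param c) x e) = 0"
      then have "ghat (param d (?H x)) w = 0" using fac by simp
      then obtain W where "w = ?J W" using hyp_tangent_space[OF d y] by blast
      then show "(\<Sum>b\<in>Basis. ghat (hess (s \<circ> param c) x b (sharp I (\<lambda>v. b \<bullet> v))) w) = 0"
        using L w by blast
    qed
  next
    assume R: ?R
    have "ghat (s (param c x)) (?J W) = 0" for W using hyp_tangent[OF d y] fac by simp
    then show ?L using R by blast
  qed
  finally show ?thesis .
qed

end

section \<open>Inverse maps\<close>

text \<open>\<open>L\<close> is a left inverse of \<open>P\<close>, and \<open>S\<close> may have
  empty interior: this differentiates the coordinate map of an embedded submanifold from within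
  it.\<close>

lemma has_derivative_inverse_within:
  assumes p: "(p has_derivative P) (at w)" "p w = z" and L: "bounded_linear L" "\<And>X. L (P X) = X"
    and g: "continuous (at z within S) g" "g z = w" "\<And>z'. z' \<in> S \<Longrightarrow> p (g z') = z'"
  shows "(g has_derivative L) (at z within S)"
  unfolding has_derivative_within_alt
proof (intro conjI allI impI)
  show "bounded_linear L" by (rule L(1))
  fix e :: real assume e: "e > 0"
  obtain K where K: "K > 0" "\<And>x. norm (L x) \<le> norm x * K"
    using bounded_linear.pos_bounded[OF L(1)] by blast
  interpret L: bounded_linear L by (rule L(1))
  \<comment> \<open>The first bound absorbs half of \<open>norm (g y - w)\<close> and yields the
    Lipschitz estimate with constant \<open>2 * K\<close>; the second bound turns this estimate into
    the error \<open>e\<close>.\<close>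
  define \<epsilon> where "\<epsilon> = min (1 / (2 * K)) (e / (2 * K * K))"
  have \<epsilon>: "\<epsilon> > 0" "\<epsilon> * K \<le> 1 / 2" "\<epsilon> * (2 * K * K) \<le> e"
  proof -
    show "\<epsilon> > 0" using e K by (simp add: \<epsilon>_def)
    have "\<epsilon> * K \<le> (1 / (2 * K)) * K" unfolding \<epsilon>_def using K by (intro mult_right_mono) auto
    then show "\<epsilon> * K \<le> 1 / 2" using K by simp
    have "\<epsilon> * (2 * K * K) \<le> (e / (2 * K * K)) * (2 * K * K)"
      unfolding \<epsilon>_def using K by (intro mult_right_mono) auto
    then show "\<epsilon> * (2 * K * K) \<le> e" using K by simp
  qed
  obtain d where d: "d > 0" "\<And>w'. norm (w' - w) < d \<Longrightarrow> norm (p w' - p w - P (w' - w)) \<le> \<epsilon> * norm (w' - w)"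
    using p(1) \<epsilon>(1) unfolding has_derivative_at_alt by blast
  obtain d' where d': "d' > 0" "\<And>z'. z' \<in> S \<Longrightarrow> dist z' z < d' \<Longrightarrow> dist (g z') (g z) < d"
    using g(1) d(1) unfolding continuous_within_eps_delta by blast
  show "\<exists>d>0. \<forall>y\<in>S. norm (y - z) < d \<longrightarrow> norm (g y - g z - L (y - z)) \<le> e * norm (y - z)"
  proof (intro exI[of _ d'] conjI ballI impI)
    fix y assume y: "y \<in> S" "norm (y - z) < d'"
    have gy: "norm (g y - w) < d" using d'(2)[OF y(1)] y(2) g(2) by (simp add: dist_norm)
    have "L (y - z - P (g y - w)) = L (y - z) - (g y - w)"
      by (simp add: L.diff L(2))
    then have "norm (g y - w - L (y - z)) = norm (L (y - z - P (g y - w)))"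
      by (simp add: norm_minus_commute)
    also have "\<dots> \<le> norm (y - z - P (g y - w)) * K" by (rule K(2))
    also have "\<dots> \<le> (\<epsilon> * norm (g y - w)) * K"
      using d(2)[OF gy] g(3)[OF y(1)] p(2) K(1) by (intro mult_right_mono) auto
    finally have 1: "norm (g y - w - L (y - z)) \<le> (\<epsilon> * K) * norm (g y - w)" by (simp add: ac_simps)
    have "norm (g y - w) \<le> norm (L (y - z)) + norm (g y - w - L (y - z))"
      using norm_triangle_ineq[of "L (y - z)" "g y - w - L (y - z)"] by simp
    also have "\<dots> \<le> norm (y - z) * K + (1 / 2) * norm (g y - w)"
      using K(2)[of "y - z"] 1 mult_right_mono[OF \<epsilon>(2), of "norm (g y - w)"] by simp
    finally have 2: "norm (g y - w) \<le> 2 * K * norm (y - z)" by (simp add: ac_simps)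
    have "(\<epsilon> * K) * norm (g y - w) \<le> (\<epsilon> * K) * (2 * K * norm (y - z))"
      using \<epsilon>(1) K(1) by (intro mult_left_mono[OF 2]) auto
    also have "\<dots> = (\<epsilon> * (2 * K * K)) * norm (y - z)" by (simp add: ac_simps)
    also have "\<dots> \<le> e * norm (y - z)" by (rule mult_right_mono[OF \<epsilon>(3)]) simp
    finally show "norm (g y - g z - L (y - z)) \<le> e * norm (y - z)" using 1 g(2) by simp
  qed (rule d'(1))
qed

text \<open>The inverse function theorem with a second derivative at a single point. As the
  derivative of \<open>f\<close> at \<open>x0\<close> is the identity, the Hessian of the inverse
  there is the negative of that of \<open>f\<close>.\<close>

lemma smooth_local_inverse:
  fixes f :: "'a::euclidean_space \<Rightarrow> 'a"
  assumes U: "open U" "x0 \<in> U" and f: "smooth_on U f" and id: "\<And>a. Dmap f x0 a = a"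
  obtains V g where "open V" "f x0 \<in> V" "g (f x0) = x0" "\<And>y. y \<in> V \<Longrightarrow> g y \<in> U"
    "\<And>y. y \<in> V \<Longrightarrow> f (g y) = y" "\<And>y. y \<in> V \<Longrightarrow> g differentiable (at y)"
    "\<And>a. Dmap g (f x0) a = a"
    "\<And>b. ((\<lambda>y. Dmap g y b) has_derivative (\<lambda>a. - hess f x0 a b)) (at (f x0))"
proof -
  define f' where "f' x = Blinfun (Dmap f x)" for x
  have f': "blinfun_apply (f' x) = Dmap f x" if "x \<in> U" for x
    unfolding f'_def
    by (rule bounded_linear_Blinfun_apply, rule has_derivative_bounded_linear[OF Dmap_works],
        rule smooth_on_differentiable[OF f that])
  have der: "(f has_derivative blinfun_apply (f' x)) (at x)" if "x \<in> U" for x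
    unfolding f'[OF that] by (rule Dmap_works[OF smooth_on_differentiable[OF f that]])
  have cont: "continuous_on U f'"
  proof (rule continuous_on_blinfun_componentwise)
    fix i :: 'a
    have "continuous_on U (\<lambda>x. Dmap f x i)" by (rule smooth_on_continuous_on[OF smooth_on_Dmap[OF f]])
    then show "continuous_on U (\<lambda>x. blinfun_apply (f' x) i)"
      by (rule continuous_on_eq) (simp add: f')
  qed
  have f'0: "f' x0 = id_blinfun" by (rule blinfun_eqI) (simp add: f'[OF U(2)] id)
  have f'id: "id_blinfun o\<^sub>L f' x0 = id_blinfun" unfolding f'0 by (rule blinfun_eqI) simp
  obtain U' V g g' where inv: "open U'" "U' \<subseteq> U" "x0 \<in> U'" "open V" "f x0 \<in> V" "homeomorphism U' V f g"
    "\<And>y. y \<in> V \<Longrightarrow> (g has_derivative (g' y)) (at y)"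
    "\<And>y. y \<in> V \<Longrightarrow> g' y = inv (blinfun_apply (f'(g y)))"
    "\<And>y. y \<in> V \<Longrightarrow> bij (blinfun_apply (f'(g y)))"
    by (rule inverse_function_theorem[OF U(1) der cont U(2) f'id], assumption, rule that)
  have gU: "g y \<in> U" "f (g y) = y" if "y \<in> V" for y
    using inv(2,6) that by (auto simp: homeomorphism_def)
  have g0: "g (f x0) = x0" using inv(3,6) by (auto simp: homeomorphism_def)
  have Dg: "Dmap g y = g' y" if "y \<in> V" for y by (rule Dmap_eq[OF inv(7)[OF that]])
  have linv: "g' y (Dmap f (g y) a) = a" if "y \<in> V" for y a
    using inv(8,9)[OF that] f'[OF gU(1)[OF that]] by (simp add: bij_is_inj inv_f_f)
  have rinv: "Dmap f (g y) (g' y a) = a" if "y \<in> V" for y a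
    using inv(8,9)[OF that] f'[OF gU(1)[OF that]] by (simp add: bij_is_surj surj_f_inv_f)
  have g'0: "g' (f x0) a = a" for a using linv[OF inv(5), of a] by (simp add: g0 id)
  \<comment> \<open>With \<open>h y = Dmap f (g y) b - b\<close>, applying \<open>g' y\<close> gives
    \<open>b - g' y b = g' y (h y)\<close>. Since \<open>g' y\<close> tends to the identity and
    \<open>h\<close> vanishes at \<open>f x0\<close>, replacing \<open>g' y (h y)\<close> by
    \<open>h y\<close> is an error of higher order.\<close>
  have main: "((\<lambda>y. g' y b) has_derivative (\<lambda>a. - hess f x0 a b)) (at (f x0))" for b
    unfolding has_derivative_at_alt
  proof (intro conjI allI impI)
    define y0 where "y0 = f x0"
    define h where "h y = Dmap f (g y) b - b" for y
    have d1: "g differentiable (at y0)" using inv(7)[OF inv(5)] by (auto simp: differentiable_def y0_def)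
    have d2: "(\<lambda>x. Dmap f x b) differentiable (at (g y0))"
      unfolding y0_def g0 by (rule smooth_on_differentiable[OF smooth_on_Dmap[OF f] U(2)])
    have "Dmap (\<lambda>y. Dmap f (g y) b) y0 = (\<lambda>a. hess f x0 a b)"
      using Dmap_compose(2)[OF d1 d2] Dg[OF inv(5)] g'0 by (auto simp: y0_def g0 hess_def)
    then have h': "(h has_derivative (\<lambda>a. hess f x0 a b)) (at y0)"
      unfolding h_def
      using has_derivative_diff[OF Dmap_works[OF Dmap_compose(1)[OF d1 d2]] has_derivative_const[of b]] by simp
    then have bl: "bounded_linear (\<lambda>a. hess f x0 a b)" by (rule has_derivative_bounded_linear)
    then show "bounded_linear (\<lambda>a. - hess f x0 a b)" by (rule bounded_linear_minus)
    obtain M where M: "M > 0" "\<And>a. norm (hess f x0 a b) \<le> norm a * M"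
      using bounded_linear.pos_bounded[OF bl] by blast
    fix e :: real assume e: "e > 0"
    have h0: "h y0 = 0" by (simp add: h_def y0_def g0 id)
    \<comment> \<open>Two error terms share \<open>e\<close>. The cap 1 on \<open>e1\<close> gives
      the growth bound \<open>M + 1\<close> for \<open>h\<close>; below, the cap 1/2 on
      \<open>e2\<close> bounds \<open>g' y\<close> by 2, and its other entry absorbs the product of
      these bounds.\<close>
    define e1 where "e1 = min (e / 2) 1"
    have e1: "e1 > 0" "e1 \<le> e / 2" "e1 \<le> 1" using e by (auto simp: e1_def)
    obtain d1 where d1: "d1 > 0" "\<And>y. norm (y - y0) < d1 \<Longrightarrow> norm (h y - h y0 - hess f x0 (y - y0) b) \<le> e1 * norm (y - y0)"
      using h' e1(1) unfolding has_derivative_at_alt by blast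
    define e2 where "e2 = min (1 / 2) (e / (4 * (M + 1)))"
    have e2: "e2 > 0" "e2 \<le> 1 / 2" "2 * e2 * (M + 1) \<le> e / 2"
    proof -
      show "e2 > 0" using e M by (auto simp: e2_def)
      show "e2 \<le> 1 / 2" unfolding e2_def by (rule min.cobounded1)
      have "2 * e2 * (M + 1) \<le> 2 * (e / (4 * (M + 1))) * (M + 1)"
        using M by (intro mult_right_mono mult_left_mono) (auto simp: e2_def)
      also have "\<dots> = e / 2" using M by (simp add: field_simps)
      finally show "2 * e2 * (M + 1) \<le> e / 2" .
    qed
    have "isCont (\<lambda>y. f' (g y)) y0"
    proof (rule isCont_o2[where g = f'])
      show "isCont g y0" using d1 inv(7)[OF inv(5)] has_derivative_continuous unfolding y0_def by blast
      show "isCont f' (g y0)" using cont U by (simp add: y0_def g0 continuous_on_eq_continuous_at)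
    qed
    then obtain d2 where d2: "d2 > 0" "\<And>y. norm (y - y0) < d2 \<Longrightarrow> norm (f' (g y) - id_blinfun) < e2"
      using e2(1) unfolding continuous_at_eps_delta dist_norm by (metis f'0 g0 y0_def)
    obtain d3 where d3: "d3 > 0" "ball y0 d3 \<subseteq> V"
      using inv(4,5) open_contains_ball unfolding y0_def by blast
    show "\<exists>d>0. \<forall>y. norm (y - f x0) < d \<longrightarrow>
        norm (g' y b - g' (f x0) b - - hess f x0 (y - f x0) b) \<le> e * norm (y - f x0)"
      unfolding y0_def[symmetric]
    proof (intro exI[of _ "min d1 (min d2 d3)"] conjI allI impI)
      fix y assume y: "norm (y - y0) < min d1 (min d2 d3)"
      have yV: "y \<in> V" using y d3(2) by (auto simp: subset_iff dist_norm norm_minus_commute)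
      have lin: "linear (g' y)" using inv(7)[OF yV] has_derivative_linear by blast
      have A: "norm (Dmap f (g y) w - w) \<le> e2 * norm w" for w
      proof -
        have "norm (blinfun_apply (f' (g y) - id_blinfun) w) \<le> norm (f' (g y) - id_blinfun) * norm w"
          by (rule norm_blinfun)
        also have "\<dots> \<le> e2 * norm w" using d2(2)[of y] y by (intro mult_right_mono) auto
        finally show ?thesis by (simp add: blinfun.diff_left f'[OF gU(1)[OF yV]])
      qed
      have bnd: "norm (g' y w) \<le> 2 * norm w" for w
      proof -
        have "norm (g' y w) \<le> norm (Dmap f (g y) (g' y w)) + norm (Dmap f (g y) (g' y w) - g' y w)"
          using norm_triangle_sub[of "g' y w" "Dmap f (g y) (g' y w)"] by (simp add: norm_minus_commute)
        also have "\<dots> \<le> norm w + e2 * norm (g' y w)" using A[of "g' y w"] rinv[OF yV] by simp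
        also have "\<dots> \<le> norm w + (1 / 2) * norm (g' y w)"
          using mult_right_mono[OF e2(2), of "norm (g' y w)"] by simp
        finally show ?thesis by simp
      qed
      have hy: "norm (h y - hess f x0 (y - y0) b) \<le> e1 * norm (y - y0)"
        using d1(2)[of y] y h0 by simp
      have "norm (h y) \<le> norm (hess f x0 (y - y0) b) + norm (h y - hess f x0 (y - y0) b)"
        using norm_triangle_sub by blast
      also have "\<dots> \<le> norm (y - y0) * M + 1 * norm (y - y0)"
        using M(2)[of "y - y0"] hy mult_right_mono[OF e1(3), of "norm (y - y0)"] by simp
      finally have hn: "norm (h y) \<le> (M + 1) * norm (y - y0)" by (simp add: algebra_simps)
      have gh: "g' y (h y) = b - g' y b"
        unfolding h_def linear_diff[OF lin] linv[OF yV] ..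
      have "g' y (h y) - h y = g' y (h y - Dmap f (g y) (h y))"
        unfolding linear_diff[OF lin] linv[OF yV] ..
      then have "norm (g' y (h y) - h y) \<le> 2 * norm (h y - Dmap f (g y) (h y))" using bnd by simp
      also have "\<dots> \<le> 2 * (e2 * norm (h y))" using A[of "h y"] by (simp add: norm_minus_commute)
      also have "\<dots> \<le> 2 * (e2 * ((M + 1) * norm (y - y0)))" using hn e2(1) by simp
      also have "\<dots> = (2 * e2 * (M + 1)) * norm (y - y0)" by (simp add: ac_simps)
      also have "\<dots> \<le> (e / 2) * norm (y - y0)" by (rule mult_right_mono[OF e2(3)]) simp
      finally have r: "norm (g' y (h y) - h y) \<le> (e / 2) * norm (y - y0)" .
      have "g' y b - g' y0 b - - hess f x0 (y - y0) b =
          - ((h y - hess f x0 (y - y0) b) + (g' y (h y) - h y))"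
        unfolding gh using g'0[of b] by (simp add: y0_def)
      then have "norm (g' y b - g' y0 b - - hess f x0 (y - y0) b) \<le>
          norm (h y - hess f x0 (y - y0) b) + norm (g' y (h y) - h y)"
        using norm_triangle_ineq by (metis norm_minus_cancel)
      also have "\<dots> \<le> (e / 2) * norm (y - y0) + (e / 2) * norm (y - y0)"
        using hy r mult_right_mono[OF e1(2), of "norm (y - y0)"] by simp
      finally show "norm (g' y b - g' y0 b - - hess f x0 (y - y0) b) \<le> e * norm (y - y0)" by simp
    qed (use d1(1) d2(1) d3(1) in simp)
  qed
  have main': "((\<lambda>y. Dmap g y b) has_derivative (\<lambda>a. - hess f x0 a b)) (at (f x0))" for b
    by (rule has_derivative_transform_within_open[OF main inv(4,5)]) (simp add: Dg)
  show ?thesis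
  proof (rule that[OF inv(4,5) g0 gU _ _ main'])
    show "g differentiable (at y)" if "y \<in> V" for y using inv(7)[OF that] by (auto simp: differentiable_def)
    show "Dmap g (f x0) a = a" for a using Dg[OF inv(5)] g'0 by simp
  qed
qed

section \<open>Charts of para-complex hyperbolic space\<close>

lemma act_0: "act 0 z = z"
  by (simp add: act_def)

lemma act_act: "act t (act u z) = act (t + u) z"
  by (simp add: act_def mult_exp_exp)

lemma proj_act: "proj (act t z) = proj z"
proof -
  have "range (\<lambda>u. act u (act t z)) = range (\<lambda>u. act u z)"
  proof
    show "range (\<lambda>u. act u (act t z)) \<subseteq> range (\<lambda>u. act u z)" by (auto simp: act_act)
    have "act u z = act (u - t) (act t z)" for u by (simp add: act_act)
    then show "range (\<lambda>u. act u z) \<subseteq> range (\<lambda>u. act u (act t z))" by blast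
  qed
  then show ?thesis by (simp add: proj_def)
qed

lemma proj_eqD:
  assumes "proj z' = proj z"
  shows "\<exists>t. z' = act t z"
proof -
  have "act 0 z' \<in> proj z'" unfolding proj_def by (rule rangeI)
  then have "z' \<in> range (\<lambda>t. act t z)" using assms by (simp add: act_0 proj_def)
  then show ?thesis by blast
qed

lemma bounded_linear_act: "bounded_linear (act t)"
  unfolding act_def
  by (rule bounded_linear_Pair[OF bounded_linear_compose[OF bounded_linear_scaleR_right bounded_linear_fst]
        bounded_linear_compose[OF bounded_linear_scaleR_right bounded_linear_snd]])

lemma has_derivative_act_curve: "((\<lambda>t. act t z) has_derivative (\<lambda>h. h *\<^sub>R zeta z)) (at 0)"
proof -
  have "((\<lambda>t. (exp t *\<^sub>R fst z, exp (- t) *\<^sub>R snd z)) has_derivative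
      (\<lambda>h. (h *\<^sub>R fst z, - h *\<^sub>R snd z))) (at 0)"
    by (auto intro!: derivative_eq_intros)
  then show ?thesis by (simp add: act_def zeta_def)
qed

text \<open>A derivative within a thin set is determined only in directions reached by maps into
  that set; along such a map the chain rule computes it.\<close>

lemma has_derivative_within_unique_along:
  assumes q: "(q has_derivative Q) (at (p x) within S)" and p: "(p has_derivative P) (at x)"
    and U: "open U" "x \<in> U" "\<And>y. y \<in> U \<Longrightarrow> p y \<in> S"
    and D: "((\<lambda>y. q (p y)) has_derivative D) (at x)"
  shows "Q (P a) = D a"
proof -
  have "(p has_derivative P) (at x within U)" using p by (rule has_derivative_at_withinI)
  moreover have "(q has_derivative Q) (at (p x) within p ` U)"
    by (rule has_derivative_subset[OF q]) (use U(3) in auto)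
  ultimately have "(q \<circ> p has_derivative Q \<circ> P) (at x within U)" by (rule diff_chain_within)
  then have "((\<lambda>y. q (p y)) has_derivative Q \<circ> P) (at x)"
    using at_within_open[OF U(2,1)] by (simp add: comp_def)
  from has_derivative_unique[OF this D] show ?thesis by (metis comp_apply)
qed

text \<open>A chart of the quotient is studied through a chart upstairs, one point at a time;
  neighbouring points are handled by further interpretations.\<close>

locale para_point =
  fixes c :: "('n::finite amb, (real^'n) \<times> (real^'n) \<times> real) chart"
    and e :: "('n amb set, (real^'n) \<times> (real^'n)) chart"
    and x :: "(real^'n) \<times> (real^'n) \<times> real"
  assumes c: "c \<in> hyp_atlas" and e: "e \<in> para_atlas" and x: "x \<in> local_dom proj c e"
begin

abbreviation "R \<equiv> local_rep proj c e"
abbreviation "P \<equiv> param c"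
abbreviation "J \<equiv> Dmap P x"
abbreviation "z \<equiv> P x"

lemma para_chart: "is_chart para_top e"
  using e by (simp add: para_atlas_def)

lemma R_smooth: "smooth_on (local_dom proj c e) R"
  using e c by (simp add: para_atlas_def)

lemma DR_surj: "surj (Dmap R x)"
  using e c x by (simp add: para_atlas_def)

lemma x_in: "x \<in> crange c"
  using x by (simp add: local_dom_eq[OF hyp_chart[OF c]])

lemma proj_in: "proj z \<in> fst e"
  using x by (simp add: local_dom_eq[OF hyp_chart[OF c]])

lemma R_eq: "R y = (snd e \<circ> proj) (P y)"
  by (simp add: local_rep_def)

lemma open_local_dom: "open (local_dom proj c e)"
proof -
  have "openin para_top (fst e)" using para_chart by (simp add: is_chart_def)
  then obtain W where W: "open W" "{z \<in> hyp. proj z \<in> fst e} = hyp \<inter> W"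
    unfolding openin_para_top openin_open by blast
  have "local_dom proj c e = crange c \<inter> P -` W"
  proof (intro set_eqI iffI)
    fix y assume "y \<in> local_dom proj c e"
    then have y: "y \<in> crange c" "proj (P y) \<in> fst e" by (simp_all add: local_dom_eq[OF hyp_chart[OF c]])
    then have "P y \<in> {z \<in> hyp. proj z \<in> fst e}" using hyp_param_in[OF c y(1)] by blast
    then show "y \<in> crange c \<inter> P -` W" using y unfolding W(2) by blast
  next
    fix y assume y: "y \<in> crange c \<inter> P -` W"
    then have "P y \<in> hyp \<inter> W" using hyp_param_in[OF c, of y] by blast
    then have "proj (P y) \<in> fst e" unfolding W(2)[symmetric] by blast
    then show "y \<in> local_dom proj c e" using y by (simp add: local_dom_eq[OF hyp_chart[OF c]])
  qed
  moreover have "open (crange c \<inter> P -` W)"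
    by (rule continuous_open_preimage[OF smooth_on_continuous_on[OF hyp_param_smooth[OF c]]
          chart_open_crange[OF hyp_chart[OF c]] W(1)])
  ultimately show ?thesis by simp
qed

lemma z_hyp: "z \<in> hyp"
  by (rule hyp_param_in[OF c x_in])

lemma linear_J: "linear J"
  by (rule hyp_param_linear[OF c x_in])

lemma DR: "(R has_derivative Dmap R x) (at x)"
  by (rule Dmap_works[OF smooth_on_differentiable[OF R_smooth x]])

lemma linear_DR: "linear (Dmap R x)"
  using DR by (rule has_derivative_linear)

text \<open>The injective differential \<open>J\<close> has a linear left inverse, which serves as a
  derivative of the coordinate map within \<open>hyp\<close>.\<close>

lemma coord_differentiable: "\<exists>L. (snd c has_derivative L) (at z within hyp)"
proof -
  have lin: "linear (coords \<circ> J)"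
    by (rule linear_compose[OF linear_J bounded_linear.linear[OF bounded_linear_coords]])
  have "inj (coords \<circ> J)" by (rule inj_compose[OF inj_coords hyp_param_inj[OF c x_in]])
  then obtain L' where L': "linear L'" "L' \<circ> (coords \<circ> J) = id"
    using linear_injective_left_inverse[OF lin] by blast
  have bl: "bounded_linear (\<lambda>w. L' (coords w))"
    by (rule bounded_linear_compose[OF _ bounded_linear_coords]) (use L'(1) linear_conv_bounded_linear in blast)
  have "openin (top_of_set hyp) (fst c)" using hyp_chart[OF c] by (simp add: is_chart_def)
  then obtain W where W: "open W" "fst c = hyp \<inter> W" unfolding openin_open by blast
  have zc: "z \<in> fst c" by (rule param_in_dom[OF hyp_chart[OF c] x_in])
  have at_eq: "at z within hyp = at z within fst c"
    by (rule at_within_nhd[of z W]) (use zc W in auto)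
  have "continuous_on (fst c) (snd c)"
    using chart_continuous[OF hyp_chart[OF c]] W(2) by (simp add: subtopology_subtopology Int_absorb1)
  then have cont: "continuous (at z within fst c) (snd c)"
    using zc by (simp add: continuous_on_eq_continuous_within)
  have "(snd c has_derivative (\<lambda>w. L' (coords w))) (at z within fst c)"
  proof (rule has_derivative_inverse_within[OF Dmap_works[OF hyp_param_differentiable[OF c x_in]] refl bl _ cont])
    show "L' (coords (J X)) = X" for X using L'(2) by (metis comp_apply id_apply)
    show "snd c z = x" by (rule coord_param[OF hyp_chart[OF c] x_in])
    show "P (snd c z') = z'" if "z' \<in> fst c" for z' by (rule param_coord[OF hyp_chart[OF c] that])
  qed
  then show ?thesis unfolding at_eq by blast
qed

lemma projection_differentiable: "\<exists>Q. (snd e \<circ> proj has_derivative Q) (at z within hyp)"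
proof -
  obtain L where L: "(snd c has_derivative L) (at z within hyp)" using coord_differentiable by blast
  have sz: "snd c z = x" by (rule coord_param[OF hyp_chart[OF c] x_in])
  have "(R has_derivative Dmap R x) (at (snd c z) within snd c ` hyp)"
    unfolding sz by (rule has_derivative_at_withinI[OF DR])
  from diff_chain_within[OF L this]
  have h: "(R \<circ> snd c has_derivative Dmap R x \<circ> L) (at z within hyp)" .
  have "openin (top_of_set hyp) (fst c)" using hyp_chart[OF c] by (simp add: is_chart_def)
  then obtain W where W: "open W" "fst c = hyp \<inter> W" unfolding openin_open by blast
  have zc: "z \<in> fst c" by (rule param_in_dom[OF hyp_chart[OF c] x_in])
  obtain d where d: "d > 0" "ball z d \<subseteq> W" using W zc open_contains_ball by blast
  have "(snd e \<circ> proj has_derivative Dmap R x \<circ> L) (at z within hyp)"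
  proof (rule has_derivative_transform_within[OF h d(1) z_hyp])
    fix z' assume "z' \<in> hyp" "dist z' z < d"
    then have "z' \<in> fst c" using d(2) W(2) by (auto simp: dist_commute)
    then show "(R \<circ> snd c) z' = (snd e \<circ> proj) z'"
      by (simp add: R_eq param_coord[OF hyp_chart[OF c]])
  qed
  then show ?thesis by blast
qed

text \<open>\<open>fibre_point\<close> may choose a point outside the domain of \<open>c\<close>, so
  the derivative is wanted on the whole orbit; the invariance of \<open>proj\<close> under
  \<open>act\<close> carries it there.\<close>

lemma projection_derivative:
  defines "Q t \<equiv> frechet_derivative (snd e \<circ> proj) (at (act t z) within hyp)"
  shows "(snd e \<circ> proj has_derivative Q t) (at (act t z) within hyp)"
    and "Q t (act t (J X)) = Dmap R x X"
proof -
  obtain Q0 where Q0: "(snd e \<circ> proj has_derivative Q0) (at z within hyp)"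
    using projection_differentiable by blast
  have inv: "act (- t) (act t z) = z" by (simp add: act_act act_0)
  have a: "(act (- t) has_derivative act (- t)) (at (act t z) within hyp)"
    by (rule bounded_linear_imp_has_derivative[OF bounded_linear_act])
  have "(snd e \<circ> proj has_derivative Q0) (at (act (- t) (act t z)) within act (- t) ` hyp)"
    unfolding inv by (rule has_derivative_subset[OF Q0]) (auto simp: act_in_hyp)
  from diff_chain_within[OF a this]
  have "((snd e \<circ> proj) \<circ> act (- t) has_derivative Q0 \<circ> act (- t)) (at (act t z) within hyp)" .
  moreover have "(snd e \<circ> proj) \<circ> act (- t) = snd e \<circ> proj" by (auto simp: proj_act)
  ultimately have "(snd e \<circ> proj) differentiable (at (act t z) within hyp)"
    by (auto simp: differentiable_def)
  then show Q: "(snd e \<circ> proj has_derivative Q t) (at (act t z) within hyp)"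
    unfolding Q_def using frechet_derivative_works by blast
  show "Q t (act t (J X)) = Dmap R x X"
  proof (rule has_derivative_within_unique_along[where p = "\<lambda>y. act t (P y)" and U = "crange c", OF Q])
    show "((\<lambda>y. act t (P y)) has_derivative (\<lambda>X. act t (J X))) (at x)"
      by (rule bounded_linear.has_derivative[OF bounded_linear_act Dmap_works[OF hyp_param_differentiable[OF c x_in]]])
    show "act t (P y) \<in> hyp" if "y \<in> crange c" for y using hyp_param_in[OF c that] by (simp add: act_in_hyp)
    have "(\<lambda>y. (snd e \<circ> proj) (act t (P y))) = R" by (auto simp: R_eq proj_act)
    then show "((\<lambda>y. (snd e \<circ> proj) (act t (P y))) has_derivative Dmap R x) (at x)" using DR by simp
  qed (use chart_open_crange[OF hyp_chart[OF c]] x_in in auto)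
qed

text \<open>The projection is constant along the orbit of \<open>z\<close>, whose velocity is
  \<open>zeta z\<close>.\<close>

lemma vertical: "\<exists>X. J X = zeta z \<and> Dmap R x X = 0"
proof -
  obtain X where X: "zeta z = J X" using hyp_tangent_space[OF c x_in ghat_zeta_self] .
  let ?Q = "frechet_derivative (snd e \<circ> proj) (at (act 0 z) within hyp)"
  have "?Q (1 *\<^sub>R zeta z) = 0"
  proof (rule has_derivative_within_unique_along[where p = "\<lambda>t. act t z" and U = UNIV, OF projection_derivative(1)])
    show "((\<lambda>t. act t z) has_derivative (\<lambda>h. h *\<^sub>R zeta z)) (at 0)" by (rule has_derivative_act_curve)
    show "act t z \<in> hyp" for t using z_hyp by (simp add: act_in_hyp)
    have "(\<lambda>t. (snd e \<circ> proj) (act t z)) = (\<lambda>t. (snd e \<circ> proj) z)" by (auto simp: proj_act)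
    then show "((\<lambda>t. (snd e \<circ> proj) (act t z)) has_derivative (\<lambda>h. 0)) (at 0)" by simp
  qed auto
  then have "Dmap R x X = 0" using projection_derivative(2)[of 0 X] X by (simp add: act_0)
  then show ?thesis using X by metis
qed

text \<open>Adding the \<open>zeta\<close> component to the differential of \<open>R\<close> gives a
  map \<open>N\<close> between spaces of equal dimension. The vertical vector changes this component
  alone, so \<open>N\<close> is onto and hence bijective; \<open>K\<close> is its inverse on vectors
  with last component 0.\<close>

lemma horizontal_inverse:
  "\<exists>K. linear K \<and> (\<forall>u. Dmap R x (K u) = u) \<and> (\<forall>u. ghat (zeta z) (J (K u)) = 0) \<and>
    (\<forall>X. ghat (zeta z) (J X) = 0 \<longrightarrow> X = K (Dmap R x X))"
proof -
  obtain V where V: "J V = zeta z" "Dmap R x V = 0" using vertical by blast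
  define N where "N X = (fst (Dmap R x X), snd (Dmap R x X), ghat (zeta z) (J X))" for X
  have lin: "linear N"
    by (rule linearI) (simp_all add: N_def linear_add[OF linear_DR] linear_cmul[OF linear_DR]
        linear_add[OF linear_J] linear_cmul[OF linear_J] ghat_simps)
  have sN: "\<exists>X. N X = (u, v, r)" for u v r
  proof -
    obtain X where X: "Dmap R x X = (u, v)" using DR_surj by (metis surjD)
    have "N (X + (r - ghat (zeta z) (J X)) *\<^sub>R V) = (u, v, r)"
      by (simp add: N_def linear_add[OF linear_DR] linear_cmul[OF linear_DR] X V
        linear_add[OF linear_J] linear_cmul[OF linear_J] ghat_simps ghat_zeta[OF z_hyp])
    then show ?thesis by blast
  qed
  have "surj N"
  proof (rule surjI)
    show "N (SOME X. N X = y) = y" for y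
      by (rule someI_ex) (use sN[of "fst y" "fst (snd y)" "snd (snd y)"] in simp)
  qed
  then have "inj N" by (rule linear_surj_imp_inj[OF lin])
  then obtain M where M: "linear M" "\<forall>X. M (N X) = X" "\<forall>Y. N (M Y) = Y"
    using linear_injective_isomorphism[OF lin] by blast
  define K where "K u = M (fst u, snd u, 0)" for u :: "(real^'n) \<times> (real^'n)"
  have NK: "N (K u) = (fst u, snd u, 0)" for u using M(3) by (simp add: K_def)
  show ?thesis
  proof (intro exI[of _ K] conjI allI impI)
    show "linear K"
    proof (rule linearI)
      fix u v :: "(real^'n) \<times> (real^'n)" and r :: real
      show "K (u + v) = K u + K v" using linear_add[OF M(1), of "(fst u, snd u, 0)" "(fst v, snd v, 0)"]
        by (simp add: K_def)
      show "K (r *\<^sub>R v) = r *\<^sub>R K v" using linear_cmul[OF M(1), of r "(fst v, snd v, 0)"]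
        by (simp add: K_def)
    qed
    show "Dmap R x (K u) = u" "ghat (zeta z) (J (K u)) = 0" for u
      using NK[of u] by (auto simp: N_def prod_eq_iff)
    fix X assume "ghat (zeta z) (J X) = 0"
    then have "N X = (fst (Dmap R x X), snd (Dmap R x X), 0)" by (simp add: N_def)
    then show "X = K (Dmap R x X)" using M(2) unfolding K_def by metis
  qed
qed

text \<open>The inverse of the differential of the projection on the horizontal space at \<open>z\<close>, in the
  coordinates of \<open>c\<close> and \<open>e\<close>.\<close>

definition hl :: "(real^'n) \<times> (real^'n) \<Rightarrow> (real^'n) \<times> (real^'n) \<times> real"
  where "hl = (SOME K. linear K \<and> (\<forall>u. Dmap R x (K u) = u) \<and> (\<forall>u. ghat (zeta z) (J (K u)) = 0) \<and>
    (\<forall>X. ghat (zeta z) (J X) = 0 \<longrightarrow> X = K (Dmap R x X)))"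

lemma hl: "linear hl" "Dmap R x (hl u) = u" "ghat (zeta z) (J (hl u)) = 0"
  "ghat (zeta z) (J X) = 0 \<Longrightarrow> X = hl (Dmap R x X)"
  using someI_ex[OF horizontal_inverse, folded hl_def] by blast+

lemma hl_hor: "J (hl u) \<in> hor z"
  by (simp add: hor_iff hyp_tangent[OF c x_in] hl(3))

lemma hor_hl:
  assumes "w \<in> hor z"
  obtains u where "w = J (hl u)"
proof -
  have "ghat z w = 0" using assms by (simp add: hor_iff)
  then obtain X where X: "w = J X" using hyp_tangent_space[OF c x_in] by blast
  then have "X = hl (Dmap R x X)" using assms by (intro hl(4)) (simp add: hor_iff)
  then show ?thesis using X by (intro that[of "Dmap R x X"]) metis
qed

text \<open>Subtracting a multiple of the vertical vector removes the \<open>zeta\<close> component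
  without changing the projection.\<close>

lemma J_hl: "J (hl (Dmap R x X)) = J X - ghat (zeta z) (J X) *\<^sub>R zeta z"
proof -
  obtain V where V: "J V = zeta z" "Dmap R x V = 0" using vertical by blast
  let ?X = "X - ghat (zeta z) (J X) *\<^sub>R V"
  have "ghat (zeta z) (J ?X) = 0"
    by (simp add: linear_diff[OF linear_J] linear_cmul[OF linear_J] V ghat_simps ghat_zeta[OF z_hyp])
  then have "?X = hl (Dmap R x ?X)" by (rule hl(4))
  also have "Dmap R x ?X = Dmap R x X" by (simp add: linear_diff[OF linear_DR] linear_cmul[OF linear_DR] V)
  finally have "J (hl (Dmap R x X)) = J ?X" by simp
  then show ?thesis by (simp add: linear_diff[OF linear_J] linear_cmul[OF linear_J] V)
qed

lemma hlift_act: "hlift e (act t z) u = act t (J (hl u))"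
  unfolding hlift_def
proof (rule the_equality)
  show "act t (J (hl u)) \<in> hor (act t z) \<and>
      frechet_derivative (snd e \<circ> proj) (at (act t z) within hyp) (act t (J (hl u))) = u"
    using hl_hor by (simp add: act_in_hor projection_derivative(2) hl(2))
  fix w assume w: "w \<in> hor (act t z) \<and> frechet_derivative (snd e \<circ> proj) (at (act t z) within hyp) w = u"
  have wt: "w = act t (act (- t) w)" by (simp add: act_act act_0)
  then have "act (- t) w \<in> hor z" using w act_in_hor by metis
  then obtain v where v: "act (- t) w = J (hl v)" using hor_hl by blast
  then have "u = v" using w wt projection_derivative(2)[of t "hl v"] hl(2) by metis
  then show "w = act t (J (hl u))" using v wt by simp
qed

text \<open>\<open>fibre_point\<close> lies on the orbit of \<open>z\<close>, and \<open>act\<close>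
  is isometric and carries horizontal lifts to horizontal lifts.\<close>

lemma para_metric_eq: "para_metric e (R x) u v = ghat (J (hl u)) (J (hl v))"
proof -
  have pe: "param e (R x) = proj z"
    using param_coord[OF para_chart proj_in] by (simp add: local_rep_def)
  have "\<exists>z'. z' \<in> hyp \<and> proj z' = param e (R x)" using z_hyp pe by metis
  then have "fibre_point e (R x) \<in> hyp \<and> proj (fibre_point e (R x)) = param e (R x)"
    unfolding fibre_point_def by (rule someI_ex)
  then obtain t where t: "fibre_point e (R x) = act t z" using proj_eqD pe by metis
  show ?thesis by (simp add: para_metric_def Let_def t hlift_act ghat_act)
qed

text \<open>The version for vectors with a vertical part. A local section is horizontal at its base
  point but perhaps not nearby, so this is the form of the metric that gets differentiated.\<close>

lemma para_metric_DR:
  "para_metric e (R x) (Dmap R x X) (Dmap R x Y) =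
    ghat (J X) (J Y) - ghat (zeta z) (J X) * ghat (zeta z) (J Y)"
  unfolding para_metric_eq J_hl
  by (simp add: ghat_simps ghat_zeta[OF z_hyp] ghat_commute)

lemma para_metric_nondegenerate: "nondegenerate_form (para_metric e (R x))"
  unfolding nondegenerate_form_def
proof (intro allI impI)
  fix u assume h: "\<forall>v. para_metric e (R x) u v = 0"
  have "ghat (J (hl u)) w = 0" for w
  proof -
    obtain X s where w: "w = J X + s *\<^sub>R z" using hyp_decompose[OF c x_in] .
    have e: "J X = J (hl (Dmap R x X)) + ghat (zeta z) (J X) *\<^sub>R zeta z" by (simp add: J_hl)
    have "ghat (J (hl u)) (J X) = ghat (J (hl u)) (J (hl (Dmap R x X)) + ghat (zeta z) (J X) *\<^sub>R zeta z)"
      by (rule arg_cong[OF e])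
    also have "\<dots> = para_metric e (R x) u (Dmap R x X) + ghat (zeta z) (J X) * ghat (zeta z) (J (hl u))"
      unfolding para_metric_eq by (simp add: ghat_simps ghat_commute)
    also have "\<dots> = 0" unfolding spec[OF h, of "Dmap R x X"] hl(3) by simp
    finally have "ghat (J (hl u)) (J X) = 0" .
    then show ?thesis unfolding w using hyp_tangent[OF c x_in, of "hl u"]
      by (simp add: ghat_simps ghat_commute[of _ z])
  qed
  then have "J (hl u) = 0" by (rule ghat_nondegenerate)
  then have "J (hl u) = J 0" using linear_0[OF linear_J] by simp
  then have "hl u = 0" by (rule injD[OF hyp_param_inj[OF c x_in]])
  then show "u = 0" using hl(2)[of u] linear_0[OF linear_DR] by simp
qed

lemma linear_J_hl: "linear (\<lambda>u. J (hl u))"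
  using linear_compose[OF hl(1) linear_J] by (simp add: comp_def)

lemma para_metric_bilinear: "bilinear (para_metric e (R x))"
  unfolding bilinear_def para_metric_eq
  by (intro conjI allI linearI)
    (simp_all add: ghat_simps linear_add[OF linear_J_hl] linear_cmul[OF linear_J_hl])

lemma para_metric_symmetric: "para_metric e (R x) u v = para_metric e (R x) v u"
  by (simp add: para_metric_eq ghat_commute)

end

section \<open>Local sections and the Levi-Civita connection of the quotient\<close>

lemma Ck_on_ident: "Ck_on k S (\<lambda>x. x)"
proof (cases k)
  case (Suc m)
  have "Dmap (\<lambda>x. x) x v = v" for x v :: 'a
    using Dmap_eq[OF has_derivative_ident, of x] by simp
  then show ?thesis unfolding Suc by (simp add: Ck_on_const)
qed simp

context para_point
begin

text \<open>\<open>R\<close> lowers the dimension by one, so it is restricted to the affine slice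
  \<open>x + hl k\<close>. There its derivative at 0 is the identity and its Hessian is that of
  \<open>R\<close> on lifted vectors; the inverse followed by the slice is the section.\<close>

lemma local_section:
  obtains V \<sigma> where "open V" "R x \<in> V" "\<sigma> (R x) = x"
    "\<And>y. y \<in> V \<Longrightarrow> \<sigma> y \<in> local_dom proj c e" "\<And>y. y \<in> V \<Longrightarrow> R (\<sigma> y) = y"
    "\<And>y. y \<in> V \<Longrightarrow> \<sigma> differentiable (at y)" "\<And>u. Dmap \<sigma> (R x) u = hl u"
    "\<And>u. ((\<lambda>y. Dmap \<sigma> y u) has_derivative (\<lambda>a. - hl (hess R x (hl a) (hl u)))) (at (R x))"
proof -
  define \<alpha> where "\<alpha> k = x + hl k" for k
  define U where "U = \<alpha> -` local_dom proj c e"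
  have blh: "bounded_linear hl" using hl(1) linear_conv_bounded_linear by blast
  have \<alpha>0: "\<alpha> 0 = x" by (simp add: \<alpha>_def linear_0[OF hl(1)])
  have d\<alpha>: "(\<alpha> has_derivative hl) (at k)" for k
    unfolding \<alpha>_def
    using has_derivative_add[OF has_derivative_const bounded_linear_imp_has_derivative[OF blh]] by simp
  have d\<alpha>': "\<alpha> differentiable (at k)" for k
    unfolding differentiable_def using d\<alpha>[of k] by blast
  have D\<alpha>: "Dmap \<alpha> k = hl" for k by (rule Dmap_eq[OF d\<alpha>])
  have "continuous_on UNIV \<alpha>"
    using d\<alpha> has_derivative_continuous continuous_at_imp_continuous_on by blast
  then have oU: "open U" unfolding U_def by (intro open_vimage open_local_dom)
  have U0: "0 \<in> U" using x by (simp add: U_def \<alpha>0)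
  have s\<alpha>: "smooth_on U \<alpha>"
    unfolding \<alpha>_def
    by (rule smooth_onI, rule Ck_on_add[OF oU Ck_on_const Ck_on_bounded_linear[OF oU blh Ck_on_ident]])
  have sK: "smooth_on U (\<lambda>k. R (\<alpha> k))"
    by (rule smooth_on_compose[OF oU open_local_dom s\<alpha> R_smooth]) (auto simp: U_def)
  have DK: "Dmap (\<lambda>k. R (\<alpha> k)) 0 a = a" for a
    using Dmap_compose(2)[of \<alpha> 0 R a] smooth_on_differentiable[OF s\<alpha> U0] smooth_on_differentiable[OF R_smooth x]
    by (simp add: \<alpha>0 D\<alpha> hl(2))
  have h\<alpha>: "hess \<alpha> 0 a b = 0" for a b
    unfolding hess_def D\<alpha> by (rule Dmap_zero)
  have hK: "hess (\<lambda>k. R (\<alpha> k)) 0 a b = hess R x (hl a) (hl b)" for a b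
  proof -
    have "hess (\<lambda>k. R (\<alpha> k)) 0 a b =
        Dmap R (\<alpha> 0) (hess \<alpha> 0 a b) + hess R (\<alpha> 0) (Dmap \<alpha> 0 a) (Dmap \<alpha> 0 b)"
      by (rule hess_compose(2)[OF oU U0 smooth_on_differentiable[OF s\<alpha>]
            smooth_on_differentiable[OF smooth_on_Dmap[OF s\<alpha>] U0] open_local_dom R_smooth])
        (simp_all add: U_def)
    then show ?thesis by (simp add: h\<alpha> \<alpha>0 D\<alpha> linear_0[OF linear_DR])
  qed
  obtain V g where Vg: "open V" "R (\<alpha> 0) \<in> V" "g (R (\<alpha> 0)) = 0" "\<And>y. y \<in> V \<Longrightarrow> g y \<in> U"
    "\<And>y. y \<in> V \<Longrightarrow> R (\<alpha> (g y)) = y" "\<And>y. y \<in> V \<Longrightarrow> g differentiable (at y)"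
    "\<And>a. Dmap g (R (\<alpha> 0)) a = a"
    "\<And>b. ((\<lambda>y. Dmap g y b) has_derivative (\<lambda>a. - hess (\<lambda>k. R (\<alpha> k)) 0 a b)) (at (R (\<alpha> 0)))"
    by (rule smooth_local_inverse[OF oU U0 sK DK], rule that)
  note Vg' = Vg[unfolded \<alpha>0 hK]
  have D\<sigma>: "(\<lambda>y. \<alpha> (g y)) differentiable (at y)" "Dmap (\<lambda>y. \<alpha> (g y)) y u = hl (Dmap g y u)" if "y \<in> V" for y u
    using Dmap_compose[OF Vg(6)[OF that] d\<alpha>'] by (simp_all add: D\<alpha>)
  have "((\<lambda>y. hl (Dmap g y u)) has_derivative (\<lambda>a. hl (- hess R x (hl a) (hl u)))) (at (R x))" for u
    by (rule bounded_linear.has_derivative[OF blh Vg'(8)])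
  then have "((\<lambda>y. hl (Dmap g y u)) has_derivative (\<lambda>a. - hl (hess R x (hl a) (hl u)))) (at (R x))" for u
    by (simp add: linear_neg[OF hl(1)])
  then have "((\<lambda>y. Dmap (\<lambda>y. \<alpha> (g y)) y u) has_derivative (\<lambda>a. - hl (hess R x (hl a) (hl u)))) (at (R x))" for u
    by (rule has_derivative_transform_within_open[OF _ Vg'(1,2)]) (simp add: D\<sigma>(2))
  from that[of V "\<lambda>y. \<alpha> (g y)", OF Vg'(1,2) _ _ Vg'(5) D\<sigma>(1) _ this]
  show ?thesis using Vg'(2,3,4,7) by (simp add: \<alpha>0 D\<sigma>(2) U_def)
qed

text \<open>The section of the projection is horizontal at the base point, so that only the pulled back
  ambient metric contributes to the first derivatives of the metric there: the correction term is a
  product of two functions that vanish at the base point.\<close>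

lemma para_christoffel:
  defines "H \<equiv> (\<lambda>u v. hess P x (hl u) (hl v) - J (hl (hess R x (hl u) (hl v))))"
  shows "para_metric e (R x) (christoffel (para_metric e) (R x) u v) w = ghat (H u v) (J (hl w))"
proof -
  obtain V \<sigma> where V: "open V" "R x \<in> V" and \<sigma>x: "\<sigma> (R x) = x"
    and \<sigma>in: "\<And>y. y \<in> V \<Longrightarrow> \<sigma> y \<in> local_dom proj c e" and R\<sigma>: "\<And>y. y \<in> V \<Longrightarrow> R (\<sigma> y) = y"
    and d\<sigma>: "\<And>y. y \<in> V \<Longrightarrow> \<sigma> differentiable (at y)" and D\<sigma>: "\<And>u. Dmap \<sigma> (R x) u = hl u"
    and DD\<sigma>: "\<And>u. ((\<lambda>y. Dmap \<sigma> y u) has_derivative (\<lambda>a. - hl (hess R x (hl a) (hl u)))) (at (R x))"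
    by (rule local_section, rule that)
  define S where "S y = P (\<sigma> y)" for y
  have dD\<sigma>: "(\<lambda>y. Dmap \<sigma> y u) differentiable (at (R x))" for u
    unfolding differentiable_def using DD\<sigma>[of u] by blast
  have crange: "\<sigma> y \<in> crange c" if "y \<in> V" for y
    using \<sigma>in[OF that] by (simp add: local_dom_eq[OF hyp_chart[OF c]])
  have DS: "S differentiable (at y)" "Dmap S y u = Dmap P (\<sigma> y) (Dmap \<sigma> y u)" if "y \<in> V" for y u
    unfolding S_def[abs_def]
    using Dmap_compose[OF d\<sigma>[OF that] hyp_param_differentiable[OF c crange[OF that]]] by simp_all
  note hc = hess_compose[OF V d\<sigma> dD\<sigma> chart_open_crange[OF hyp_chart[OF c]] hyp_param_smooth[OF c] crange]
  have "hess \<sigma> (R x) a b = - hl (hess R x (hl a) (hl b))" for a b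
    unfolding hess_def[of \<sigma>] Dmap_eq[OF DD\<sigma>] ..
  \<comment> \<open>This is the origin of \<open>H\<close>: it is the Hessian of the section in the
    ambient space, and its \<open>J\<close> term comes from the second derivative of
    \<open>\<sigma>\<close>.\<close>
  then have "hess S (R x) a b = H a b" for a b
    unfolding S_def[abs_def] H_def using hc(2)[of a b]
    by (simp add: \<sigma>x D\<sigma> linear_neg[OF linear_J])
  moreover have "(\<lambda>y. Dmap S y u) differentiable (at (R x))" for u
    unfolding S_def[abs_def] by (rule hc(1))
  ultimately have dDS: "((\<lambda>y. Dmap S y u) has_derivative (\<lambda>a. H a u)) (at (R x))" for u
  proof -
    assume h: "\<And>a b. hess S (R x) a b = H a b" and d: "\<And>u. (\<lambda>y. Dmap S y u) differentiable (at (R x))"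
    have "Dmap (\<lambda>y. Dmap S y u) (R x) = (\<lambda>a. H a u)"
      using h unfolding hess_def by (intro ext)
    then show ?thesis using Dmap_works[OF d[of u]] by simp
  qed
  have DSx: "Dmap S (R x) u = J (hl u)" for u by (simp add: DS(2)[OF V(2)] \<sigma>x D\<sigma>)
  define \<theta> where "\<theta> u y = ghat (zeta (S y)) (Dmap S y u)" for u y
  have metric: "ghat (Dmap S y u) (Dmap S y v) - \<theta> u y * \<theta> v y = para_metric e y u v" if y: "y \<in> V" for y u v
  proof -
    interpret py: para_point c e "\<sigma> y" by (rule para_point.intro[OF c e \<sigma>in[OF y]])
    have "Dmap R (\<sigma> y) (Dmap \<sigma> y u) = u" for u
    proof -
      have "Dmap (\<lambda>y. R (\<sigma> y)) y = Dmap (\<lambda>y. y) y"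
        by (rule Dmap_cong_open[OF V(1) y]) (rule R\<sigma>)
      then have "Dmap (\<lambda>y. R (\<sigma> y)) y u = u" using Dmap_eq[OF has_derivative_ident, of y] by simp
      then show ?thesis
        using Dmap_compose(2)[OF d\<sigma>[OF y] smooth_on_differentiable[OF R_smooth \<sigma>in[OF y]]] by simp
    qed
    then show ?thesis
      using py.para_metric_DR[of "Dmap \<sigma> y u" "Dmap \<sigma> y v"] R\<sigma>[OF y]
      by (simp add: \<theta>_def DS(2)[OF y] S_def)
  qed
  have blz: "bounded_linear (zeta :: 'n amb \<Rightarrow> _)"
    unfolding zeta_def by (intro bounded_linear_Pair bounded_linear_fst bounded_linear_minus bounded_linear_snd)
  have d\<theta>: "\<theta> u differentiable (at (R x))" for u
  proof -
    have "(\<lambda>y. Dmap S y u) differentiable (at (R x))"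
      unfolding differentiable_def using dDS[of u] by blast
    then show ?thesis
      unfolding \<theta>_def[abs_def]
      by (rule Dmap_bilinear(1)[OF bounded_bilinear_ghat Dmap_bounded_linear(1)[OF blz DS(1)[OF V(2)]]])
  qed
  have \<theta>0: "\<theta> u (R x) = 0" for u by (simp add: \<theta>_def DSx S_def \<sigma>x hl(3))
  have D: "((\<lambda>y. para_metric e y u v) has_derivative
      (\<lambda>a. ghat (H a u) (J (hl v)) + ghat (J (hl u)) (H a v))) (at (R x))" for u v
  proof (rule has_derivative_transform_within_open[OF _ V metric])
    have "((\<lambda>y. \<theta> u y * \<theta> v y) has_derivative (\<lambda>a. 0)) (at (R x))"
      using has_derivative_mult[OF Dmap_works[OF d\<theta>[of u]] Dmap_works[OF d\<theta>[of v]]] by (simp add: \<theta>0)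
    from has_derivative_diff[OF bounded_bilinear.FDERIV[OF bounded_bilinear_ghat dDS[of u] dDS[of v]] this]
    show "((\<lambda>y. ghat (Dmap S y u) (Dmap S y v) - \<theta> u y * \<theta> v y) has_derivative
      (\<lambda>a. ghat (H a u) (J (hl v)) + ghat (J (hl u)) (H a v))) (at (R x))"
      by (simp add: DSx add.commute)
  qed
  note sP = chart_open_crange[OF hyp_chart[OF c]] x_in hyp_param_smooth[OF c]
  note sR = open_local_dom x R_smooth
  have bilH: "bilinear H"
    unfolding H_def bilinear_def
    by (intro conjI allI linearI)
      (simp_all add: linear_add[OF hl(1)] linear_cmul[OF hl(1)] linear_add[OF linear_J] linear_cmul[OF linear_J]
        bilinear_ladd[OF bilinear_hess[OF sP]] bilinear_radd[OF bilinear_hess[OF sP]]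
        bilinear_lmul[OF bilinear_hess[OF sP]] bilinear_rmul[OF bilinear_hess[OF sP]]
        bilinear_ladd[OF bilinear_hess[OF sR]] bilinear_radd[OF bilinear_hess[OF sR]]
        bilinear_lmul[OF bilinear_hess[OF sR]] bilinear_rmul[OF bilinear_hess[OF sR]]
        algebra_simps)
  show ?thesis
  proof (rule christoffel_pullback[OF bilinear_ghat ghat_commute linear_J_hl _ para_metric_nondegenerate bilH _ D])
    show "para_metric e (R x) u v = ghat (J (hl u)) (J (hl v))" for u v by (rule para_metric_eq)
    show "ghat (H u v) (J (hl w)) = ghat (H v u) (J (hl w))" for u v w
      using ghat_hess_symmetric[OF sP, of "hl u" "hl v" "J (hl w)"] hess_symmetric[OF sR, of "hl u" "hl v"]
      by (simp add: H_def ghat_simps)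
  qed
qed

end

section \<open>Maps into para-complex hyperbolic space and their horizontal lifts\<close>

context
  fixes A :: "('a, 'e::euclidean_space) chart set" and s :: "'a \<Rightarrow> 'n::finite amb" and sbar :: "'a \<Rightarrow> 'n amb set"
    and T :: "'a topology" and c' :: "('a, 'e) chart" and e :: "('n amb set, (real^'n) \<times> (real^'n)) chart" and x :: 'e
  assumes s: "smooth_map A hyp_atlas s" and sbar: "smooth_map A para_atlas sbar"
    and c': "c' \<in> A" and T: "is_chart T c'"
    and proj: "\<And>p. p \<in> fst c' \<Longrightarrow> proj (s p) = sbar p"
    and hor: "\<And>y a. y \<in> crange c' \<Longrightarrow> Dmap (s \<circ> param c') y a \<in> hor (s (param c' y))"
    and e: "e \<in> para_atlas" and x: "x \<in> local_dom sbar c' e"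
begin

text \<open>As the lift is horizontal, \<open>hl\<close> returns the differential of its local
  representative. The Hessian of \<open>R\<close> then occurs twice with opposite signs, in the
  chain rule and in the Christoffel symbol, and the ambient Hessian of the lift is left.\<close>

lemma para_lift:
  obtains c where "para_point c e (local_rep s c' c x)" "param c (local_rep s c' c x) = s (param c' x)"
    "local_rep sbar c' e x = local_rep proj c e (local_rep s c' c x)"
    "\<And>a. Dmap (s \<circ> param c') x a =
      Dmap (param c) (local_rep s c' c x) (para_point.hl c e (local_rep s c' c x) (Dmap (local_rep sbar c' e) x a))"
    "\<And>a b w. para_metric e (local_rep sbar c' e x)
      (hess (local_rep sbar c' e) x a b + christoffel (para_metric e) (local_rep sbar c' e x)
         (Dmap (local_rep sbar c' e) x a) (Dmap (local_rep sbar c' e) x b)) w =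
      ghat (hess (s \<circ> param c') x a b)
        (Dmap (param c) (local_rep s c' c x) (para_point.hl c e (local_rep s c' c x) w))"
proof -
  have xc: "x \<in> crange c'" using x by (simp add: local_dom_eq[OF T])
  obtain c where cc: "c \<in> hyp_atlas" "x \<in> local_dom s c' c" using smooth_map_covers[OF s c' T xc] .
  let ?h = "local_rep s c' c" and ?G = "local_rep sbar c' e"
  define D where "D = local_dom s c' c \<inter> local_dom sbar c' e"
  have oD: "open D" unfolding D_def by (intro open_Int local_rep_smooth(1)[OF s c' cc(1)] local_rep_smooth(1)[OF sbar c' e])
  have xD: "x \<in> D" using cc x by (simp add: D_def)
  have ph: "param c (?h y) = s (param c' y)" if "y \<in> D" for y
    using lift_factor(1)[OF s c' T cc(1), of y] that by (simp add: D_def)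
  have hin: "?h y \<in> local_dom proj c e" if y: "y \<in> D" for y
  proof -
    have "y \<in> crange c'" "sbar (param c' y) \<in> fst e" using y by (auto simp: D_def local_dom_eq[OF T])
    moreover have "?h y \<in> crange c" using lift_factor(2)[OF s c' T cc(1), of y] y by (simp add: D_def)
    ultimately show ?thesis
      using ph[OF y] proj[OF param_in_dom[OF T]] by (simp add: local_dom_eq[OF hyp_chart[OF cc(1)]])
  qed
  have Gh: "?G y = local_rep proj c e (?h y)" if y: "y \<in> D" for y
  proof -
    have "y \<in> crange c'" using y by (auto simp: D_def local_dom_eq[OF T])
    then show ?thesis
      using ph[OF y] proj[OF param_in_dom[OF T]] by (simp add: local_rep_def)
  qed
  interpret para_point c e "?h x" by (rule para_point.intro[OF cc(1) e hin[OF xD]])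
  have hs: "smooth_on D ?h"
    by (rule smooth_on_subset[OF local_rep_smooth(2)[OF s c' cc(1)]]) (auto simp: D_def)
  have hd: "?h differentiable (at y)" if "y \<in> D" for y by (rule smooth_on_differentiable[OF hs that])
  have DG: "Dmap ?G y a = Dmap R (?h y) (Dmap ?h y a)" if y: "y \<in> D" for y a
  proof -
    have "Dmap ?G y = Dmap (\<lambda>y. R (?h y)) y" by (rule Dmap_cong_open[OF oD y]) (rule Gh)
    then show ?thesis
      using Dmap_compose(2)[OF hd[OF y] smooth_on_differentiable[OF R_smooth hin[OF y]]] by simp
  qed
  have hG: "hess ?G x a b = Dmap R (?h x) (hess ?h x a b) + hess R (?h x) (Dmap ?h x a) (Dmap ?h x b)" for a b
  proof -
    have "Dmap (\<lambda>y. Dmap ?G y b) x = Dmap (\<lambda>y. Dmap (\<lambda>y. R (?h y)) y b) x"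
    proof (rule Dmap_cong_open[OF oD xD])
      fix y assume y: "y \<in> D"
      show "Dmap ?G y b = Dmap (\<lambda>y. R (?h y)) y b"
        using DG[OF y] Dmap_compose(2)[OF hd[OF y] smooth_on_differentiable[OF R_smooth hin[OF y]]] by simp
    qed
    then have "hess ?G x a b = hess (\<lambda>y. R (?h y)) x a b" by (simp add: hess_def)
    also have "\<dots> = Dmap R (?h x) (hess ?h x a b) + hess R (?h x) (Dmap ?h x a) (Dmap ?h x b)"
      by (rule hess_compose(2)[OF oD xD hd smooth_on_differentiable[OF smooth_on_Dmap[OF hs] xD]
            open_local_dom R_smooth hin])
    finally show ?thesis .
  qed
  have Dphi: "Dmap (s \<circ> param c') x a = J (Dmap ?h x a)" for a
    by (rule lift_derivatives(1)[OF s c' T cc])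
  have hlG: "hl (Dmap ?G x a) = Dmap ?h x a" for a
  proof -
    have "ghat (zeta (param c (?h x))) (J (Dmap ?h x a)) = 0"
      using hor[OF xc, of a] unfolding Dphi[of a, symmetric] ph[OF xD] by (simp add: hor_iff)
    from hl(4)[OF this] show ?thesis unfolding DG[OF xD] by simp
  qed
  show ?thesis
  proof (rule that[of c])
    show "para_point c e (?h x)" by (rule para_point_axioms)
    show "param c (?h x) = s (param c' x)" by (rule ph[OF xD])
    show "?G x = R (?h x)" by (rule Gh[OF xD])
    show "Dmap (s \<circ> param c') x a = J (hl (Dmap ?G x a))" for a unfolding hlG by (rule Dphi)
    fix a b w
    have JX: "ghat (J (hl (Dmap R (?h x) X))) (J (hl w)) = ghat (J X) (J (hl w))" for X
      unfolding J_hl by (simp add: ghat_simps hl(3))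
    have "para_metric e (?G x) (hess ?G x a b + christoffel (para_metric e) (?G x) (Dmap ?G x a) (Dmap ?G x b)) w =
       ghat (J (hl (hess ?G x a b))) (J (hl w)) +
       ghat (hess P (?h x) (Dmap ?h x a) (Dmap ?h x b) - J (hl (hess R (?h x) (Dmap ?h x a) (Dmap ?h x b)))) (J (hl w))"
      unfolding Gh[OF xD] bilinear_ladd[OF para_metric_bilinear] para_christoffel hlG
      unfolding para_metric_eq ..
    also have "\<dots> = ghat (J (hess ?h x a b)) (J (hl w)) + ghat (hess P (?h x) (Dmap ?h x a) (Dmap ?h x b)) (J (hl w))"
      unfolding hG by (simp add: linear_add[OF hl(1)] linear_add[OF linear_J] ghat_simps JX)
    also have "\<dots> = ghat (hess (s \<circ> param c') x a b) (J (hl w))"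
      unfolding lift_derivatives(2)[OF s c' T cc] by (simp add: ghat_simps)
    finally show "para_metric e (?G x) (hess ?G x a b + christoffel (para_metric e) (?G x) (Dmap ?G x a) (Dmap ?G x b)) w =
      ghat (hess (s \<circ> param c') x a b) (J (hl w))" .
  qed
qed

lemma para_first_form:
  "first_form para_metric sbar c' e x = (\<lambda>a b. ghat (Dmap (s \<circ> param c') x a) (Dmap (s \<circ> param c') x b))"
proof -
  obtain c where p: "para_point c e (local_rep s c' c x)"
    and G: "local_rep sbar c' e x = local_rep proj c e (local_rep s c' c x)"
    and D: "\<And>a. Dmap (s \<circ> param c') x a =
      Dmap (param c) (local_rep s c' c x) (para_point.hl c e (local_rep s c' c x) (Dmap (local_rep sbar c' e) x a))"
    using para_lift by metis
  show ?thesis unfolding first_form_def D G para_point.para_metric_eq[OF p] ..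
qed

text \<open>As for \<open>hyp\<close>, except that tangent vectors of the quotient correspond to
  horizontal vectors, so \<open>zeta\<close> is absent from the test.\<close>

lemma para_mean_curvature:
  defines "I \<equiv> (\<lambda>a b. ghat (Dmap (s \<circ> param c') x a) (Dmap (s \<circ> param c') x b))"
  assumes nd: "nondegenerate_form I"
  shows "mean_curvature para_metric sbar c' e x = 0 \<longleftrightarrow>
    (\<forall>w \<in> hor (s (param c' x)). (\<forall>a. ghat w (Dmap (s \<circ> param c') x a) = 0) \<longrightarrow>
      (\<Sum>b\<in>Basis. ghat (hess (s \<circ> param c') x b (sharp I (\<lambda>v. b \<bullet> v))) w) = 0)"
proof -
  let ?G = "local_rep sbar c' e"
  obtain c where p: "para_point c e (local_rep s c' c x)"
    and z: "param c (local_rep s c' c x) = s (param c' x)"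
    and G: "?G x = local_rep proj c e (local_rep s c' c x)"
    and D: "\<And>a. Dmap (s \<circ> param c') x a =
      Dmap (param c) (local_rep s c' c x) (para_point.hl c e (local_rep s c' c x) (Dmap ?G x a))"
    and Q: "\<And>a b w. para_metric e (?G x)
      (hess ?G x a b + christoffel (para_metric e) (?G x) (Dmap ?G x a) (Dmap ?G x b)) w =
      ghat (hess (s \<circ> param c') x a b)
        (Dmap (param c) (local_rep s c' c x) (para_point.hl c e (local_rep s c' c x) w))"
    by (rule para_lift, rule that)
  have lin: "linear (Dmap ?G x)"
    by (rule linear_Dmap[OF smooth_on_differentiable[OF local_rep_smooth(2)[OF sbar c' e] x]])
  interpret para_point c e "local_rep s c' c x" by (rule p)
  have I: "first_form para_metric sbar c' e x = I" unfolding I_def by (rule para_first_form)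
  have "mean_curvature para_metric sbar c' e x = 0 \<longleftrightarrow>
    (\<forall>W. (\<forall>a. para_metric e (?G x) W (Dmap ?G x a) = 0) \<longrightarrow>
       (\<Sum>b\<in>Basis. ghat (hess (s \<circ> param c') x b (sharp (first_form para_metric sbar c' e x) (\<lambda>v. b \<bullet> v)))
          (J (hl W))) = 0)"
  proof (rule mean_curvature_eq_0_iff)
    show "bilinear (para_metric e (?G x))" unfolding G by (rule para_metric_bilinear)
    show "para_metric e (?G x) u v = para_metric e (?G x) v u" for u v unfolding G by (rule para_metric_symmetric)
    show "nondegenerate_form (para_metric e (?G x))" unfolding G by (rule para_metric_nondegenerate)
    show "linear (Dmap ?G x)" by (rule lin)
    show "nondegenerate_form (first_form para_metric sbar c' e x)" unfolding I by (rule nd)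
  qed (rule Q)
  also have "\<dots> \<longleftrightarrow> (\<forall>W. (\<forall>a. ghat (J (hl W)) (Dmap (s \<circ> param c') x a) = 0) \<longrightarrow>
       (\<Sum>b\<in>Basis. ghat (hess (s \<circ> param c') x b (sharp I (\<lambda>v. b \<bullet> v))) (J (hl W))) = 0)"
    unfolding I D G para_metric_eq ..
  also have "\<dots> \<longleftrightarrow> (\<forall>w \<in> hor (s (param c' x)). (\<forall>a. ghat w (Dmap (s \<circ> param c') x a) = 0) \<longrightarrow>
      (\<Sum>b\<in>Basis. ghat (hess (s \<circ> param c') x b (sharp I (\<lambda>v. b \<bullet> v))) w) = 0)"
    (is "?L \<longleftrightarrow> ?R")
  proof
    assume L: ?L
    show ?R
    proof (intro ballI impI)
      fix w assume w: "w \<in> hor (s (param c' x))" "\<forall>a. ghat w (Dmap (s \<circ> param c') x a) = 0"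
      then obtain W where "w = J (hl W)" using hor_hl unfolding z[symmetric] by blast
      then show "(\<Sum>b\<in>Basis. ghat (hess (s \<circ> param c') x b (sharp I (\<lambda>v. b \<bullet> v))) w) = 0"
        using L w(2) by blast
    qed
  next
    assume R: ?R
    have "J (hl W) \<in> hor (s (param c' x))" for W using hl_hor unfolding z .
    then show ?L using R by blast
  qed
  finally show ?thesis .
qed

end

section \<open>Affine spheres\<close>

lemma smooth_vec_scaled:
  assumes "smooth_vec A F" "\<And>c. c \<in> A \<Longrightarrow> open (crange c)"
  shows "smooth_vec A (\<lambda>p. k *\<^sub>R F p)"
  unfolding smooth_vec_def
proof
  fix c assume c: "c \<in> A"
  then have "smooth_on (crange c) (F \<circ> param c)" using assms(1) unfolding smooth_vec_def by blast
  from smooth_on_bounded_linear[OF assms(2)[OF c] bounded_linear_scaleR_right this]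
  have "smooth_on (crange c) (\<lambda>y. k *\<^sub>R (F \<circ> param c) y)" .
  then show "smooth_on (crange c) ((\<lambda>p. k *\<^sub>R F p) \<circ> param c)" by (simp add: comp_def)
qed

locale dual_pair_on =
  fixes A :: "('m::topological_space, real^'n) chart set"
    and B :: "'v::real_normed_vector \<Rightarrow> 'w::real_normed_vector \<Rightarrow> real"
    and f :: "'m \<Rightarrow> 'w" and \<nu> :: "'m \<Rightarrow> 'v"
  assumes manifold: "smooth_manifold (euclidean :: 'm topology) A"
    and pair: "c \<in> A \<Longrightarrow> dual_pair (crange c) B (f \<circ> param c) (\<nu> \<circ> param c)"
begin

lemma flip_on: "dual_pair_on A (\<lambda>w v. B v w) \<nu> f"
  by (rule dual_pair_on.intro[OF manifold dual_pair.flip[OF pair]])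

lemma chart: "c \<in> A \<Longrightarrow> is_chart euclidean c"
  using manifold by (simp add: smooth_manifold_def)

lemma charts_cover: "\<exists>c\<in>A. p \<in> fst c"
proof -
  have "(\<Union>c\<in>A. fst c) = UNIV" using manifold by (simp add: smooth_manifold_def)
  then show ?thesis by blast
qed

lemma dim_of_volume_form: "volume_form (vol :: ('n option \<Rightarrow> 'w) \<Rightarrow> real) \<Longrightarrow> dim (UNIV :: 'w set) = CARD('n option)"
  by (simp add: volume_form_def)

lemma smooth_f: "smooth_vec A f"
  using pair by (auto simp: smooth_vec_def dual_pair_def dual_map_def)

lemma affine_immersion_scaled:
  assumes vol: "volume_form (vol :: ('n option \<Rightarrow> 'w) \<Rightarrow> real)" and k: "k \<noteq> 0"
  shows "affine_immersion A f (\<lambda>p. k *\<^sub>R f p)"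
  unfolding affine_immersion_def
proof (intro conjI ballI)
  show "smooth_vec A f" by (rule smooth_f)
  show "smooth_vec A (\<lambda>p. k *\<^sub>R f p)" by (rule smooth_vec_scaled[OF smooth_f chart_open_crange[OF chart]])
  fix c x assume c: "c \<in> A" and x: "x \<in> crange c"
  show "inj (Dmap (f \<circ> param c) x)" by (rule dual_pair.inj_D_phi[OF pair[OF c] x])
  show "transversal_at (f \<circ> param c) ((\<lambda>p. k *\<^sub>R f p) \<circ> param c) x"
    using dual_pair.transversal[OF pair[OF c] dim_of_volume_form[OF vol] x k] by (simp add: comp_def)
qed

lemma centroaffine:
  assumes vol: "volume_form (vol :: ('n option \<Rightarrow> 'w) \<Rightarrow> real)"
  shows "centroaffine A f"
  using affine_immersion_scaled[OF vol, of 1] by (simp add: centroaffine_def)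

abbreviation "ratio vol c \<equiv> vol_ratio vol B (f \<circ> param c) (\<nu> \<circ> param c)"

text \<open>Vanishing \<open>affine_tau\<close>, a non-degenerate \<open>affine_h\<close> and the
  scalar shape operator with \<open>l = k\<close> hold for every multiple of \<open>f\<close>; the
  volume condition is what remains.\<close>

lemma proper_affine_sphere_iff:
  assumes vol: "volume_form (vol :: ('n option \<Rightarrow> 'w) \<Rightarrow> real)" and k: "k \<noteq> 0"
  shows "proper_affine_sphere vol A f (\<lambda>p. k *\<^sub>R f p) \<longleftrightarrow>
    (\<forall>c\<in>A. \<forall>x\<in>crange c. ratio vol c x * \<bar>k\<bar> ^ (2 * CARD('n) + 4) = 1)"
proof -
  have comp: "(\<lambda>p. k *\<^sub>R f p) \<circ> param c = (\<lambda>y. k *\<^sub>R (f \<circ> param c) y)" for c by (simp add: comp_def)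
  have equi: "equiaffine A f (\<lambda>p. k *\<^sub>R f p)"
    unfolding equiaffine_def comp
    using affine_immersion_scaled[OF vol k] dual_pair.affine_tau_eq[OF pair _ k] by blast
  have nd: "nondegenerate_form (affine_h (f \<circ> param c) (\<lambda>y. k *\<^sub>R (f \<circ> param c) y) x)"
    if c: "c \<in> A" and x: "x \<in> crange c" for c x
  proof -
    have "affine_h (f \<circ> param c) (\<lambda>y. k *\<^sub>R (f \<circ> param c) y) x =
        (\<lambda>a b. pair_metric B (f \<circ> param c) (\<nu> \<circ> param c) x a b / k)"
      by (intro ext) (rule dual_pair.affine_h_eq[OF pair[OF c] dim_of_volume_form[OF vol] x k])
    then show ?thesis
      using dual_pair.nondegenerate[OF pair[OF c] x] k unfolding nondegenerate_form_def by simp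
  qed
  have shape: "\<exists>l. (\<forall>p\<in>(\<Union>c\<in>A. fst c). l p \<noteq> 0) \<and> (\<forall>c\<in>A. \<forall>x\<in>crange c. \<forall>a.
      affine_shape (f \<circ> param c) (\<lambda>y. k *\<^sub>R (f \<circ> param c) y) x a = - l (param c x) *\<^sub>R a)"
    by (rule exI[of _ "\<lambda>p. k"]) (use k dual_pair.affine_shape_eq[OF pair _ k] in blast)
  have bl: "(\<forall>X :: 'n \<Rightarrow> real^'n.
        \<bar>vol (case_option (k *\<^sub>R f (param c x)) (\<lambda>i. Dmap (f \<circ> param c) x (X i)))\<bar> =
        sqrt \<bar>det (\<chi> i j. affine_h (f \<circ> param c) (\<lambda>y. k *\<^sub>R (f \<circ> param c) y) x (X i) (X j))\<bar>) \<longleftrightarrow>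
      ratio vol c x * \<bar>k\<bar> ^ (2 * CARD('n) + 4) = 1"
    if c: "c \<in> A" and x: "x \<in> crange c" for c x
    using dual_pair.blaschke_condition[OF pair[OF c] vol x k] by simp
  show ?thesis
    unfolding proper_affine_sphere_def blaschke_def comp
    using equi shape by (simp only: nd bl simp_thms cong: ball_cong)
qed

text \<open>The volume condition fixes the ratio in terms of \<open>k\<close>, and the derivative of
  the ratio is a positive multiple of the trace.\<close>

lemma trace_zero_of_sphere:
  assumes vol: "volume_form (vol :: ('n option \<Rightarrow> 'w) \<Rightarrow> real)" and sphere: "centroaffine_sphere vol A f"
    and c: "c \<in> A" and x: "x \<in> crange c"
  shows "pair_trace B (f \<circ> param c) (\<nu> \<circ> param c) x a = 0"
proof -
  obtain k where k: "k \<noteq> 0" "proper_affine_sphere vol A f (\<lambda>p. k *\<^sub>R f p)"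
    using sphere by (auto simp: centroaffine_sphere_def)
  have const: "ratio vol c y = inverse (\<bar>k\<bar> ^ (2 * CARD('n) + 4))" if "y \<in> crange c" for y
    using k(2) c that unfolding proper_affine_sphere_iff[OF vol k(1)] by (intro inverse_unique[symmetric]) (simp add: mult.commute)
  have "Dmap (ratio vol c) x = Dmap (\<lambda>y. inverse (\<bar>k\<bar> ^ (2 * CARD('n) + 4))) x"
    by (rule Dmap_cong_open[OF chart_open_crange[OF chart[OF c]] x]) (rule const)
  then have "Dmap (ratio vol c) x a = 0" by (simp add: Dmap_zero)
  moreover have "Dmap (ratio vol c) x a = 2 * ratio vol c x * pair_trace B (f \<circ> param c) (\<nu> \<circ> param c) x a"
    unfolding Dmap_eq[OF dual_pair.has_derivative_vol_ratio[OF pair[OF c] vol x]] ..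
  ultimately show ?thesis using dual_pair.vol_ratio_pos[OF pair[OF c] vol x] by simp
qed

lemma ratio_chart_independent:
  assumes vol: "volume_form (vol :: ('n option \<Rightarrow> 'w) \<Rightarrow> real)" and c: "c \<in> A" and d: "d \<in> A"
    and p: "p \<in> fst c" "p \<in> fst d"
  shows "ratio vol c (snd c p) = ratio vol d (snd d p)"
proof -
  define \<tau> where "\<tau> = local_rep id c d"
  let ?W = "local_dom id c d" and ?x = "snd c p"
  have \<tau>s: "smooth_on ?W \<tau>" using manifold c d by (simp add: smooth_manifold_def \<tau>_def)
  have W: "?W = {y \<in> crange c. param c y \<in> fst d}" by (simp add: local_dom_eq[OF chart[OF c]])
  \<comment> \<open>The atlas gives smoothness of the transition map on this set; openness comes
    from \<open>snd c\<close> being a homeomorphism onto an open set.\<close>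
  have oW: "open ?W"
  proof -
    have "open (fst c)" "open (fst d)" using chart[OF c] chart[OF d] by (simp_all add: is_chart_def)
    then have "openin (subtopology euclidean (fst c)) (fst c \<inter> fst d)" by (simp add: openin_open_Int)
    then have "openin (top_of_set (crange c)) (snd c ` (fst c \<inter> fst d))"
      using homeomorphic_imp_open_map[OF chart_homeo[OF chart[OF c]]] by (auto simp: open_map_def)
    then have "open (snd c ` (fst c \<inter> fst d))"
      using openin_open_trans chart_open_crange[OF chart[OF c]] by blast
    moreover have "?W = snd c ` (fst c \<inter> fst d)" by (simp add: local_dom_def)
    ultimately show ?thesis by simp
  qed
  have xW: "?x \<in> ?W" using p by (simp add: W coord_in_crange[OF chart[OF c]] param_coord[OF chart[OF c]])
  have \<tau>x: "\<tau> ?x = snd d p" by (simp add: \<tau>_def local_rep_def param_coord[OF chart[OF c] p(1)])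
  have pd: "param c y = param d (\<tau> y)" "\<tau> y \<in> crange d" if "y \<in> ?W" for y
    using that W by (auto simp: \<tau>_def local_rep_def param_coord[OF chart[OF d]] coord_in_crange[OF chart[OF d]])
  have \<tau>d: "\<tau> differentiable (at ?x)" by (rule smooth_on_differentiable[OF \<tau>s xW])
  have xd: "\<tau> ?x \<in> crange d" using pd(2)[OF xW] .
  have D: "Dmap (g \<circ> param c) ?x a = Dmap (g \<circ> param d) (\<tau> ?x) (Dmap \<tau> ?x a)"
    if "(g \<circ> param d) differentiable (at (\<tau> ?x))" for g :: "'m \<Rightarrow> 'z::real_normed_vector" and a
  proof -
    have "Dmap (g \<circ> param c) ?x = Dmap (\<lambda>y. (g \<circ> param d) (\<tau> y)) ?x"
      by (rule Dmap_cong_open[OF oW xW]) (simp add: pd(1))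
    then have "Dmap (g \<circ> param c) ?x a = Dmap (\<lambda>y. (g \<circ> param d) (\<tau> y)) ?x a" by (simp only:)
    also have "\<dots> = Dmap (g \<circ> param d) (\<tau> ?x) (Dmap \<tau> ?x a)" by (rule Dmap_compose(2)[OF \<tau>d that])
    finally show ?thesis .
  qed
  have m: "dual_map (crange d) B (f \<circ> param d) (\<nu> \<circ> param d)" using pair[OF d] by (simp add: dual_pair_def)
  have "ratio vol c ?x = ratio vol d (\<tau> ?x)"
  proof (rule dual_pair.vol_ratio_reparametrize[OF pair[OF d] vol xd linear_Dmap[OF \<tau>d]])
    show "(f \<circ> param c) ?x = (f \<circ> param d) (\<tau> ?x)" by (simp add: pd(1)[OF xW])
    show "Dmap (f \<circ> param c) ?x a = Dmap (f \<circ> param d) (\<tau> ?x) (Dmap \<tau> ?x a)" for a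
      by (rule D[OF dual_map.differentiable(1)[OF m xd]])
    show "Dmap (\<nu> \<circ> param c) ?x a = Dmap (\<nu> \<circ> param d) (\<tau> ?x) (Dmap \<tau> ?x a)" for a
      by (rule D[OF dual_map.differentiable(2)[OF m xd]])
    show "gram (pair_metric B (f \<circ> param c) (\<nu> \<circ> param c) ?x) \<noteq> 0"
      by (rule dual_pair.gram_nonzero[OF pair[OF c] coord_in_crange[OF chart[OF c] p(1)]])
  qed
  then show ?thesis by (simp add: \<tau>x)
qed

lemma sphere_of_trace_zero:
  assumes vol: "volume_form (vol :: ('n option \<Rightarrow> 'w) \<Rightarrow> real)" and conn: "connected (UNIV :: 'm set)"
    and trace: "\<And>c x a. c \<in> A \<Longrightarrow> x \<in> crange c \<Longrightarrow> pair_trace B (f \<circ> param c) (\<nu> \<circ> param c) x a = 0"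
  shows "centroaffine_sphere vol A f"
proof -
  define ch where "ch p = (SOME c. c \<in> A \<and> p \<in> fst c)" for p
  have ch: "ch p \<in> A" "p \<in> fst (ch p)" for p
  proof -
    have "\<exists>c. c \<in> A \<and> p \<in> fst c" using charts_cover[of p] by blast
    then have "ch p \<in> A \<and> p \<in> fst (ch p)" unfolding ch_def by (rule someI_ex)
    then show "ch p \<in> A" "p \<in> fst (ch p)" by blast+
  qed
  \<comment> \<open>The charts \<open>ch p\<close> are chosen point by point; chart independence
    allows one fixed chart on a whole neighbourhood, so that \<open>\<rho>\<close> is locally
    constant.\<close>
  define \<rho> where "\<rho> p = ratio vol (ch p) (snd (ch p) p)" for p
  have \<rho>: "\<rho> p = ratio vol c (snd c p)" if "c \<in> A" "p \<in> fst c" for c p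
    unfolding \<rho>_def by (rule ratio_chart_independent[OF vol ch(1) that(1) ch(2) that(2)])
  have const: "\<rho> a = \<rho> b" for a b
  proof (rule connected_local_const[OF conn UNIV_I UNIV_I], rule ballI)
    fix q :: 'm
    obtain c where c: "c \<in> A" "q \<in> fst c" using charts_cover by blast
    have "snd c q \<in> crange c" by (rule coord_in_crange[OF chart[OF c(1)] c(2)])
    then obtain r where r: "r > 0" "ball (snd c q) r \<subseteq> crange c"
      using chart_open_crange[OF chart[OF c(1)]] open_contains_ball by blast
    have der: "(ratio vol c has_derivative (\<lambda>h. 0)) (at y within ball (snd c q) r)" if "y \<in> ball (snd c q) r" for y
    proof -
      have y: "y \<in> crange c" using that r(2) by blast
      show ?thesis
        using has_derivative_at_withinI[OF dual_pair.has_derivative_vol_ratio[OF pair[OF c(1)] vol y]]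
        unfolding trace[OF c(1) y] mult_zero_right .
    qed
    have cst: "ratio vol c y = ratio vol c (snd c q)" if "y \<in> ball (snd c q) r" for y
      by (rule has_derivative_zero_unique[OF convex_ball der that]) (use r(1) in auto)
    define N where "N = fst c \<inter> snd c -` ball (snd c q) r"
    have "open (fst c)" using chart[OF c(1)] by (simp add: is_chart_def)
    moreover have "continuous_on (fst c) (snd c)" using chart_continuous[OF chart[OF c(1)]] by simp
    ultimately have "open N" unfolding N_def by (intro continuous_open_preimage) auto
    moreover have "q \<in> N" using c(2) r(1) by (simp add: N_def)
    moreover have "\<rho> q = \<rho> b" if "b \<in> N" for b
      using cst[of "snd c b"] that \<rho>[OF c(1) c(2)] \<rho>[OF c(1), of b] by (simp add: N_def)
    ultimately show "eventually (\<lambda>b. \<rho> q = \<rho> b) (at q within UNIV)"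
      unfolding eventually_at_topological by blast
  qed
  \<comment> \<open>Any point serves, as \<open>\<rho>\<close> is constant.\<close>
  define v where "v = \<rho> undefined"
  have ratio: "ratio vol c x = v" if "c \<in> A" "x \<in> crange c" for c x
    using \<rho>[OF that(1) param_in_dom[OF chart[OF that(1)] that(2)]] const[of "param c x" undefined]
    unfolding coord_param[OF chart[OF that(1)] that(2)] v_def by (rule trans[OF sym])
  have v: "v > 0"
    unfolding v_def \<rho>_def
    by (rule dual_pair.vol_ratio_pos[OF pair[OF ch(1)] vol coord_in_crange[OF chart[OF ch(1)] ch(2)]])
  \<comment> \<open>Solves \<open>v * k ^ (2 * CARD('n) + 4) = 1\<close>, the volume condition;
    positivity of \<open>v\<close> makes the root positive.\<close>
  define k where "k = root (2 * CARD('n) + 4) (1 / v)"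
  have k: "k > 0" using v by (simp add: k_def)
  have "\<bar>k\<bar> ^ (2 * CARD('n) + 4) = 1 / v"
    unfolding k_def using v by (simp add: real_root_pow_pos2)
  then have "v * \<bar>k\<bar> ^ (2 * CARD('n) + 4) = 1" using v by simp
  then have "ratio vol c x * \<bar>k\<bar> ^ (2 * CARD('n) + 4) = 1" if "c \<in> A" "x \<in> crange c" for c x
    unfolding ratio[OF that] .
  moreover have k0: "k \<noteq> 0" using k by simp
  ultimately have "proper_affine_sphere vol A f (\<lambda>p. k *\<^sub>R f p)"
    unfolding proper_affine_sphere_iff[OF vol k0] by blast
  then have "\<exists>k. k \<noteq> 0 \<and> proper_affine_sphere vol A f (\<lambda>p. k *\<^sub>R f p)" by (intro exI[of _ k] conjI k0)
  then show ?thesis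
    unfolding centroaffine_sphere_def by (rule conjI[OF centroaffine[OF vol]])
qed

end

section \<open>Equivalence of the maximality conditions\<close>

context
  fixes A :: "('m::topological_space, real^'n) chart set"
    and f :: "'m \<Rightarrow> real^('n option)" and \<nu> :: "'m \<Rightarrow> (real^('n option)) \<Rightarrow>\<^sub>L real"
    and c :: "('m, real^'n) chart" and x :: "real^'n"
  assumes man: "smooth_manifold (euclidean :: 'm topology) A"
    and s: "smooth_map A hyp_atlas (\<lambda>p. (- f p, \<nu> p))" and hor: "horizontal A (\<lambda>p. (- f p, \<nu> p))"
    and c: "c \<in> A"
begin

abbreviation (input) "\<Phi> \<equiv> (\<lambda>p. (- f p, \<nu> p)) \<circ> param c"

lemma chart_c: "is_chart euclidean c"
  using man c by (simp add: smooth_manifold_def)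

lemma Phi_smooth: "smooth_on (crange c) \<Phi>"
  by (rule lift_smooth[OF s c chart_c])

lemma components_smooth: "smooth_on (crange c) (f \<circ> param c)" "smooth_on (crange c) (\<nu> \<circ> param c)"
proof -
  have "smooth_on (crange c) (\<lambda>y. - fst (\<Phi> y))"
    by (rule smooth_on_bounded_linear[OF chart_open_crange[OF chart_c] bounded_linear_minus[OF bounded_linear_fst] Phi_smooth])
  then show "smooth_on (crange c) (f \<circ> param c)" by (simp add: comp_def)
  have "smooth_on (crange c) (\<lambda>y. snd (\<Phi> y))"
    by (rule smooth_on_bounded_linear[OF chart_open_crange[OF chart_c] bounded_linear_snd Phi_smooth])
  then show "smooth_on (crange c) (\<nu> \<circ> param c)" by (simp add: comp_def)
qed

lemma Dmap_Phi:
  assumes "y \<in> crange c"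
  shows "Dmap \<Phi> y a = (- Dmap (f \<circ> param c) y a, Dmap (\<nu> \<circ> param c) y a)"
proof -
  note d = smooth_on_differentiable[OF components_smooth(1) assms] smooth_on_differentiable[OF components_smooth(2) assms]
  have "((\<lambda>y. (- (f \<circ> param c) y, (\<nu> \<circ> param c) y)) has_derivative
      (\<lambda>a. (- Dmap (f \<circ> param c) y a, Dmap (\<nu> \<circ> param c) y a))) (at y)"
    by (rule has_derivative_Pair[OF has_derivative_minus[OF Dmap_works[OF d(1)]] Dmap_works[OF d(2)]])
  from Dmap_eq[OF this] show ?thesis by (simp add: comp_def)
qed

lemma hess_Phi:
  assumes "y \<in> crange c"
  shows "hess \<Phi> y a b = (- hess (f \<circ> param c) y a b, hess (\<nu> \<circ> param c) y a b)"
proof -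
  note o = chart_open_crange[OF chart_c]
  note d = smooth_on_differentiable[OF smooth_on_Dmap[OF components_smooth(1)] assms]
    smooth_on_differentiable[OF smooth_on_Dmap[OF components_smooth(2)] assms]
  have 1: "((\<lambda>y. (- Dmap (f \<circ> param c) y b, Dmap (\<nu> \<circ> param c) y b)) has_derivative
      (\<lambda>a. (- hess (f \<circ> param c) y a b, hess (\<nu> \<circ> param c) y a b))) (at y)"
    unfolding hess_def
    by (rule has_derivative_Pair[OF has_derivative_minus[OF Dmap_works[OF d(1)]] Dmap_works[OF d(2)]])
  have 2: "Dmap (\<lambda>y. Dmap \<Phi> y b) y = Dmap (\<lambda>y. (- Dmap (f \<circ> param c) y b, Dmap (\<nu> \<circ> param c) y b)) y"
    by (rule Dmap_cong_open[OF o assms]) (rule Dmap_Phi)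
  show ?thesis unfolding hess_def[of \<Phi>] 2 Dmap_eq[OF 1] ..
qed

lemma Phi_hor: "y \<in> crange c \<Longrightarrow> Dmap \<Phi> y a \<in> hor (- f (param c y), \<nu> (param c y))"
  using hor c by (simp add: horizontal_def)

text \<open>The sign of the first component turns the equation of \<open>hyp\<close> into the
  normalisation of the dual, and the first equation of \<open>hor\<close> is its tangency
  condition.\<close>

lemma dual_map_c: "dual_map (crange c) blinfun_apply (f \<circ> param c) (\<nu> \<circ> param c)"
proof (rule dual_map.intro)
  fix y a assume y: "y \<in> crange c"
  have "(- f (param c y), \<nu> (param c y)) \<in> hyp" by (rule lift_in_hyp[OF s c chart_c y])
  then show "blinfun_apply ((\<nu> \<circ> param c) y) ((f \<circ> param c) y) = 1"
    by (simp add: hyp_def blinfun.minus_right)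
  show "blinfun_apply ((\<nu> \<circ> param c) y) (Dmap (f \<circ> param c) y a) = 0"
    using Phi_hor[OF y, of a] by (simp add: Dmap_Phi[OF y] hor_def blinfun.minus_right)
qed (auto intro: chart_open_crange[OF chart_c] bounded_bilinear_blinfun_apply components_smooth)

lemma induced_metric:
  assumes y: "y \<in> crange c"
  shows "(\<lambda>a b. ghat (Dmap \<Phi> y a) (Dmap \<Phi> y b)) = pair_metric blinfun_apply (f \<circ> param c) (\<nu> \<circ> param c) y"
proof (intro ext)
  fix a b
  show "ghat (Dmap \<Phi> y a) (Dmap \<Phi> y b) = pair_metric blinfun_apply (f \<circ> param c) (\<nu> \<circ> param c) y a b"
    using dual_map.metric_symmetric[OF dual_map_c y, of a b]
    by (simp add: Dmap_Phi[OF y] ghat_def pair_metric_def blinfun.minus_right)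
qed

text \<open>The two pairings of a Hessian with the opposite position vector both equal the metric
  and enter with opposite signs.\<close>

lemma hess_Phi_zeta:
  assumes y: "y \<in> crange c"
  shows "ghat (hess \<Phi> y a b) (zeta (- f (param c y), \<nu> (param c y))) = 0"
  using dual_map.pair_hess_phi[OF dual_map_c y, of a b] dual_map.pair_hess_psi[OF dual_map_c y, of a b]
  by (simp add: hess_Phi[OF y] ghat_def zeta_def blinfun.minus_right blinfun.minus_left)

text \<open>The horizontal normal vectors are exactly the \<open>n a\<close>, and a normal vector
  tangent to \<open>hyp\<close> differs from one of them by a multiple of \<open>zeta\<close>, to
  which \<open>H\<close> is blind. The volume forms supply the dimensions that
  \<open>decompose\<close> asks for.\<close>

lemma normal_trace_iff:
  assumes y: "y \<in> crange c"
    and pair: "dual_pair (crange c) blinfun_apply (f \<circ> param c) (\<nu> \<circ> param c)"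
    and vol: "volume_form (vol :: ('n option \<Rightarrow> real^('n option)) \<Rightarrow> real)"
    and vol': "volume_form (vol' :: ('n option \<Rightarrow> (real^('n option)) \<Rightarrow>\<^sub>L real) \<Rightarrow> real)"
  defines "H \<equiv> (\<lambda>w. \<Sum>b\<in>Basis. ghat (hess \<Phi> y b (sharp (\<lambda>a b. ghat (Dmap \<Phi> y a) (Dmap \<Phi> y b)) (\<lambda>v. b \<bullet> v))) w)"
  shows "(\<forall>w \<in> hor (- f (param c y), \<nu> (param c y)). (\<forall>a. ghat w (Dmap \<Phi> y a) = 0) \<longrightarrow> H w = 0) \<longleftrightarrow>
      (\<forall>a. pair_trace blinfun_apply (f \<circ> param c) (\<nu> \<circ> param c) y a = 0)" (is "?hor \<longleftrightarrow> ?trace")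
    and "(\<forall>w. ghat (- f (param c y), \<nu> (param c y)) w = 0 \<longrightarrow> (\<forall>a. ghat w (Dmap \<Phi> y a) = 0) \<longrightarrow> H w = 0) \<longleftrightarrow>
      (\<forall>a. pair_trace blinfun_apply (f \<circ> param c) (\<nu> \<circ> param c) y a = 0)" (is "?tan \<longleftrightarrow> ?trace")
proof -
  let ?z = "(- f (param c y), \<nu> (param c y))"
  let ?g = "pair_metric blinfun_apply (f \<circ> param c) (\<nu> \<circ> param c) y"
  let ?\<phi> = "f \<circ> param c" and ?\<psi> = "\<nu> \<circ> param c"
  define n where "n a = (Dmap ?\<phi> y a, Dmap ?\<psi> y a)" for a
  note dm = dual_map_c
  have z: "?z \<in> hyp" by (rule lift_in_hyp[OF s c chart_c y])
  have n_hor: "n a \<in> hor ?z" for a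
    using dual_map.pair_tangent[OF dm y, of a] dual_map.pair_cotangent[OF dm y, of a]
    by (simp add: n_def hor_def blinfun.minus_right)
  have n_normal: "ghat (n a) (Dmap \<Phi> y b) = 0" for a b
    using dual_map.metric_symmetric[OF dm y, of a b]
    by (simp add: n_def Dmap_Phi[OF y] ghat_def pair_metric_def blinfun.minus_right)
  \<comment> \<open>Horizontality puts each component of \<open>w\<close> into the image of one of
    the two differentials; orthogonality to the immersion and non-degeneracy then force the two
    preimages to agree.\<close>
  have n_ex: "\<exists>a. w = n a" if w: "w \<in> hor ?z" and wn: "\<And>a. ghat w (Dmap \<Phi> y a) = 0" for w
  proof -
    have w0: "blinfun_apply (?\<psi> y) (fst w) = 0" "blinfun_apply (snd w) (?\<phi> y) = 0"
      using w by (simp_all add: hor_def blinfun.minus_right)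
    obtain a where a: "fst w = Dmap ?\<phi> y a"
      using dual_pair.decompose[OF pair _ y, of "fst w"] vol w0(1) by (auto simp: volume_form_def)
    obtain b where b: "snd w = Dmap ?\<psi> y b"
      using dual_pair.decompose[OF dual_pair.flip[OF pair] _ y, of "snd w"] vol' w0(2) by (auto simp: volume_form_def)
    have "?g a v = ?g b v" for v
      using wn[of v] dual_map.metric_symmetric[OF dm y, of a v]
      by (simp add: Dmap_Phi[OF y] ghat_def a b pair_metric_def blinfun.minus_right)
    then have "a = b"
      by (rule nondegenerate_eqI[OF dual_map.bilinear_metric[OF dm y] dual_pair.nondegenerate[OF pair y]])
    then show ?thesis using a b by (auto simp: n_def prod_eq_iff)
  qed
  have H: "H (n a) = pair_trace blinfun_apply ?\<phi> ?\<psi> y a / 2" for a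
    unfolding H_def induced_metric[OF y] pair_trace_def sum_divide_distrib
    by (rule sum.cong) (simp_all add: hess_Phi[OF y] n_def ghat_def pair_cubic_def blinfun.minus_right)
  show hor_iff': "?hor \<longleftrightarrow> ?trace"
  proof
    assume h: ?hor
    show ?trace
    proof
      fix a
      have "H (n a) = 0" using h n_hor n_normal by blast
      then show "pair_trace blinfun_apply ?\<phi> ?\<psi> y a = 0" using H[of a] by simp
    qed
  next
    assume t: ?trace
    have "H (n a) = 0" for a using t H[of a] by simp
    then show ?hor using n_ex by blast
  qed
  have Hz: "H (w + r *\<^sub>R zeta ?z) = H w" for w r
    unfolding H_def by (rule sum.cong) (simp_all add: ghat_simps hess_Phi_zeta[OF y])
  have "?tan \<longleftrightarrow> ?hor"
  proof
    assume h: ?tan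
    then show ?hor by (auto simp: hor_iff)
  next
    assume h: ?hor
    show ?tan
    proof (intro allI impI)
      fix w assume w: "ghat ?z w = 0" "\<forall>a. ghat w (Dmap \<Phi> y a) = 0"
      define r where "r = ghat (zeta ?z) w"
      define w' where "w' = w - r *\<^sub>R zeta ?z"
      have "w' \<in> hor ?z"
        using w(1) by (simp add: w'_def hor_iff ghat_simps ghat_zeta_self ghat_zeta[OF z] r_def)
      moreover have "ghat w' (Dmap \<Phi> y a) = 0" for a
        using w(2) Phi_hor[OF y, of a] by (simp add: w'_def hor_iff ghat_simps)
      ultimately have "H w' = 0" using h by blast
      moreover have "w = w' + r *\<^sub>R zeta ?z" by (simp add: w'_def)
      ultimately show "H w = 0" using Hz by metis
    qed
  qed
  then show "?tan \<longleftrightarrow> ?trace" using hor_iff' by blast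
qed

end

theorem corollaryD:
  fixes A :: "('m::topological_space, real^'n) chart set"
    and sbar :: "'m \<Rightarrow> 'n amb set"
    and f :: "'m \<Rightarrow> real^('n option)"
    and \<nu> :: "'m \<Rightarrow> (real^('n option)) \<Rightarrow>\<^sub>L real"
    and vol :: "('n option \<Rightarrow> real^('n option)) \<Rightarrow> real"
    and vol' :: "('n option \<Rightarrow> (real^('n option)) \<Rightarrow>\<^sub>L real) \<Rightarrow> real"
  assumes "smooth_manifold (euclidean :: 'm topology) A"
    and "connected (UNIV :: 'm set)"
    and "simply_connected (UNIV :: 'm set)"
    and "nondegenerate_immersion A para_atlas para_metric sbar"
    and "lagrangian A sbar"
    and "horizontal_lift A sbar (\<lambda>p. (- f p, \<nu> p))"
    and "volume_form vol"
    and "volume_form vol'"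
  shows "centroaffine A f \<and> centroaffine A \<nu> \<and>
         is_dual A f \<nu> \<and> is_dual A \<nu> (\<lambda>p. Blinfun (\<lambda>\<alpha>. blinfun_apply \<alpha> (f p))) \<and>
         (maximal A para_atlas para_metric sbar \<longleftrightarrow>
          maximal A hyp_atlas hyp_metric (\<lambda>p. (- f p, \<nu> p))) \<and>
         (maximal A hyp_atlas hyp_metric (\<lambda>p. (- f p, \<nu> p)) \<longleftrightarrow>
          centroaffine_sphere vol A f \<and> centroaffine_sphere vol' A \<nu>)"
proof -
  note man = assms(1) and conn = assms(2) and nd = assms(4) and vol = assms(7) and vol' = assms(8)
  let ?s = "\<lambda>p. (- f p, \<nu> p)"
  let ?g = "\<lambda>c y a b. ghat (Dmap (?s \<circ> param c) y a) (Dmap (?s \<circ> param c) y b)"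
  have s: "smooth_map A hyp_atlas ?s" and hor: "horizontal A ?s"
    and proj: "\<And>p. p \<in> (\<Union>c\<in>A. fst c) \<Longrightarrow> proj (?s p) = sbar p"
    using assms(6) by (auto simp: horizontal_lift_def)
  have sbar: "smooth_map A para_atlas sbar" using nd by (simp add: nondegenerate_immersion_def)
  have chart: "is_chart euclidean c" if "c \<in> A" for c using man that by (simp add: smooth_manifold_def)
  have cover: "\<exists>c\<in>A. p \<in> fst c" for p
  proof -
    have "(\<Union>c\<in>A. fst c) = UNIV" using man by (simp add: smooth_manifold_def)
    then show ?thesis by blast
  qed
  note dm = dual_map_c[OF man s hor]
  have phor: "Dmap (?s \<circ> param c) y a \<in> hor (?s (param c y))" if "c \<in> A" "y \<in> crange c" for c y a
    using Phi_hor[OF man s hor that] .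
  have pproj: "proj (?s p) = sbar p" if "c \<in> A" "p \<in> fst c" for c p using proj that by blast
  have ff: "first_form para_metric sbar c e y = ?g c y" if "c \<in> A" "e \<in> para_atlas" "y \<in> local_dom sbar c e" for c e y
    by (rule para_first_form[OF s sbar that(1) chart[OF that(1)] pproj[OF that(1)] phor[OF that(1)] that(2,3)])
  \<comment> \<open>Non-degeneracy passes from \<open>sbar\<close> to its lift because both induce
    the same metric.\<close>
  have g_nd: "nondegenerate_form (?g c y)" if c: "c \<in> A" and y: "y \<in> crange c" for c y
  proof -
    obtain e where e: "e \<in> para_atlas" "y \<in> local_dom sbar c e" using smooth_map_covers[OF sbar c chart[OF c] y] .
    then have "nondegenerate_form (first_form para_metric sbar c e y)"
      using nd c by (auto simp: nondegenerate_immersion_def)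
    then show ?thesis unfolding ff[OF c e] .
  qed
  have pair: "dual_pair (crange c) blinfun_apply (f \<circ> param c) (\<nu> \<circ> param c)" if c: "c \<in> A" for c
    using dm[OF c] g_nd[OF c] by (intro dual_pair.intro dual_pair_axioms.intro) (simp_all add: induced_metric[OF man s hor c])
  interpret pf: dual_pair_on A blinfun_apply f \<nu> using man pair by (rule dual_pair_on.intro)
  interpret pn: dual_pair_on A "\<lambda>w v. blinfun_apply v w" \<nu> f by (rule pf.flip_on)
  let ?tr = "\<lambda>c y. \<forall>a. pair_trace blinfun_apply (f \<circ> param c) (\<nu> \<circ> param c) y a = 0"
  let ?trace = "\<forall>c\<in>A. \<forall>y\<in>crange c. ?tr c y"
  have in_crange: "y \<in> crange c" if "c \<in> A" "y \<in> local_dom F c d" for c y d and F :: "'m \<Rightarrow> 'z"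
    using that(2) by (simp add: local_dom_eq[OF chart[OF that(1)]])
  have mc_para: "mean_curvature para_metric sbar c e y = 0 \<longleftrightarrow>
      ?tr c y"
    if c: "c \<in> A" and e: "e \<in> para_atlas" "y \<in> local_dom sbar c e" for c e y
    using para_mean_curvature[OF s sbar c chart[OF c] pproj[OF c] phor[OF c] e g_nd[OF c in_crange[OF c e(2)]]]
      normal_trace_iff(1)[OF man s hor c in_crange[OF c e(2)] pair[OF c] vol vol'] by simp
  have mc_hyp: "mean_curvature hyp_metric ?s c d y = 0 \<longleftrightarrow>
      ?tr c y"
    if c: "c \<in> A" and d: "d \<in> hyp_atlas" "y \<in> local_dom ?s c d" for c d y
    using hyp_mean_curvature[OF s c chart[OF c] d g_nd[OF c in_crange[OF c d(2)]]]
      normal_trace_iff(2)[OF man s hor c in_crange[OF c d(2)] pair[OF c] vol vol'] by simp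
  have "maximal A para_atlas para_metric sbar \<longleftrightarrow> ?trace"
  proof
    assume m: "maximal A para_atlas para_metric sbar"
    show ?trace
    proof (intro ballI)
      fix c y assume c: "c \<in> A" and y: "y \<in> crange c"
      obtain e where e: "e \<in> para_atlas" "y \<in> local_dom sbar c e" using smooth_map_covers[OF sbar c chart[OF c] y] .
      have "mean_curvature para_metric sbar c e y = 0" using m c e unfolding maximal_def by blast
      then show "?tr c y"
        unfolding mc_para[OF c e] .
    qed
  next
    assume ?trace
    then show "maximal A para_atlas para_metric sbar"
      unfolding maximal_def using nd mc_para in_crange by blast
  qed
  moreover have "maximal A hyp_atlas hyp_metric ?s \<longleftrightarrow> ?trace"
  proof
    assume m: "maximal A hyp_atlas hyp_metric ?s"
    show ?trace
    proof (intro ballI)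
      fix c y assume c: "c \<in> A" and y: "y \<in> crange c"
      obtain d where d: "d \<in> hyp_atlas" "y \<in> local_dom ?s c d" using smooth_map_covers[OF s c chart[OF c] y] .
      have "mean_curvature hyp_metric ?s c d y = 0" using m c d unfolding maximal_def by blast
      then show "?tr c y"
        unfolding mc_hyp[OF c d] .
    qed
  next
    assume t: ?trace
    have "inj (Dmap (local_rep ?s c d) y) \<and> nondegenerate_form (first_form hyp_metric ?s c d y)"
      if c: "c \<in> A" and d: "d \<in> hyp_atlas" "y \<in> local_dom ?s c d" for c d y
    proof
      have y: "y \<in> crange c" by (rule in_crange[OF c d(2)])
      show "nondegenerate_form (first_form hyp_metric ?s c d y)"
        unfolding hyp_first_form[OF s c chart[OF c] d] by (rule g_nd[OF c y])
      show "inj (Dmap (local_rep ?s c d) y)"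
      proof (rule injI)
        fix a b assume "Dmap (local_rep ?s c d) y a = Dmap (local_rep ?s c d) y b"
        then have "Dmap (?s \<circ> param c) y a = Dmap (?s \<circ> param c) y b"
          unfolding lift_derivatives(1)[OF s c chart[OF c] d] by simp
        then have "Dmap (f \<circ> param c) y a = Dmap (f \<circ> param c) y b"
          unfolding Dmap_Phi[OF man s hor c y] by simp
        then show "a = b" by (rule injD[OF dual_pair.inj_D_phi[OF pair[OF c] y]])
      qed
    qed
    then show "maximal A hyp_atlas hyp_metric ?s"
      unfolding maximal_def nondegenerate_immersion_def using s t mc_hyp in_crange by blast
  qed
  moreover have "centroaffine_sphere vol A f \<and> centroaffine_sphere vol' A \<nu> \<longleftrightarrow> ?trace"
  proof
    assume "centroaffine_sphere vol A f \<and> centroaffine_sphere vol' A \<nu>"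
    then show ?trace using pf.trace_zero_of_sphere[OF vol] by blast
  next
    assume t: ?trace
    have "centroaffine_sphere vol A f" by (rule pf.sphere_of_trace_zero[OF vol conn]) (use t in blast)
    moreover have "centroaffine_sphere vol' A \<nu>"
    proof (rule pn.sphere_of_trace_zero[OF vol' conn])
      fix c y a assume c: "c \<in> A" and y: "y \<in> crange c"
      show "pair_trace (\<lambda>w v. blinfun_apply v w) (\<nu> \<circ> param c) (f \<circ> param c) y a = 0"
        unfolding dual_pair.trace_flip[OF pair[OF c] y] using t c y by simp
    qed
    ultimately show "centroaffine_sphere vol A f \<and> centroaffine_sphere vol' A \<nu>" by blast
  qed
  moreover have "is_dual A f \<nu> \<and> is_dual A \<nu> (\<lambda>p. Blinfun (\<lambda>\<alpha>. blinfun_apply \<alpha> (f p)))"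
  proof -
    have one: "blinfun_apply (\<nu> p) (f p) = 1" for p
    proof -
      obtain c where c: "c \<in> A" "p \<in> fst c" using cover by blast
      show ?thesis
        using dual_map.pair_one[OF dm[OF c(1)] coord_in_crange[OF chart[OF c(1)] c(2)]]
        by (simp add: param_coord[OF chart[OF c(1)] c(2)])
    qed
    \<comment> \<open>The value of \<open>Blinfun\<close> is specified only on bounded linear
      functions, so evaluation at \<open>f p\<close> has to be recognised as one before it can be
      unfolded.\<close>
    have ev: "blinfun_apply (Blinfun (\<lambda>\<alpha>. blinfun_apply \<alpha> (f p))) = (\<lambda>\<alpha>. blinfun_apply \<alpha> (f p))" for p
      by (rule bounded_linear_Blinfun_apply)
        (rule bounded_bilinear.bounded_linear_left[OF bounded_bilinear_blinfun_apply])
    show ?thesis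
      unfolding is_dual_def ev
      using one dual_map.pair_tangent[OF dm] dual_map.pair_cotangent[OF dm] by simp
  qed
  ultimately show ?thesis
    using pf.centroaffine[OF vol] pn.centroaffine[OF vol'] by blast
qed

end
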